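(* Let $d\ge 1$ and $T>0$. Let $f\in W^{1,\infty}(\mathbb{R},\mathbb{R}^d)$ with $f(0)=0$; let $A\in W^{1,\infty}(\mathbb{R})$ be nondecreasing with $A(0)=0$; let $u_0\in L^\infty(\mathbb{R}^d)\cap L^1(\mathbb{R}^d)\cap BV(\mathbb{R}^d)$; and let $\mu$ be a nonnegative Radon measure on $\mathbb{R}^d\setminus\{0\}$ with $\int_{\mathbb{R}^d\setminus\{0\}}|z|^2\wedge 1\,\mathrm{d}\mu(z)<+\infty$. Let $u$ be the entropy solution of $$\partial_t u+\mathrm{div} f(u)=\mathcal{L}^\mu[A(u)]\ \text{ in } Q_T,\qquad u(\cdot,0)=u_0,$$ and let $v\in L^\infty(Q_T)\cap C([0,T];L^1(\mathbb{R}^d))$ with $v(0)=v_0$. Then for all $r>0$, $\epsilon>0$ and $0<\delta<T$, $$\begin{aligned} &\|u(T)-v(T)\|_{L^1(\mathbb{R}^d)}\\ &\le \|u_0-v_0\|_{L^1(\mathbb{R}^d)}+\epsilon\, C_{\tilde\theta}\,|u_0|_{BV(\mathbb{R}^d)}+2\,\max\{\omega_u(\delta),\omega_v(\delta)\}\\ &\quad-\iint_{Q_T^2}|v(x,t)-u(y,s)|\,\partial_t\phi^{\epsilon,\delta}(x,t,y,s)\,\mathrm{d}w\\ &\quad-\iint_{Q_T^2}\Big(q_f(v(x,t),u(y,s))+b_r^{\mu^\ast}\,|A(v(x,t))-A(u(y,s))|\Big)\cdot D_x\phi^{\epsilon,\delta}(x,t,y,s)\,\mathrm{d}w\\ &\quad+\iint_{Q_T^2}|A(v(x,t))-A(u(y,s))|\,\mathcal{L}^{\mu^\ast}_r[\phi^{\epsilon,\delta}(x,t,\cdot,s)](y)\,\mathrm{d}w\\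 &\quad-\iint_{Q_T^2}\mathrm{sgn}(v(x,t)-u(y,s))\,\mathcal{L}^{\mu,r}[A(u(\cdot,s))](y)\,\phi^{\epsilon,\delta}(x,t,y,s)\,\mathrm{d}w\\ &\quad+\iint_{\mathbb{R}^d\times Q_T}|v(x,T)-u(y,s)|\,\phi^{\epsilon,\delta}(x,T,y,s)\,\mathrm{d}x\,\mathrm{d}y\,\mathrm{d}s\\ &\quad-\iint_{\mathbb{R}^d\times Q_T}|v_0(x)-u(y,s)|\,\phi^{\epsilon,\delta}(x,0,y,s)\,\mathrm{d}x\,\mathrm{d}y\,\mathrm{d}s, \end{aligned}$$ where $\mathrm{d}w=\mathrm{d}x\,\mathrm{d}t\,\mathrm{d}y\,\mathrm{d}s$ and $C_{\tilde\theta}=2\int_{\mathbb{R}^d}|x|\,\tilde\theta_d(x)\,\mathrm{d}x$.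
   Context: Notation: $Q_T=\mathbb{R}^d\times(0,T)$; $a\wedge b=\min\{a,b\}$; $|\cdot|$ is the Euclidean norm; $|\cdot|_{BV(\mathbb{R}^d)}$ is the total variation semi-norm; $D$ is the gradient in $x$; $\mathrm{sgn}(u)=\pm1$ if $\pm u>0$ and $\mathrm{sgn}(0)=0$. Operators. For a nonnegative Radon measure $\mu$ on $\mathbb{R}^d\setminus\{0\}$ with $\int |z|^2\wedge 1\,\mathrm{d}\mu<\infty$ (a Lévy measure), and $r>0$: $\mathcal{L}^\mu[\phi](x)=\int_{\mathbb{R}^d\setminus\{0\}}\phi(x+z)-\phi(x)-z\cdot D\phi(x)\mathbf{1}_{|z|\le1}\,\mathrm{d}\mu(z)$, $\mathcal{L}^\mu_r[\phi](x)=\int_{0<|z|\le r}\phi(x+z)-\phi(x)-z\cdot D\phi(x)\mathbf{1}_{|z|\le1}\,\mathrm{d}\mu(z)$, $b^\mu_r=-\int_{|z|>r}z\,\mathbf{1}_{|z|\le1}\,\mathrm{d}\mu(z)$, $\mathcal{L}^{\mu,r}[\phi](x)=\int_{|z|>r}\phi(x+z)-\phi(x)\,\mathrm{d}\mu(z)$. The dual measure $\mu^\ast$ is defined by $\int\phi(z)\,\mathrm{d}\mu^\ast(z)=\int\phi(-z)\,\mathrm{d}\mu(z)$. The entropy flux is $q_f(u,k)=\mathrm{sgn}(u-k)(f(u)-f(k))$. Entropy solution: a function $u\in L^\infty(Q_T)\cap C([0,T];L^1(\mathbb{R}^d))$ such that for all $k\in\mathbb{R}$, all $r>0$ and all nonnegative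 $\phi\in C_c^\infty(\mathbb{R}^{d+1})$, $$\begin{aligned}&\int_{Q_T}|u-k|\,\partial_t\phi+\big(q_f(u,k)+b_r^{\mu^\ast}|A(u)-A(k)|\big)\cdot D\phi\,\mathrm{d}x\,\mathrm{d}t\\&+\int_{Q_T}|A(u)-A(k)|\,\mathcal{L}^{\mu^\ast}_r[\phi]+\mathrm{sgn}(u-k)\,\mathcal{L}^{\mu,r}[A(u)]\,\phi\,\mathrm{d}x\,\mathrm{d}t\\&-\int_{\mathbb{R}^d}|u(x,T)-k|\,\phi(x,T)\,\mathrm{d}x+\int_{\mathbb{R}^d}|u_0(x)-k|\,\phi(x,0)\,\mathrm{d}x\ge0.\end{aligned}$$ Under the stated assumptions on $(f,A,u_0,\mu)$ it is known that there is exactly one entropy solution. Test function: $\phi^{\epsilon,\delta}(x,t,y,s)=\theta_\delta(t-s)\,\bar\theta_\epsilon(x-y)$ with $\theta_\delta(t)=\frac1\delta\tilde\theta_1(\frac t\delta)$ and $\bar\theta_\epsilon(x)=\frac1{\epsilon^d}\tilde\theta_d(\frac x\epsilon)$, where for $n=1$ and $n=d$ the kernel $\tilde\theta_n\in C_c^\infty(\mathbb{R}^n)$ satisfies $\tilde\theta_n\ge0$, $\mathrm{supp}\,\tilde\theta_n\subseteq\{|x|<1\}$ and $\int_{\mathbb{R}^n}\tilde\theta_n\,\mathrm{d}x=1$. $\omega_u(\delta)$ and $\omega_v(\delta)$ are the moduli of continuity of $u$ and $v$ as elements of $C([0,T];L^1(\mathbb{R}^d))$, i.e. $\omega_u(\delta)=\sup\{\|u(t)-u(s)\|_{L^1(\mathbb{R}^d)}: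 t,s\in[0,T],\ |t-s|\le\delta\}$. *)

theory Defs
  imports "HOL-Analysis.Analysis"
begin

section \<open>Smooth functions, gradients, test functions\<close>

text \<open>Continuously differentiable of order \<open>k\<close> on the whole space, through iterated partial
  derivatives.\<close>

fun Ck :: "nat \<Rightarrow> ('a::euclidean_space \<Rightarrow> 'b::real_normed_vector) \<Rightarrow> bool" where
  "Ck 0 f \<longleftrightarrow> continuous_on UNIV f"
| "Ck (Suc k) f \<longleftrightarrow>
     (\<forall>x. f differentiable (at x)) \<and> (\<forall>b\<in>Basis. Ck k (\<lambda>x. frechet_derivative f (at x) b))"

definition support :: "('a::topological_space \<Rightarrow> 'b::real_normed_vector) \<Rightarrow> 'a set" where
  "support f = closure (support_on UNIV f)"

definition Cc_infinity :: "('a::euclidean_space \<Rightarrow> real) set" where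
  "Cc_infinity = {\<phi>. (\<forall>k. Ck k \<phi>) \<and> compact (support \<phi>)}"

definition grad :: "('a::euclidean_space \<Rightarrow> real) \<Rightarrow> 'a \<Rightarrow> 'a" where
  "grad \<phi> x = (THE D. GDERIV \<phi> x :> D)"

definition divergence :: "('a::euclidean_space \<Rightarrow> 'a) \<Rightarrow> 'a \<Rightarrow> real" where
  "divergence \<psi> x = (\<Sum>b\<in>Basis. frechet_derivative \<psi> (at x) b \<bullet> b)"


section \<open>Function spaces\<close>

text \<open>Elements of Lebesgue spaces are represented by Borel functions: \<open>lborel\<close> is the
  Lebesgue measure on the Borel sets. Borel (rather than Lebesgue measurable) representatives are
  needed for the nonlocal operators, which integrate \<open>z \<mapsto> u (x + z)\<close> against a
  measure that may be singular.\<close>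

definition L_infinity :: "'a measure \<Rightarrow> ('a \<Rightarrow> 'b::euclidean_space) \<Rightarrow> bool" where
  "L_infinity M f \<longleftrightarrow> f \<in> borel_measurable M \<and> (\<exists>C. AE x in M. norm (f x) \<le> C)"

abbreviation L1_norm :: "('a::euclidean_space \<Rightarrow> real) \<Rightarrow> real" where
  "L1_norm g \<equiv> LINT x|lborel. \<bar>g x\<bar>"

definition weak_derivative :: "(real \<Rightarrow> 'b::euclidean_space) \<Rightarrow> (real \<Rightarrow> 'b) \<Rightarrow> bool" where
  "weak_derivative f g \<longleftrightarrow>
     (\<forall>\<phi>\<in>Cc_infinity. (LINT x|lborel. deriv \<phi> x *\<^sub>R f x) = - (LINT x|lborel. \<phi> x *\<^sub>R g x))"

text \<open>\<open>W\<^sup>1\<^sup>,\<^sup>\<infinity>(\<real>)\<close>. Members are evaluated pointwise (as in \<open>f(0) = 0\<close> and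
  \<open>f(u)\<close>), so \<open>f\<close> is the continuous representative of its class.\<close>

definition W1_infinity :: "(real \<Rightarrow> 'b::euclidean_space) \<Rightarrow> bool" where
  "W1_infinity f \<longleftrightarrow> continuous_on UNIV f \<and> L_infinity lborel f \<and>
     (\<exists>g. L_infinity lborel g \<and> weak_derivative f g)"

definition total_variation :: "('a::euclidean_space \<Rightarrow> real) \<Rightarrow> ereal" where
  "total_variation u =
     (SUP \<psi> \<in> {\<psi>. Ck 1 \<psi> \<and> compact (support \<psi>) \<and> (\<forall>x. norm (\<psi> x) \<le> 1)}.
        ereal (LINT x|lborel. u x * divergence \<psi> x))"

definition BV_seminorm :: "('a::euclidean_space \<Rightarrow> real) \<Rightarrow> real" where
  "BV_seminorm u = real_of_ereal (total_variation u)"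

text \<open>Functions of \<open>(x, t)\<close> are functions on the product space.\<close>

definition Q :: "real \<Rightarrow> ('a::euclidean_space \<times> real) set" where
  "Q T = UNIV \<times> {0<..<T}"

text \<open>\<open>L\<^sup>\<infinity>(Q\<^sub>T) \<inter> C([0,T]; L\<^sup>1)\<close>. The slice \<open>u (\<cdot>, t)\<close> represents the value at \<open>t\<close> of the
  continuous \<open>L\<^sup>1\<close>-valued curve for every \<open>t \<in> [0,T]\<close>, the end points included.\<close>

definition Linf_C_L1 :: "real \<Rightarrow> ('a::euclidean_space \<times> real \<Rightarrow> real) \<Rightarrow> bool" where
  "Linf_C_L1 T u \<longleftrightarrow> L_infinity (restrict_space lborel (Q T)) u \<and>
     (\<forall>t\<in>{0..T}. integrable lborel (\<lambda>x. u (x, t))) \<and>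
     (\<forall>t\<in>{0..T}. ((\<lambda>s. L1_norm (\<lambda>x. u (x, s) - u (x, t))) \<longlongrightarrow> 0) (at t within {0..T}))"

definition modulus :: "real \<Rightarrow> ('a::euclidean_space \<times> real \<Rightarrow> real) \<Rightarrow> real \<Rightarrow> real" where
  "modulus T u \<delta> =
     Sup {L1_norm (\<lambda>x. u (x, t) - u (x, s)) | t s. t \<in> {0..T} \<and> s \<in> {0..T} \<and> \<bar>t - s\<bar> \<le> \<delta>}"


section \<open>Levy measures and nonlocal operators\<close>

text \<open>Measures on the Borel sets of \<open>\<real>\<^sup>d \<setminus> {0}\<close>. On this space, finiteness on compact sets
  implies the regularity required of a Radon measure.\<close>

definition levy_measure :: "'a::euclidean_space measure \<Rightarrow> bool" where
  "levy_measure \<mu> \<longleftrightarrow> sets \<mu> = sets (restrict_space borel (- {0})) \<and>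
     (\<forall>K. compact K \<and> K \<subseteq> - {0} \<longrightarrow> emeasure \<mu> K < \<infinity>) \<and>
     (\<integral>\<^sup>+ z. ennreal (min ((norm z)\<^sup>2) 1) \<partial>\<mu>) < \<infinity>"

definition dual :: "'a::euclidean_space measure \<Rightarrow> 'a measure" where
  "dual \<mu> = distr \<mu> \<mu> uminus"

definition levy_small :: "'a::euclidean_space measure \<Rightarrow> real \<Rightarrow> ('a \<Rightarrow> real) \<Rightarrow> 'a \<Rightarrow> real" where
  "levy_small \<mu> r \<phi> x =
     (LINT z:{z. 0 < norm z \<and> norm z \<le> r}|\<mu>.
        \<phi> (x + z) - \<phi> x - (z \<bullet> grad \<phi> x) * indicator {z. norm z \<le> 1} z)"

definition levy_drift :: "'a::euclidean_space measure \<Rightarrow> real \<Rightarrow> 'a" where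
  "levy_drift \<mu> r = - (LINT z:{z. norm z > r}|\<mu>. indicat_real {z. norm z \<le> 1} z *\<^sub>R z)"

definition levy_large :: "'a::euclidean_space measure \<Rightarrow> real \<Rightarrow> ('a \<Rightarrow> real) \<Rightarrow> 'a \<Rightarrow> real" where
  "levy_large \<mu> r \<phi> x = (LINT z:{z. norm z > r}|\<mu>. \<phi> (x + z) - \<phi> x)"


section \<open>Entropy solutions\<close>

definition entropy_flux :: "(real \<Rightarrow> 'a::euclidean_space) \<Rightarrow> real \<Rightarrow> real \<Rightarrow> 'a" where
  "entropy_flux f u k = sgn (u - k) *\<^sub>R (f u - f k)"

text \<open>Entropy solutions of \<open>\<partial>\<^sub>t u + div f(u) = L\<^sup>\<mu>[A(u)]\<close> in \<open>Q\<^sub>T\<close> with initial value \<open>u0\<close>.\<close>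

definition entropy_solution ::
  "real \<Rightarrow> (real \<Rightarrow> 'a::euclidean_space) \<Rightarrow> (real \<Rightarrow> real) \<Rightarrow> 'a measure \<Rightarrow> ('a \<Rightarrow> real)
     \<Rightarrow> ('a \<times> real \<Rightarrow> real) \<Rightarrow> bool" where
  "entropy_solution T f A \<mu> u0 u \<longleftrightarrow> Linf_C_L1 T u \<and>
     (\<forall>k. \<forall>r>0. \<forall>\<phi>\<in>Cc_infinity. (\<forall>p. \<phi> p \<ge> 0) \<longrightarrow>
        (LINT (x, t):Q T|lborel.
            \<bar>u (x, t) - k\<bar> * deriv (\<lambda>\<tau>. \<phi> (x, \<tau>)) t
          + (entropy_flux f (u (x, t)) k + \<bar>A (u (x, t)) - A k\<bar> *\<^sub>R levy_drift (dual \<mu>) r)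
              \<bullet> grad (\<lambda>\<xi>. \<phi> (\<xi>, t)) x)
      + (LINT (x, t):Q T|lborel.
            \<bar>A (u (x, t)) - A k\<bar> * levy_small (dual \<mu>) r (\<lambda>\<xi>. \<phi> (\<xi>, t)) x
          + sgn (u (x, t) - k) * levy_large \<mu> r (\<lambda>\<xi>. A (u (\<xi>, t))) x * \<phi> (x, t))
      - (LINT x|lborel. \<bar>u (x, T) - k\<bar> * \<phi> (x, T))
      + (LINT x|lborel. \<bar>u0 x - k\<bar> * \<phi> (x, 0)) \<ge> 0)"


section \<open>The test function of the doubling of variables\<close>

definition mollifier_kernel :: "('a::euclidean_space \<Rightarrow> real) \<Rightarrow> bool" where
  "mollifier_kernel \<theta> \<longleftrightarrow> \<theta> \<in> Cc_infinity \<and> (\<forall>x. \<theta> x \<ge> 0) \<and>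
     support \<theta> \<subseteq> {x. norm x < 1} \<and> (LINT x|lborel. \<theta> x) = 1"

definition rescaled :: "('a::euclidean_space \<Rightarrow> real) \<Rightarrow> real \<Rightarrow> 'a \<Rightarrow> real" where
  "rescaled \<theta> \<epsilon> x = 1 / \<epsilon> ^ DIM('a) * \<theta> (x /\<^sub>R \<epsilon>)"

definition doubling_test ::
  "(real \<Rightarrow> real) \<Rightarrow> ('a::euclidean_space \<Rightarrow> real) \<Rightarrow> real \<Rightarrow> real
     \<Rightarrow> 'a \<Rightarrow> real \<Rightarrow> 'a \<Rightarrow> real \<Rightarrow> real" where
  "doubling_test \<theta>1 \<theta>d \<epsilon> \<delta> x t y s = rescaled \<theta>1 \<delta> (t - s) * rescaled \<theta>d \<epsilon> (x - y)"

end

theory Submission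
  imports Defs
begin

text \<open>The entropy inequality of \<open>u\<close> in \<open>(y, s)\<close>, with \<open>k = v (x, t)\<close> and the doubling test function,
  is integrated over \<open>(x, t)\<close>. Everything in sight is globally integrable, so no spatial cutoff is
  needed. The boundary terms are averages in time of
  \<open>P K g w = \<integral>\<integral> \<bar>g y - w x\<bar> K (x - y) dx dy\<close>, which is 1-Lipschitz in \<open>g\<close> and in \<open>w\<close> for the
  \<open>L\<^sup>1\<close> norm; the weights at each end of the time interval sum to 1. This reduces the claim to
  \<open>P K (u T) (u T) \<le> P K u\<^sub>0 u\<^sub>0\<close>, since \<open>P K u\<^sub>0 u\<^sub>0\<close> is bounded by the total variation of \<open>u\<^sub>0\<close>.
  That inequality is Kruzkov's argument for \<open>u\<close> against itself with the spatial kernel \<open>K\<close> kept fixed: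
  adding the two doubled inequalities, the first-order terms cancel because \<open>K\<close> depends on \<open>x - y\<close>
  only, the small jumps disappear as \<open>r \<rightarrow> 0\<close>, and the large jumps have a favourable sign because
  \<open>A\<close> is monotone. Letting the time mollification tend to 0 uses \<open>u 0 = u\<^sub>0\<close>, which is not part of the
  definition of an entropy solution and is recovered from the inequality by shrinking a cutoff
  at the initial time.\<close>

section \<open>Smooth functions\<close>

text \<open>The definition of an entropy solution provides no BV bound on \<open>u (., T)\<close>;
  only \<open>u0\<close> is assumed to have one. Passing from the mollified distance to the L^1 norm
  at time \<open>T\<close> can therefore not rest on a translation estimate for
  \<open>u (., T)\<close>. The self-distance \<open>P K (u T) (u T)\<close> takes its place: it is
  compared with that of \<open>u0\<close> for one fixed kernel \<open>K\<close>, without sending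
  \<epsilon> to 0. The factor 2 in \<open>C\<theta>\<close> arises because \<open>P K u0 u0\<close>
  is paid twice, once at time \<open>T\<close> and once in bounding \<open>P K u0 v0\<close> by the
  L^1 norm of \<open>u0 - v0\<close>. The kernels are not assumed even. At each end of the time
  interval the mass of the time mollifier splits into two parts: one weights the term in which
  \<open>u\<close> is frozen at the end point, the other the term in which \<open>v\<close> is. The
  errors \<open>\<omega>u\<close> and \<open>\<omega>v\<close> thus enter as a convex combination,
  so each end costs a single maximum of the moduli, and the two ends together give the factor 2 in
  front of it.\<close>

lemma Ck_imp_continuous: "Ck k f \<Longrightarrow> continuous_on UNIV f"
  by (cases k) (auto intro!: differentiable_imp_continuous_on simp: differentiable_on_def)

lemma Ck_Suc_imp_Ck: "Ck (Suc k) f \<Longrightarrow> Ck k f"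
proof (induction k arbitrary: f)
  case 0
  then show ?case using Ck_imp_continuous[of "Suc 0" f] by simp
next
  case (Suc k)
  have "f differentiable (at x)" for x using Suc.prems by (subst (asm) Ck.simps(2)) blast
  moreover have "Ck (Suc k) (\<lambda>x. frechet_derivative f (at x) b)" if "b \<in> Basis" for b
    using Suc.prems that by (subst (asm) Ck.simps(2)) blast
  ultimately show ?case by (subst Ck.simps(2)) (blast intro: Suc.IH)
qed

lemma Ck_const [simp]: "Ck k (\<lambda>x. c)"
  by (induction k arbitrary: c) simp_all

lemma Ck_has_derivative:
  "Ck (Suc k) f \<Longrightarrow> (f has_derivative frechet_derivative f (at x)) (at x)"
  using frechet_derivative_works by auto

lemma Ck_SucI:
  assumes "\<And>x. (f has_derivative f' x) (at x)" "\<And>b. b \<in> Basis \<Longrightarrow> Ck k (\<lambda>x. f' x b)"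
  shows "Ck (Suc k) f"
proof -
  have "frechet_derivative f (at x) = f' x" for x
    using assms(1)[of x] frechet_derivative_at by metis
  with assms show ?thesis
    by (auto simp: differentiable_def)
qed

lemma Ck_partial: "Ck (Suc k) f \<Longrightarrow> b \<in> Basis \<Longrightarrow> Ck k (\<lambda>x. frechet_derivative f (at x) b)"
  by simp

lemma Ck_bounded_linear:
  assumes L: "bounded_linear L"
  shows "Ck k f \<Longrightarrow> Ck k (\<lambda>x. L (f x))"
proof (induction k arbitrary: f)
  case 0
  then show ?case
    using bounded_linear.continuous_on[OF L] by auto
next
  case (Suc k)
  show ?case
  proof (rule Ck_SucI)
    show "((\<lambda>x. L (f x)) has_derivative (\<lambda>h. L (frechet_derivative f (at x) h))) (at x)" for x
      by (rule bounded_linear.has_derivative[OF L Ck_has_derivative[OF Suc.prems]])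
    show "Ck k (\<lambda>x. L (frechet_derivative f (at x) b))" if "b \<in> Basis" for b
      by (rule Suc.IH[OF Ck_partial[OF Suc.prems that]])
  qed
qed

lemma Ck_add:
  "Ck k f \<Longrightarrow> Ck k g \<Longrightarrow> Ck k (\<lambda>x. f x + g x)"
proof (induction k arbitrary: f g)
  case 0
  then show ?case by (auto intro: continuous_intros)
next
  case (Suc k)
  show ?case
  proof (rule Ck_SucI)
    show "((\<lambda>x. f x + g x) has_derivative
        (\<lambda>h. frechet_derivative f (at x) h + frechet_derivative g (at x) h)) (at x)" for x
      by (intro has_derivative_add Ck_has_derivative[OF Suc.prems(1)] Ck_has_derivative[OF Suc.prems(2)])
    show "Ck k (\<lambda>x. frechet_derivative f (at x) b + frechet_derivative g (at x) b)" if "b \<in> Basis" for b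
      by (rule Suc.IH[OF Ck_partial[OF Suc.prems(1) that] Ck_partial[OF Suc.prems(2) that]])
  qed
qed

lemma Ck_sum: "(\<And>i. i \<in> I \<Longrightarrow> Ck k (f i)) \<Longrightarrow> Ck k (\<lambda>x. \<Sum>i\<in>I. f i x)"
  by (induction I rule: infinite_finite_induct) (auto intro: Ck_add)

lemma Ck_mult:
  fixes f g :: "'a::euclidean_space \<Rightarrow> real"
  shows "Ck k f \<Longrightarrow> Ck k g \<Longrightarrow> Ck k (\<lambda>x. f x * g x)"
proof (induction k arbitrary: f g)
  case 0
  then show ?case by (auto intro: continuous_intros)
next
  case (Suc k)
  show ?case
  proof (rule Ck_SucI)
    show "((\<lambda>x. f x * g x) has_derivative
        (\<lambda>h. f x * frechet_derivative g (at x) h + frechet_derivative f (at x) h * g x)) (at x)" for x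
      by (intro has_derivative_mult Ck_has_derivative[OF Suc.prems(1)] Ck_has_derivative[OF Suc.prems(2)])
    show "Ck k (\<lambda>x. f x * frechet_derivative g (at x) b + frechet_derivative f (at x) b * g x)"
      if "b \<in> Basis" for b
      by (rule Ck_add[OF Suc.IH[OF Ck_Suc_imp_Ck[OF Suc.prems(1)] Ck_partial[OF Suc.prems(2) that]]
            Suc.IH[OF Ck_partial[OF Suc.prems(1) that] Ck_Suc_imp_Ck[OF Suc.prems(2)]]])
  qed
qed

lemma Ck_compose_affine:
  fixes f :: "'b::euclidean_space \<Rightarrow> 'c::real_normed_vector" and L :: "'a::euclidean_space \<Rightarrow> 'b"
  assumes L: "bounded_linear L"
  shows "Ck k f \<Longrightarrow> Ck k (\<lambda>x. f (c + L x))"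
proof (induction k arbitrary: f)
  case 0
  have "continuous_on UNIV (\<lambda>x. c + L x)"
    by (intro continuous_intros bounded_linear.continuous_on[OF L])
  with 0 show ?case
    using continuous_on_compose2[of UNIV f UNIV "\<lambda>x. c + L x"] by auto
next
  case (Suc k)
  have D: "linear (frechet_derivative f (at x))" for x
    using Ck_has_derivative[OF Suc.prems, of x] has_derivative_linear by blast
  show ?case
  proof (rule Ck_SucI)
    have *: "((\<lambda>x. c + L x) has_derivative L) (at x)" for x
      using has_derivative_add[OF has_derivative_const[of c] bounded_linear_imp_has_derivative[OF L]] by simp
    show "((\<lambda>x. f (c + L x)) has_derivative
        (\<lambda>h. frechet_derivative f (at (c + L x)) (L h))) (at x)" for x
      using has_derivative_compose[OF * Ck_has_derivative[OF Suc.prems]] .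
    show "Ck k (\<lambda>x. frechet_derivative f (at (c + L x)) (L b))" if "b \<in> Basis" for b
    proof -
      \<comment> \<open>\<open>Ck\<close> speaks only of partial derivatives along basis vectors, so
        the direction \<open>L b\<close> is expanded in the basis.\<close>
      have "frechet_derivative f (at (c + L x)) (L b)
          = (\<Sum>i\<in>Basis. (L b \<bullet> i) *\<^sub>R frechet_derivative f (at (c + L x)) i)" for x
        by (subst euclidean_representation[of "L b", symmetric])
          (simp add: linear_sum[OF D] linear_cmul[OF D])
      moreover have "Ck k (\<lambda>x. \<Sum>i\<in>Basis. (L b \<bullet> i) *\<^sub>R frechet_derivative f (at (c + L x)) i)"
        by (intro Ck_sum Ck_bounded_linear[OF bounded_linear_scaleR_right] Suc.IH Ck_partial[OF Suc.prems])
      ultimately show ?thesis by simp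
    qed
  qed
qed

section \<open>Test functions: closure properties and bounds\<close>

lemma compact_support_iff:
  "compact (support f) \<longleftrightarrow> (\<exists>R. \<forall>x. f x \<noteq> 0 \<longrightarrow> norm x \<le> R)"
  for f :: "'a::euclidean_space \<Rightarrow> 'b::real_normed_vector"
proof -
  have "compact (support f) \<longleftrightarrow> bounded {x. f x \<noteq> 0}"
    by (auto simp: support_def support_on_def compact_closure)
  also have "\<dots> \<longleftrightarrow> (\<exists>R. \<forall>x. f x \<noteq> 0 \<longrightarrow> norm x \<le> R)"
    by (auto simp: bounded_iff)
  finally show ?thesis .
qed

lemma Cc_infinityI:
  "(\<And>k. Ck k f) \<Longrightarrow> (\<And>x. f x \<noteq> 0 \<Longrightarrow> norm x \<le> R) \<Longrightarrow> f \<in> Cc_infinity"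
  by (auto simp: Cc_infinity_def compact_support_iff)

lemma Cc_infinity_vanishes:
  assumes "f \<in> Cc_infinity"
  obtains R where "R \<ge> 0" "\<And>x. norm x > R \<Longrightarrow> f x = 0"
proof -
  from assms obtain R where R: "\<forall>x. f x \<noteq> 0 \<longrightarrow> norm x \<le> R"
    by (auto simp: Cc_infinity_def compact_support_iff)
  show ?thesis by (rule that[of "max R 0"]) (use R in force)+
qed

lemma Cc_infinity_Ck: "f \<in> Cc_infinity \<Longrightarrow> Ck k f"
  by (auto simp: Cc_infinity_def)

lemma Cc_infinity_continuous: "f \<in> Cc_infinity \<Longrightarrow> continuous_on UNIV f"
  using Cc_infinity_Ck Ck_imp_continuous by blast

lemma Cc_infinity_has_derivative:
  "f \<in> Cc_infinity \<Longrightarrow> (f has_derivative frechet_derivative f (at x)) (at x)"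
  using Cc_infinity_Ck Ck_has_derivative by blast

lemma Cc_infinity_partial:
  assumes "f \<in> Cc_infinity" "b \<in> Basis"
  shows "(\<lambda>x. frechet_derivative f (at x) b) \<in> Cc_infinity"
proof -
  obtain R where R: "\<And>x. norm x > R \<Longrightarrow> f x = 0"
    using Cc_infinity_vanishes[OF assms(1)] by blast
  show ?thesis
  proof (rule Cc_infinityI)
    show "Ck k (\<lambda>x. frechet_derivative f (at x) b)" for k
      by (rule Ck_partial[OF Cc_infinity_Ck[OF assms(1)] assms(2)])
    show "norm x \<le> R" if "frechet_derivative f (at x) b \<noteq> 0" for x
    proof (rule ccontr)
      assume "\<not> norm x \<le> R"
      then have x: "x \<in> {x. R < norm x}" by simp
      have op: "open {x::'a. R < norm x}" by (intro open_Collect_less continuous_intros)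
      have "(f has_derivative (\<lambda>h. 0)) (at x)"
        by (rule has_derivative_transform_within_open[OF has_derivative_const op x]) (use R in auto)
      then have "frechet_derivative f (at x) = (\<lambda>h. 0)"
        using frechet_derivative_at by metis
      with that show False by simp
    qed
  qed
qed

text \<open>The constant \<open>B\<close> says that \<open>L\<close> is bounded below. This keeps
  the support of the composite bounded; along a kernel of \<open>L\<close> the composite would be
  constant.\<close>

lemma Cc_infinity_compose_affine:
  fixes f :: "'b::euclidean_space \<Rightarrow> real" and L :: "'a::euclidean_space \<Rightarrow> 'b"
  assumes f: "f \<in> Cc_infinity" and L: "bounded_linear L" and B: "\<And>x. norm x \<le> B * norm (L x)" "B \<ge> 0"
  shows "(\<lambda>x. f (c + L x)) \<in> Cc_infinity"
proof -
  obtain R where R: "\<And>x. norm x > R \<Longrightarrow> f x = 0"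
    using Cc_infinity_vanishes[OF f] by blast
  show ?thesis
  proof (rule Cc_infinityI)
    show "Ck k (\<lambda>x. f (c + L x))" for k
      by (rule Ck_compose_affine[OF L Cc_infinity_Ck[OF f]])
    show "norm x \<le> B * (R + norm c)" if "f (c + L x) \<noteq> 0" for x
    proof -
      have "norm (c + L x) \<le> R" using R that by force
      moreover have "norm (L x) \<le> norm (c + L x) + norm c"
        using norm_triangle_ineq4[of "c + L x" c] by simp
      ultimately have "norm (L x) \<le> R + norm c" by simp
      then show ?thesis using B(1)[of x] B(2) by (meson mult_left_mono order_trans)
    qed
  qed
qed

lemma Cc_infinity_scale: "f \<in> Cc_infinity \<Longrightarrow> (\<lambda>x. c * f x) \<in> Cc_infinity" for f :: "'a::euclidean_space \<Rightarrow> real"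
proof -
  assume f: "f \<in> Cc_infinity"
  obtain R where "\<And>x. norm x > R \<Longrightarrow> f x = 0"
    using Cc_infinity_vanishes[OF f] by blast
  then show ?thesis
    by (intro Cc_infinityI[of _ R] Ck_bounded_linear[OF bounded_linear_mult_right] Cc_infinity_Ck[OF f])
      force
qed

text \<open>Neither function need have compact support. This form serves differences of smooth
  steps, each of which is eventually 1 but which agree outside a ball.\<close>

lemma Cc_infinity_diff:
  fixes f g :: "'a::euclidean_space \<Rightarrow> real"
  assumes "\<And>k. Ck k f" "\<And>k. Ck k g" "\<And>x. norm x > R \<Longrightarrow> f x = g x"
  shows "(\<lambda>x. f x - g x) \<in> Cc_infinity"
proof (rule Cc_infinityI)
  show "Ck k (\<lambda>x. f x - g x)" for k
    using Ck_add[OF assms(1) Ck_bounded_linear[OF bounded_linear_minus[OF bounded_linear_ident] assms(2)]] by simp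
  show "norm x \<le> R" if "f x - g x \<noteq> 0" for x using assms(3)[of x] that by force
qed

lemma Cc_infinity_tensor:
  fixes K :: "'a::euclidean_space \<Rightarrow> real" and \<sigma> :: "real \<Rightarrow> real"
  assumes "K \<in> Cc_infinity" "\<sigma> \<in> Cc_infinity"
  shows "(\<lambda>p. \<sigma> (snd p) * K (fst p)) \<in> Cc_infinity"
proof -
  obtain R where R: "R \<ge> 0" "\<And>x. norm x > R \<Longrightarrow> K x = 0"
    using Cc_infinity_vanishes[OF assms(1)] by blast
  obtain S where S: "S \<ge> 0" "\<And>x. norm x > S \<Longrightarrow> \<sigma> x = 0"
    using Cc_infinity_vanishes[OF assms(2)] by blast
  show ?thesis
  proof (rule Cc_infinityI)
    show "Ck k (\<lambda>p. \<sigma> (snd p) * K (fst p))" for k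
      using Ck_mult[OF Ck_compose_affine[OF bounded_linear_snd Cc_infinity_Ck[OF assms(2)], of k 0]
          Ck_compose_affine[OF bounded_linear_fst Cc_infinity_Ck[OF assms(1)], of k 0]] by simp
    show "norm x \<le> R + S" if "\<sigma> (snd x) * K (fst x) \<noteq> 0" for x
    proof -
      have "norm (fst x) \<le> R" "norm (snd x) \<le> S" using R S that by force+
      then show ?thesis by (metis norm_Pair_le add_mono order_trans prod.collapse)
    qed
  qed
qed

lemma Cc_infinity_bounded:
  assumes "f \<in> Cc_infinity"
  obtains M where "M \<ge> 0" "\<And>x. \<bar>f x\<bar> \<le> M"
proof -
  obtain R where R: "R \<ge> 0" "\<And>x. norm x > R \<Longrightarrow> f x = 0"
    using Cc_infinity_vanishes[OF assms(1)] by blast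
  have "compact (f ` cball 0 R)"
    by (intro compact_continuous_image) (use Cc_infinity_continuous[OF assms] continuous_on_subset in auto)
  then obtain M where M: "\<And>x. x \<in> cball 0 R \<Longrightarrow> norm (f x) \<le> M"
    by (meson bounded_iff compact_imp_bounded imageI)
  have "M \<ge> 0" using M[of 0] R(1) norm_ge_zero[of "f 0"] by simp
  show ?thesis
  proof (rule that[OF \<open>M \<ge> 0\<close>])
    show "\<bar>f x\<bar> \<le> M" for x
      using M[of x] R(2)[of x] \<open>M \<ge> 0\<close> by (cases "norm x \<le> R") auto
  qed
qed

lemma Cc_infinity_borel: "f \<in> Cc_infinity \<Longrightarrow> f \<in> borel_measurable borel"
  using Cc_infinity_continuous borel_measurable_continuous_onI by blast

lemma integrable_continuous_vanishing:
  fixes f :: "'a::euclidean_space \<Rightarrow> 'b::euclidean_space"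
  assumes "continuous_on UNIV f" "\<And>x. norm x > R \<Longrightarrow> f x = 0"
  shows "integrable lborel f"
proof -
  have "integrable lborel (\<lambda>x. indicator (cball 0 R) x *\<^sub>R f x)"
    by (rule borel_integrable_compact) (use assms(1) continuous_on_subset in auto)
  moreover have "(\<lambda>x. indicator (cball 0 R) x *\<^sub>R f x) = f"
    using assms(2) by (auto simp: fun_eq_iff indicator_def)
  ultimately show ?thesis by simp
qed

lemma Cc_infinity_integrable: "f \<in> Cc_infinity \<Longrightarrow> integrable lborel f"
  by (metis Cc_infinity_continuous Cc_infinity_vanishes integrable_continuous_vanishing)

lemma Cc_infinity_Lipschitz:
  assumes "f \<in> Cc_infinity"
  obtains L where "L \<ge> 0" "\<And>x y. \<bar>f x - f y\<bar> \<le> L * norm (x - y)"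
proof -
  let ?D = "\<lambda>x. frechet_derivative f (at x)"
  have "\<exists>M\<ge>0. \<forall>x. \<bar>?D x b\<bar> \<le> M" if "b \<in> Basis" for b
    by (rule Cc_infinity_bounded[OF Cc_infinity_partial[OF assms that]]) blast
  then obtain M where M: "\<And>b. b \<in> Basis \<Longrightarrow> M b \<ge> 0" "\<And>b x. b \<in> Basis \<Longrightarrow> \<bar>?D x b\<bar> \<le> M b"
    by metis
  have lin: "linear (?D x)" for x
    using Cc_infinity_has_derivative[OF assms, of x] has_derivative_linear by blast
  have bound: "norm (?D x h) \<le> (\<Sum>b\<in>Basis. M b) * norm h" for x h
  proof -
    have "?D x h = (\<Sum>b\<in>Basis. (h \<bullet> b) * ?D x b)"
      by (subst euclidean_representation[of h, symmetric])
        (simp add: linear_sum[OF lin] linear_cmul[OF lin])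
    also have "norm \<dots> \<le> (\<Sum>b\<in>Basis. norm h * M b)"
      by (intro sum_norm_le) (simp add: abs_mult mult_mono M Basis_le_norm)
    finally show ?thesis by (simp add: sum_distrib_left mult.commute)
  qed
  show ?thesis
  proof (rule that[of "\<Sum>b\<in>Basis. M b"])
    show "(\<Sum>b\<in>Basis. M b) \<ge> 0" by (intro sum_nonneg M)
    show "\<bar>f x - f y\<bar> \<le> (\<Sum>b\<in>Basis. M b) * norm (x - y)" for x y
      using differentiable_bound[of UNIV f ?D "\<Sum>b\<in>Basis. M b" x y] Cc_infinity_has_derivative[OF assms]
        onorm_le[OF bound] by auto
  qed
qed

section \<open>Gradients\<close>

text \<open>\<open>grad\<close> is a definite description, so its value is available only through
  uniqueness of the vector representing the derivative.\<close>

lemma GDERIV_grad: "GDERIV f x :> D \<Longrightarrow> grad f x = D"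
proof -
  assume D: "GDERIV f x :> D"
  have "D' = D" if "GDERIV f x :> D'" for D'
  proof -
    have "(\<lambda>h. h \<bullet> D') = (\<lambda>h. h \<bullet> D)"
      using has_derivative_unique D that unfolding gderiv_def by blast
    then have "h \<bullet> D' = h \<bullet> D" for h by metis
    then show ?thesis using vector_eq_rdot[of D' D] by (simp add: inner_commute)
  qed
  with D show ?thesis unfolding grad_def by blast
qed

lemma GDERIV_partials:
  assumes "f differentiable at x"
  shows "GDERIV f x :> (\<Sum>b\<in>Basis. frechet_derivative f (at x) b *\<^sub>R b)"
proof -
  let ?D = "frechet_derivative f (at x)"
  have D: "(f has_derivative ?D) (at x)"
    using assms frechet_derivative_works by blast
  then have lin: "linear ?D"
    using has_derivative_linear by blast
  have "?D h = h \<bullet> (\<Sum>b\<in>Basis. ?D b *\<^sub>R b)" for h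
  proof -
    have "?D h = (\<Sum>b\<in>Basis. (h \<bullet> b) * ?D b)"
      by (subst euclidean_representation[of h, symmetric])
        (simp add: linear_sum[OF lin] linear_cmul[OF lin])
    then show ?thesis by (simp add: inner_sum_right mult.commute)
  qed
  then have "?D = (\<lambda>h. h \<bullet> (\<Sum>b\<in>Basis. ?D b *\<^sub>R b))" by (rule ext)
  with D show ?thesis unfolding gderiv_def by simp
qed

lemma Cc_infinity_GDERIV: "f \<in> Cc_infinity \<Longrightarrow> GDERIV f x :> grad f x"
  using GDERIV_partials[of f x] GDERIV_grad Cc_infinity_has_derivative[of f x] differentiable_def by metis

lemma grad_partials:
  "f \<in> Cc_infinity \<Longrightarrow> grad f x = (\<Sum>b\<in>Basis. frechet_derivative f (at x) b *\<^sub>R b)"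
  using GDERIV_partials[of f x] GDERIV_grad Cc_infinity_has_derivative[of f x] differentiable_def by metis

text \<open>The entropy inequality of \<open>u\<close> differentiates the test function in
  \<open>y\<close>, the theorem differentiates it in \<open>x\<close>. The minus sign here, absent
  from \<open>grad_translate\<close>, is why the flux integral carries a minus in the theorem and a
  plus in the definition of entropy solutions.\<close>

lemma grad_reflect:
  assumes "K \<in> Cc_infinity"
  shows "grad (\<lambda>\<xi>. c * K (x - \<xi>)) y = - (c *\<^sub>R grad K (x - y))"
proof (rule GDERIV_grad)
  have "((\<lambda>\<xi>. x - \<xi>) has_derivative (\<lambda>h. - h)) (at y)"
    by (auto intro!: derivative_eq_intros)
  from has_derivative_compose[OF this, of K "\<lambda>h. h \<bullet> grad K (x - y)"]
  have "((\<lambda>\<xi>. K (x - \<xi>)) has_derivative (\<lambda>h. (- h) \<bullet> grad K (x - y))) (at y)"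
    using Cc_infinity_GDERIV[OF assms] by (simp add: gderiv_def)
  from has_derivative_mult_right[OF this, of c]
  show "GDERIV (\<lambda>\<xi>. c * K (x - \<xi>)) y :> - (c *\<^sub>R grad K (x - y))"
    by (simp add: gderiv_def inner_minus_right)
qed

lemma grad_translate:
  assumes "K \<in> Cc_infinity"
  shows "grad (\<lambda>\<xi>. c * K (\<xi> - y)) x = c *\<^sub>R grad K (x - y)"
proof (rule GDERIV_grad)
  have "((\<lambda>\<xi>. \<xi> - y) has_derivative (\<lambda>h. h)) (at x)"
    by (auto intro!: derivative_eq_intros)
  from has_derivative_compose[OF this, of K "\<lambda>h. h \<bullet> grad K (x - y)"]
  have "((\<lambda>\<xi>. K (\<xi> - y)) has_derivative (\<lambda>h. h \<bullet> grad K (x - y))) (at x)"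
    using Cc_infinity_GDERIV[OF assms] by (simp add: gderiv_def)
  from has_derivative_mult_right[OF this, of c]
  show "GDERIV (\<lambda>\<xi>. c * K (\<xi> - y)) x :> c *\<^sub>R grad K (x - y)"
    by (simp add: gderiv_def)
qed

lemma grad_continuous:
  assumes "K \<in> Cc_infinity"
  shows "continuous_on UNIV (grad K)"
proof -
  have "continuous_on UNIV (\<lambda>x. \<Sum>b\<in>Basis. frechet_derivative K (at x) b *\<^sub>R b)"
    by (intro continuous_intros Cc_infinity_continuous Cc_infinity_partial assms)
  then show ?thesis by (simp add: grad_partials[OF assms] cong: continuous_on_cong)
qed

lemma grad_vanishes:
  assumes "K \<in> Cc_infinity"
  obtains R where "R \<ge> 0" "\<And>x. norm x > R \<Longrightarrow> K x = 0" "\<And>x. norm x > R \<Longrightarrow> grad K x = 0"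
proof -
  obtain R where R: "R \<ge> 0" "\<And>x. norm x > R \<Longrightarrow> K x = 0"
    using Cc_infinity_vanishes[OF assms] by blast
  have "grad K x = 0" if "norm x > R" for x
  proof (rule GDERIV_grad)
    have x: "x \<in> {x. R < norm x}" using that by simp
    have op: "open {x::'a. R < norm x}" by (intro open_Collect_less continuous_intros)
    have "(K has_derivative (\<lambda>h. 0)) (at x)"
      by (rule has_derivative_transform_within_open[OF has_derivative_const op x]) (use R in auto)
    then show "GDERIV K x :> 0" by (simp add: gderiv_def)
  qed
  with R that show ?thesis by blast
qed

lemma grad_Lipschitz:
  assumes "K \<in> Cc_infinity"
  obtains L where "L \<ge> 0" "\<And>x y. norm (grad K x - grad K y) \<le> L * norm (x - y)"
proof -
  let ?D = "\<lambda>b x. frechet_derivative K (at x) b"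
  have "\<exists>L\<ge>0. \<forall>x y. \<bar>?D b x - ?D b y\<bar> \<le> L * norm (x - y)" if "b \<in> Basis" for b
    by (rule Cc_infinity_Lipschitz[OF Cc_infinity_partial[OF assms that]]) blast
  then obtain M where M: "\<And>b. b \<in> Basis \<Longrightarrow> M b \<ge> 0"
    "\<And>b x y. b \<in> Basis \<Longrightarrow> \<bar>?D b x - ?D b y\<bar> \<le> M b * norm (x - y)"
    by metis
  show ?thesis
  proof (rule that[of "\<Sum>b\<in>Basis. M b"])
    show "(\<Sum>b\<in>Basis. M b) \<ge> 0" by (intro sum_nonneg M)
    show "norm (grad K x - grad K y) \<le> (\<Sum>b\<in>Basis. M b) * norm (x - y)" for x y
    proof -
      have "grad K x - grad K y = (\<Sum>b\<in>Basis. (?D b x - ?D b y) *\<^sub>R b)"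
        by (simp add: grad_partials[OF assms] sum_subtractf scaleR_diff_left)
      also have "norm \<dots> \<le> (\<Sum>b\<in>Basis. M b * norm (x - y))"
        by (intro sum_norm_le) (simp add: M)
      finally show ?thesis by (simp add: sum_distrib_right)
    qed
  qed
qed

section \<open>Second-order Taylor remainders of test functions\<close>

abbreviation taylor_remainder :: "('a::euclidean_space \<Rightarrow> real) \<Rightarrow> 'a \<Rightarrow> 'a \<Rightarrow> real" where
  "taylor_remainder K w z \<equiv> K (w - z) - K w + (z \<bullet> grad K w) * indicator {z. norm z \<le> 1} z"

text \<open>The sign of \<open>z\<close> is the one produced by \<open>\<xi> \<mapsto> K (w - \<xi>)\<close>.\<close>

lemma Taylor2_bound:
  assumes "K \<in> Cc_infinity"
  obtains C where "C \<ge> 0"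
    "\<And>w z. \<bar>taylor_remainder K w z\<bar>
       \<le> C * min ((norm z)\<^sup>2) 1"
proof -
  obtain L where L: "L \<ge> 0" "\<And>x y. norm (grad K x - grad K y) \<le> L * norm (x - y)"
    using grad_Lipschitz[OF assms] by blast
  obtain M where M: "M \<ge> 0" "\<And>x. \<bar>K x\<bar> \<le> M"
    using Cc_infinity_bounded[OF assms] by blast
  have small: "\<bar>K (w - z) - K w + z \<bullet> grad K w\<bar> \<le> L * (norm z)\<^sup>2" for w z
  proof -
    \<comment> \<open>The linear term is built into \<open>g\<close>, so that its derivative is a
      difference of gradients at distance \<open>t * norm z\<close>. The Lipschitz bound on the
      gradient then yields the factor \<open>(norm z)\<^sup>2\<close>.\<close>
    define g where "g t = K (w - t *\<^sub>R z) + t * (z \<bullet> grad K w)" for t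
    have g': "(g has_derivative (\<lambda>h. h * (z \<bullet> (grad K w - grad K (w - t *\<^sub>R z))))) (at t)" for t
    proof -
      have "((\<lambda>t. w - t *\<^sub>R z) has_derivative (\<lambda>h. - (h *\<^sub>R z))) (at t)"
        by (auto intro!: derivative_eq_intros)
      from has_derivative_compose[OF this, of K "\<lambda>h. h \<bullet> grad K (w - t *\<^sub>R z)"]
      have "((\<lambda>t. K (w - t *\<^sub>R z)) has_derivative (\<lambda>h. (- (h *\<^sub>R z)) \<bullet> grad K (w - t *\<^sub>R z))) (at t)"
        using Cc_infinity_GDERIV[OF assms] by (simp add: gderiv_def)
      then show ?thesis unfolding g_def
        by (rule has_derivative_eq_rhs[OF has_derivative_add])
          (auto intro!: derivative_eq_intros simp: algebra_simps inner_diff_right)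
    qed
    have "norm (g 1 - g 0) \<le> (L * (norm z)\<^sup>2) * norm (1 - 0::real)"
    proof (rule differentiable_bound[of "{0..1}" g "\<lambda>t h. h * (z \<bullet> (grad K w - grad K (w - t *\<^sub>R z)))"])
      show "(g has_derivative (\<lambda>h. h * (z \<bullet> (grad K w - grad K (w - t *\<^sub>R z))))) (at t within {0..1})" for t
        using g' has_derivative_at_withinI by blast
      show "onorm (\<lambda>h. h * (z \<bullet> (grad K w - grad K (w - t *\<^sub>R z)))) \<le> L * (norm z)\<^sup>2" if "t \<in> {0..1}" for t
      proof (rule onorm_le)
        fix h :: real
        have "\<bar>z \<bullet> (grad K w - grad K (w - t *\<^sub>R z))\<bar> \<le> norm z * norm (grad K w - grad K (w - t *\<^sub>R z))"
          by (rule Cauchy_Schwarz_ineq2)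
        also have "\<dots> \<le> norm z * (L * norm (w - (w - t *\<^sub>R z)))"
          by (intro mult_left_mono L) auto
        also have "\<dots> \<le> norm z * (L * norm z)"
          using that L by (intro mult_left_mono) (auto simp: mult_left_le_one_le)
        finally have "\<bar>z \<bullet> (grad K w - grad K (w - t *\<^sub>R z))\<bar> \<le> L * (norm z)\<^sup>2"
          by (simp add: power2_eq_square algebra_simps)
        then show "norm (h * (z \<bullet> (grad K w - grad K (w - t *\<^sub>R z)))) \<le> L * (norm z)\<^sup>2 * norm h"
          by (simp add: abs_mult mult.commute mult_left_mono)
      qed
    qed auto
    then show ?thesis by (simp add: g_def algebra_simps)
  qed
  show ?thesis
  \<comment> \<open>\<open>L\<close> serves the jumps of length at most 1, where the gradient term
    is present; \<open>2 * M\<close> serves the longer ones, where only two values of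
    \<open>K\<close> remain.\<close>
  proof (rule that[of "max L (2 * M)"])
    show "max L (2 * M) \<ge> 0" using L by simp
    fix w z
    show "\<bar>taylor_remainder K w z\<bar>
       \<le> max L (2 * M) * min ((norm z)\<^sup>2) 1"
    proof (cases "norm z \<le> 1")
      case True
      then have "(norm z)\<^sup>2 \<le> 1" by (simp add: power_le_one)
      then have "L * (norm z)\<^sup>2 \<le> max L (2 * M) * min ((norm z)\<^sup>2) 1"
        by (simp add: mult_right_mono)
      then show ?thesis using small[of w z] True by simp
    next
      case False
      then have "(norm z)\<^sup>2 \<ge> 1" by simp
      then show ?thesis using M(2)[of w] M(2)[of "w - z"] False by simp
    qed
  qed
qed

section \<open>Mollifiers and Lipschitz representatives\<close>

lemma lborel_integrable_affine:
  fixes f :: "'a::euclidean_space \<Rightarrow> real"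
  assumes f: "integrable lborel f" and c: "c \<noteq> 0"
  shows "integrable lborel (\<lambda>x. f (t + c *\<^sub>R x))"
proof -
  have [measurable]: "f \<in> borel_measurable borel"
    using borel_measurable_integrable[OF f] by simp
  show ?thesis
    using f c by (subst (asm) lborel_affine[of c t]) (auto simp: integrable_density integrable_distr_eq)
qed

lemma lborel_integral_affine:
  fixes f :: "'a::euclidean_space \<Rightarrow> real"
  assumes f: "f \<in> borel_measurable borel" and c: "c \<noteq> 0"
  shows "(LINT x|lborel. f x) = \<bar>c\<bar> ^ DIM('a) * (LINT x|lborel. f (t + c *\<^sub>R x))"
proof -
  note [measurable] = f
  show ?thesis
    using c by (subst lborel_affine[of c t]) (auto simp: integral_density integral_distr)
qed

lemma lborel_integral_translate:
  fixes f :: "'a::euclidean_space \<Rightarrow> real"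
  assumes f: "f \<in> borel_measurable borel"
  shows "(LINT x|lborel. f (t + x)) = (LINT x|lborel. f x)" "(LINT x|lborel. f (t - x)) = (LINT x|lborel. f x)"
  using lborel_integral_affine[OF f, of 1 t] lborel_integral_affine[OF f, of "-1" t] by simp_all

lemma lborel_integrable_translate:
  fixes f :: "'a::euclidean_space \<Rightarrow> real"
  assumes f: "integrable lborel f"
  shows "integrable lborel (\<lambda>x. f (t + x))" "integrable lborel (\<lambda>x. f (t - x))"
  using lborel_integrable_affine[OF f, of 1 t] lborel_integrable_affine[OF f, of "-1" t] by simp_all

section \<open>Mollifier kernels and their antiderivatives\<close>

lemma mollifier_kernel_Cc: "mollifier_kernel \<theta> \<Longrightarrow> \<theta> \<in> Cc_infinity"
  and mollifier_kernel_nonneg: "mollifier_kernel \<theta> \<Longrightarrow> \<theta> x \<ge> 0"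
  and mollifier_kernel_integral: "mollifier_kernel \<theta> \<Longrightarrow> (LINT x|lborel. \<theta> x) = 1"
  by (auto simp: mollifier_kernel_def)

lemma mollifier_kernel_vanishes: "mollifier_kernel \<theta> \<Longrightarrow> norm x \<ge> 1 \<Longrightarrow> \<theta> x = 0"
proof (rule ccontr)
  assume \<theta>: "mollifier_kernel \<theta>" "norm x \<ge> 1" "\<theta> x \<noteq> 0"
  then have "x \<in> support \<theta>"
    unfolding support_def support_on_def by (intro subsetD[OF closure_subset]) simp
  with \<theta> show False by (auto simp: mollifier_kernel_def)
qed

lemma mollifier_rescaled:
  fixes \<theta> :: "'a::euclidean_space \<Rightarrow> real"
  assumes \<theta>: "mollifier_kernel \<theta>" and \<epsilon>: "\<epsilon> > 0"
  shows "rescaled \<theta> \<epsilon> \<in> Cc_infinity" "rescaled \<theta> \<epsilon> x \<ge> 0" "(LINT x|lborel. rescaled \<theta> \<epsilon> x) = 1"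
    "norm x \<ge> \<epsilon> \<Longrightarrow> rescaled \<theta> \<epsilon> x = 0"
    "(LINT x|lborel. norm x * rescaled \<theta> \<epsilon> x) = \<epsilon> * (LINT x|lborel. norm x * \<theta> x)"
proof -
  have B: "norm y \<le> \<epsilon> * norm (inverse \<epsilon> *\<^sub>R y)" for y :: 'a
    using \<epsilon> by (simp add: field_simps)
  have "(\<lambda>x. \<theta> (0 + inverse \<epsilon> *\<^sub>R x)) \<in> Cc_infinity"
    by (rule Cc_infinity_compose_affine[OF mollifier_kernel_Cc[OF \<theta>] bounded_linear_scaleR_right B]) (use \<epsilon> in simp)
  then show "rescaled \<theta> \<epsilon> \<in> Cc_infinity"
    unfolding rescaled_def by (intro Cc_infinity_scale) simp
  then have m: "rescaled \<theta> \<epsilon> \<in> borel_measurable borel" by (rule Cc_infinity_borel)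
  have m': "(\<lambda>x. norm x * rescaled \<theta> \<epsilon> x) \<in> borel_measurable borel" using m by measurable
  show "rescaled \<theta> \<epsilon> x \<ge> 0" using mollifier_kernel_nonneg[OF \<theta>] \<epsilon> by (simp add: rescaled_def)
  have r: "rescaled \<theta> \<epsilon> (0 + \<epsilon> *\<^sub>R x) = 1 / \<epsilon> ^ DIM('a) * \<theta> x" for x
    using \<epsilon> by (simp add: rescaled_def)
  show "(LINT x|lborel. rescaled \<theta> \<epsilon> x) = 1"
    using \<epsilon> by (subst lborel_integral_affine[OF m, of \<epsilon> 0]) (simp_all add: r[simplified] mollifier_kernel_integral[OF \<theta>])
  show "norm x \<ge> \<epsilon> \<Longrightarrow> rescaled \<theta> \<epsilon> x = 0"
    using \<epsilon> mollifier_kernel_vanishes[OF \<theta>, of "x /\<^sub>R \<epsilon>"] by (simp add: rescaled_def divide_simps)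
  have "(LINT x|lborel. norm x * rescaled \<theta> \<epsilon> x)
      = \<epsilon> ^ DIM('a) * (LINT x|lborel. (\<epsilon> / \<epsilon> ^ DIM('a)) * (norm x * \<theta> x))"
    using \<epsilon> by (subst lborel_integral_affine[OF m', of \<epsilon> 0]) (simp_all add: r[simplified] mult_ac)
  then show "(LINT x|lborel. norm x * rescaled \<theta> \<epsilon> x) = \<epsilon> * (LINT x|lborel. norm x * \<theta> x)"
    using \<epsilon> by simp
qed

lemma Cc_infinity_has_real_derivative:
  fixes \<sigma> :: "real \<Rightarrow> real"
  assumes "\<sigma> \<in> Cc_infinity"
  shows "(\<sigma> has_real_derivative deriv \<sigma> x) (at x)"
  by (metis Cc_infinity_has_derivative[OF assms] differentiable_def DERIV_deriv_iff_real_differentiable)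

lemma Cc_infinity_deriv:
  fixes \<sigma> :: "real \<Rightarrow> real"
  assumes "\<sigma> \<in> Cc_infinity"
  shows "deriv \<sigma> \<in> Cc_infinity"
proof -
  have "frechet_derivative \<sigma> (at x) 1 = deriv \<sigma> x" for x
    using Cc_infinity_has_real_derivative[OF assms, of x]
    by (metis frechet_derivative_at has_field_derivative_def mult.right_neutral)
  then show ?thesis
    using Cc_infinity_partial[OF assms, of 1] by simp
qed

text \<open>A smooth step from 0 to 1. Differences of its rescaled translates are test functions
  whose derivatives are differences of mollifiers; they give the Lipschitz bound from a weak
  derivative and, later, the cutoff at the initial time.\<close>

lemma mollifier_antiderivative:
  fixes \<theta> :: "real \<Rightarrow> real"
  assumes \<theta>: "mollifier_kernel \<theta>"
  obtains F where "\<And>x. (F has_real_derivative \<theta> x) (at x)" "\<And>x. x \<le> -1 \<Longrightarrow> F x = 0"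
    "\<And>x. x \<ge> 1 \<Longrightarrow> F x = 1" "\<And>x. 0 \<le> F x" "\<And>x. F x \<le> 1" "\<And>k. Ck k F"
proof -
  have cont: "isCont \<theta> x" for x
    using Cc_infinity_continuous[OF mollifier_kernel_Cc[OF \<theta>]] continuous_on_eq_continuous_at by blast
  obtain F0 where F0: "\<And>x. (F0 has_vector_derivative \<theta> x) (at x)"
    using einterval_antiderivative[of "-\<infinity>" \<infinity> \<theta>] cont by auto
  define F where "F x = F0 x - F0 (-1)" for x
  have F: "(F has_real_derivative \<theta> x) (at x)" for x
    using F0 unfolding F_def[abs_def]
    by (auto intro!: derivative_eq_intros simp: has_real_derivative_iff_has_vector_derivative)
  have mono: "F x \<le> F y" if "x \<le> y" for x y
    using DERIV_nonneg_imp_nondecreasing[OF that, of F] F mollifier_kernel_nonneg[OF \<theta>] by blast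
  have const: "F x = F y" if "x \<le> y" "\<And>z. x < z \<Longrightarrow> z < y \<Longrightarrow> \<theta> z = 0" for x y
  proof (cases "x = y")
    case False
    with that have "x < y" by simp
    from MVT2[OF this, of F \<theta>] F obtain z where "z > x" "z < y" "F y - F x = (y - x) * \<theta> z" by blast
    then show ?thesis using that by simp
  qed simp
  have m1: "F (-1) = 0" by (simp add: F_def)
  have p1: "F 1 = 1"
  proof -
    have "(LINT x|lborel. indicator {-1..1} x *\<^sub>R \<theta> x) = F 1 - F (-1)"
    proof (rule integral_FTC_Icc)
      show "(F has_vector_derivative \<theta> x) (at x within {-1..1})" for x
        using F[of x] has_vector_derivative_at_within
        by (simp add: has_real_derivative_iff_has_vector_derivative)
      show "continuous_on {-1..1} \<theta>"
        using Cc_infinity_continuous[OF mollifier_kernel_Cc[OF \<theta>]] by (rule continuous_on_subset) simp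
    qed simp
    moreover have "(\<lambda>x. indicator {-1..1} x *\<^sub>R \<theta> x) = \<theta>"
      using mollifier_kernel_vanishes[OF \<theta>] by (force simp: fun_eq_iff indicator_def)
    ultimately show ?thesis using mollifier_kernel_integral[OF \<theta>] m1 by simp
  qed
  have le: "F x = 0" if "x \<le> -1" for x
    using const[OF that] m1 mollifier_kernel_vanishes[OF \<theta>] by simp
  have ge: "F x = 1" if "x \<ge> 1" for x
    using const[OF that] p1 mollifier_kernel_vanishes[OF \<theta>] by simp
  have "0 \<le> F x" for x
    using mono[of "-1" x] le[of x] m1 by (cases "x \<le> -1") auto
  moreover have "F x \<le> 1" for x
    using mono[of x 1] ge[of x] p1 by (cases "x \<ge> 1") auto
  moreover have "Ck k F" for k
  proof (cases k)
    case 0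
    have "continuous_on UNIV F" using F DERIV_continuous_on has_field_derivative_at_within by blast
    then show ?thesis by (simp add: 0)
  next
    case (Suc k)
    have "Ck (Suc k) F"
      by (rule Ck_SucI[where f'="\<lambda>x h. \<theta> x * h"])
        (use F Cc_infinity_Ck[OF mollifier_kernel_Cc[OF \<theta>]] in \<open>auto simp: has_field_derivative_def\<close>)
    then show ?thesis by (simp add: Suc)
  qed
  ultimately show ?thesis using that[OF F le ge] by blast
qed

lemma Ck_real_affine: "Ck k F \<Longrightarrow> Ck k (\<lambda>x::real. F (c + n * x))" for F :: "real \<Rightarrow> real"
  using Ck_compose_affine[OF bounded_linear_mult_right] .

text \<open>The set where a continuous function exceeds its essential bound is open and null, hence
  empty.\<close>

lemma L_infinity_continuous_bounded:
  fixes f :: "'a::euclidean_space \<Rightarrow> 'b::euclidean_space"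
  assumes cont: "continuous_on UNIV f" and f: "L_infinity lborel f"
  obtains M where "\<And>x. norm (f x) \<le> M"
proof -
  obtain C where C: "AE x in lborel. norm (f x) \<le> C"
    using f by (auto simp: L_infinity_def)
  let ?S = "{x. C < norm (f x)}"
  have op: "open ?S" by (intro open_Collect_less continuous_intros cont)
  have "AE x in lborel. x \<notin> ?S" using C by (simp add: not_less)
  then have "?S \<in> null_sets lborel"
    by (subst (asm) AE_iff_null_sets[symmetric]) (use op in auto)
  then have "negligible ?S"
    using negligible_iff_null_sets null_sets_completionI by blast
  then have "?S = {}" using open_not_negligible[OF op] by blast
  then have "norm (f x) \<le> C" for x by (metis (mono_tags, lifting) empty_Collect_eq not_less)
  then show ?thesis using that by blast
qed

lemma W1_infinity_bounded:
  assumes "W1_infinity f"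
  obtains M where "\<And>x. norm (f x) \<le> M"
  using L_infinity_continuous_bounded[of f] assms by (auto simp: W1_infinity_def)

text \<open>The weak derivative is tested with \<open>F (n (x - a)) - F (n (x - b))\<close>, a smooth approximation
  of the indicator of \<open>[a, b]\<close>.\<close>

lemma W1_infinity_Lipschitz:
  fixes f :: "real \<Rightarrow> 'b::euclidean_space" and \<theta> :: "real \<Rightarrow> real"
  assumes \<theta>: "mollifier_kernel \<theta>" and f: "W1_infinity f"
  obtains L where "L \<ge> 0" "\<And>a b. norm (f a - f b) \<le> L * \<bar>a - b\<bar>"
proof -
  obtain F :: "real \<Rightarrow> real" where F: "\<And>x. (F has_real_derivative \<theta> x) (at x)" "\<And>x. x \<le> -1 \<Longrightarrow> F x = 0"
    "\<And>x. x \<ge> 1 \<Longrightarrow> F x = 1" "\<And>x. 0 \<le> F x" "\<And>x. F x \<le> 1" "\<And>k. Ck k F"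
    using mollifier_antiderivative[OF \<theta>] by blast
  obtain B where B: "\<And>x. norm (f x) \<le> B" using W1_infinity_bounded[OF f] by blast
  have cont: "continuous_on UNIV f" using f by (simp add: W1_infinity_def)
  have [measurable]: "f \<in> borel_measurable borel" using cont by (rule borel_measurable_continuous_onI)
  have [measurable]: "\<theta> \<in> borel_measurable borel" using Cc_infinity_borel[OF mollifier_kernel_Cc[OF \<theta>]] .
  have \<theta>i: "integrable lborel \<theta>" using Cc_infinity_integrable[OF mollifier_kernel_Cc[OF \<theta>]] .
  obtain g C0 where g: "g \<in> borel_measurable lborel" "AE x in lborel. norm (g x) \<le> C0" "weak_derivative f g"
    using f by (auto simp: W1_infinity_def L_infinity_def)
  define C where "C = max C0 0"
  have C: "C \<ge> 0" "AE x in lborel. norm (g x) \<le> C" using g(2) by (auto simp: C_def)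
  \<comment> \<open>\<open>I n a\<close> is \<open>f\<close> mollified at scale
    \<open>1 / n\<close>. It appears because the derivative of the test function is
    \<open>n * \<theta> (n * (x - a)) - n * \<theta> (n * (x - b))\<close>, so that the weak
    derivative controls \<open>I n a - I n b\<close>.\<close>
  define I where "I n a = (LINT z|lborel. \<theta> z *\<^sub>R f (a + z / real n))" for n :: nat and a
  have I: "(\<lambda>n. I (Suc n) a) \<longlonglongrightarrow> f a" for a
  proof -
    have "(\<lambda>n. I (Suc n) a) \<longlonglongrightarrow> (LINT z|lborel. \<theta> z *\<^sub>R f a)"
      unfolding I_def
    proof (rule integral_dominated_convergence[where w="\<lambda>z. \<theta> z * B"])
      show "integrable lborel (\<lambda>z. \<theta> z * B)" using \<theta>i by simp
      show "AE z in lborel. (\<lambda>n. \<theta> z *\<^sub>R f (a + z / real (Suc n))) \<longlonglongrightarrow> \<theta> z *\<^sub>R f a"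
      proof (intro AE_I2 tendsto_intros)
        fix z
        have "(\<lambda>n. a + z * inverse (real (Suc n))) \<longlonglongrightarrow> a + z * 0"
          by (intro tendsto_intros LIMSEQ_inverse_real_of_nat)
        then have "(\<lambda>n. a + z / real (Suc n)) \<longlonglongrightarrow> a" by (simp add: divide_inverse)
        then show "(\<lambda>n. f (a + z / real (Suc n))) \<longlonglongrightarrow> f a"
          using cont continuous_on_tendsto_compose[of UNIV f _ a] by simp
      qed
      show "AE z in lborel. norm (\<theta> z *\<^sub>R f (a + z / real (Suc n))) \<le> \<theta> z * B" for n
        using mollifier_kernel_nonneg[OF \<theta>] B by (intro AE_I2) (simp add: mult_left_mono)
    qed measurable
    then show ?thesis using mollifier_kernel_integral[OF \<theta>] \<theta>i by simp
  qed
  have main: "norm (f a - f b) \<le> C * (b - a)" if "a \<le> b" for a b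
  proof (rule LIMSEQ_le)
    show "(\<lambda>n. norm (I (Suc n) a - I (Suc n) b)) \<longlonglongrightarrow> norm (f a - f b)"
      by (intro tendsto_intros I)
    have "(\<lambda>n. C * (b - a + 2 * inverse (real (Suc n)))) \<longlonglongrightarrow> C * (b - a + 2 * 0)"
      by (intro tendsto_intros LIMSEQ_inverse_real_of_nat)
    then show "(\<lambda>n. C * (b - a + 2 / real (Suc n))) \<longlonglongrightarrow> C * (b - a)" by (simp add: divide_inverse)
    have "norm (I n a - I n b) \<le> C * (b - a + 2 / real n)" if n: "n \<ge> 1" for n :: nat
    proof -
      define \<phi> where "\<phi> x = F (- (n * a) + n * x) - F (- (n * b) + n * x)" for x :: real
      have out: "F (- (n * a) + n * x) = F (- (n * b) + n * x)" if "x < a - 1 / n \<or> x > b + 1 / n" for x :: real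
      proof (cases "x < a - 1 / n")
        case True
        then have "real n * x \<le> real n * (a - 1 / n)" using n by simp
        then have "n * x \<le> n * a - 1" using n by (simp add: algebra_simps)
        moreover have "real n * a \<le> n * b" using \<open>a \<le> b\<close> n by simp
        ultimately show ?thesis using F(2) by simp
      next
        case False
        with that have "real n * x \<ge> real n * (b + 1 / n)" using n by simp
        then have "n * x \<ge> n * b + 1" using n by (simp add: algebra_simps)
        moreover have "real n * a \<le> n * b" using \<open>a \<le> b\<close> n by simp
        ultimately show ?thesis using F(3) by simp
      qed
      have \<phi>: "\<phi> \<in> Cc_infinity"
        unfolding \<phi>_def
      proof (rule Cc_infinity_diff[of _ _ "\<bar>a\<bar> + \<bar>b\<bar> + 1"])
        show "F (- (n * a) + n * x) = F (- (n * b) + n * x)" if "\<bar>a\<bar> + \<bar>b\<bar> + 1 < norm x" for x :: real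
        proof (rule out)
          have "1 / real n \<le> 1" using n by simp
          then show "x < a - 1 / n \<or> x > b + 1 / n" using that by auto
        qed
      qed (intro Ck_real_affine F)+
      have d: "deriv \<phi> x = n * \<theta> (n * (x - a)) - n * \<theta> (n * (x - b))" for x :: real
        unfolding \<phi>_def
        by (rule DERIV_imp_deriv) (auto intro!: derivative_eq_intros DERIV_chain2[OF F(1)] simp: algebra_simps)
      have sc: "(LINT x|lborel. (n * \<theta> (n * (x - a))) *\<^sub>R f x) = I n a" for a :: real
      proof -
        have "(LINT x|lborel. (n * \<theta> (n * (x - a))) *\<^sub>R f x)
            = \<bar>1 / real n\<bar> *\<^sub>R (LINT x|lborel. (n * \<theta> (n * ((a + 1 / n * x) - a))) *\<^sub>R f (a + 1 / n * x))"
          by (rule lborel_integral_real_affine) (use n in simp)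
        also have "(LINT x|lborel. (n * \<theta> (n * ((a + 1 / n * x) - a))) *\<^sub>R f (a + 1 / n * x))
            = (LINT x|lborel. real n *\<^sub>R (\<theta> x *\<^sub>R f (a + x / n)))"
          using n by (intro Bochner_Integration.integral_cong) auto
        also have "\<dots> = real n *\<^sub>R I n a" unfolding I_def by (rule integral_scaleR_right)
        finally show ?thesis using n by simp
      qed
      have int: "integrable lborel (\<lambda>x. (n * \<theta> (n * (x - a))) *\<^sub>R f x)" for a :: real
      proof (rule Bochner_Integration.integrable_bound[of _ "\<lambda>x. B * (n * \<theta> (n * (x - a)))"])
        have "integrable lborel (\<lambda>x. \<theta> (-(n * a) + n * x))"
          by (rule lborel_integrable_real_affine[OF \<theta>i]) (use n in simp)
        then show "integrable lborel (\<lambda>x. B * (n * \<theta> (n * (x - a))))" by (simp add: algebra_simps)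
        show "AE x in lborel. norm ((n * \<theta> (n * (x - a))) *\<^sub>R f x) \<le> norm (B * (n * \<theta> (n * (x - a))))"
        proof (intro AE_I2)
          fix x :: real
          have "norm (f x) \<le> \<bar>B\<bar>" using B[of x] by simp
          then have "norm (f x) * \<bar>n * \<theta> (n * (x - a))\<bar> \<le> \<bar>B\<bar> * \<bar>n * \<theta> (n * (x - a))\<bar>"
            by (rule mult_right_mono) simp
          then show "norm ((n * \<theta> (n * (x - a))) *\<^sub>R f x) \<le> norm (B * (n * \<theta> (n * (x - a))))"
            by (simp add: abs_mult mult_ac)
        qed
      qed measurable
      have "I n a - I n b = (LINT x|lborel. (n * \<theta> (n * (x - a))) *\<^sub>R f x - (n * \<theta> (n * (x - b))) *\<^sub>R f x)"
        by (simp add: sc int)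
      also have "\<dots> = (LINT x|lborel. deriv \<phi> x *\<^sub>R f x)" by (simp add: d scaleR_diff_left)
      also have "\<dots> = - (LINT x|lborel. \<phi> x *\<^sub>R g x)"
        using g(3) \<phi> by (simp add: weak_derivative_def)
      finally have "norm (I n a - I n b) = norm (LINT x|lborel. \<phi> x *\<^sub>R g x)" by simp
      also have "\<dots> \<le> (LINT x|lborel. norm (\<phi> x *\<^sub>R g x))" by (rule integral_norm_bound)
      \<comment> \<open>The test function has modulus at most 1 and vanishes off this interval, so
        only the length \<open>b - a + 2 / n\<close> enters. The excess \<open>2 / n\<close>
        disappears in the limit.\<close>
      also have "\<dots> \<le> (LINT x|lborel. C * indicator {a - 1 / n..b + 1 / n} x)"
      proof (rule integral_mono_AE')
        show "AE x in lborel. norm (\<phi> x *\<^sub>R g x) \<le> C * indicator {a - 1 / n..b + 1 / n} x"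
          using C(2)
        proof eventually_elim
          case (elim x)
          have "\<bar>\<phi> x\<bar> \<le> 1"
            using F(4)[of "- (n * a) + n * x"] F(5)[of "- (n * a) + n * x"]
              F(4)[of "- (n * b) + n * x"] F(5)[of "- (n * b) + n * x"]
            unfolding \<phi>_def abs_le_iff by linarith
          then have "\<bar>\<phi> x\<bar> * norm (g x) \<le> 1 * C" using elim by (intro mult_mono) auto
          moreover have "\<phi> x = 0" if "x \<notin> {a - 1 / n..b + 1 / n}"
            using out[of x] that by (simp add: \<phi>_def not_le)
          ultimately show ?case by (auto simp: indicator_def)
        qed
        show "AE x in lborel. 0 \<le> C * indicator {a - 1 / n..b + 1 / n} x" using C by simp
      qed (auto intro!: integrable_mult_right integrable_real_indicator simp: emeasure_lborel_Icc_eq)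
      also have "\<dots> = C * (b - a + 2 / n)"
      proof -
        have "a - 1 / n \<le> b + 1 / n" using \<open>a \<le> b\<close> by (smt (verit) divide_nonneg_nonneg of_nat_0_le_iff)
        then show ?thesis by simp
      qed
      finally show ?thesis .
    qed
    then show "\<exists>N. \<forall>n\<ge>N. norm (I (Suc n) a - I (Suc n) b) \<le> C * (b - a + 2 / real (Suc n))" by (metis One_nat_def Suc_le_mono zero_le)
  qed
  show ?thesis
  proof (rule that[OF C(1)])
    show "norm (f a - f b) \<le> C * \<bar>a - b\<bar>" for a b
      using main[of a b] main[of b a] by (cases "a \<le> b") (auto simp: norm_minus_commute)
  qed
qed

section \<open>Translation estimate for functions of bounded variation\<close>

lemma Ck_real_polynomial_function: "real_polynomial_function p \<Longrightarrow> Ck k p"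
  for p :: "'a::euclidean_space \<Rightarrow> real"
proof (induction p rule: real_polynomial_function.induct)
  case (linear f)
  have "Ck k (\<lambda>x::'a. x)"
  proof (cases k)
    case (Suc m)
    have "Ck (Suc m) (\<lambda>x::'a. x)" by (rule Ck_SucI[where f'="\<lambda>x h. h"]) auto
    then show ?thesis by (simp add: Suc)
  qed simp
  then show ?case using Ck_bounded_linear[OF linear] by blast
qed (auto intro: Ck_add Ck_mult)

text \<open>Squaring the positive part makes it continuously differentiable. One derivative is
  enough for a cutoff here, since \<open>total_variation\<close> is a supremum over
  \<open>Ck 1\<close> fields.\<close>

lemma positive_part_square_derivative:
  "((\<lambda>t::real. (max 0 t)\<^sup>2) has_real_derivative 2 * max 0 t) (at t)"
proof (cases "t = 0")
  case True
  have "(\<lambda>h::real. ((max 0 (0 + h))\<^sup>2 - (max 0 0)\<^sup>2) / h) \<midarrow>0\<rightarrow> 0"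
  proof (rule Lim_null_comparison)
    show "\<forall>\<^sub>F h in at 0. norm (((max 0 (0 + h))\<^sup>2 - (max 0 0)\<^sup>2) / h) \<le> \<bar>h\<bar>" for h :: real
      by (intro always_eventually) (auto simp: max_def power2_eq_square)
    show "(\<lambda>h::real. \<bar>h\<bar>) \<midarrow>0\<rightarrow> 0" by (rule tendsto_eq_intros) (auto intro!: tendsto_eq_intros)
  qed
  then show ?thesis by (simp add: True DERIV_def)
next
  case False
  then consider "t < 0" | "t > 0" by linarith
  then show ?thesis
  proof cases
    case 1
    have "((\<lambda>t::real. 0) has_real_derivative 0) (at t)" by simp
    then have "((\<lambda>t::real. (max 0 t)\<^sup>2) has_real_derivative 0) (at t)"
      by (rule has_field_derivative_transform_within_open[of _ _ _ "{..<0}"]) (use 1 in auto)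
    with 1 show ?thesis by simp
  next
    case 2
    have "((\<lambda>t::real. t\<^sup>2) has_real_derivative 2 * t) (at t)"
      by (auto intro!: derivative_eq_intros)
    then have "((\<lambda>t::real. (max 0 t)\<^sup>2) has_real_derivative 2 * t) (at t)"
      by (rule has_field_derivative_transform_within_open[of _ _ _ "{0<..}"]) (use 2 in auto)
    with 2 show ?thesis by simp
  qed
qed

lemma C1_cutoff:
  "c \<noteq> 0 \<Longrightarrow> Ck 1 (\<lambda>x::'a::euclidean_space. (max 0 (1 - x \<bullet> x / c))\<^sup>2)"
proof -
  assume c: "c \<noteq> 0"
  let ?f' = "\<lambda>x h::'a. - (2 * (x \<bullet> h) / c) * (2 * max 0 (1 - x \<bullet> x / c))"
  have "((\<lambda>x. (max 0 (1 - x \<bullet> x / c))\<^sup>2) has_derivative ?f' x) (at x)" for x :: 'a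
  proof -
    have "((\<lambda>x. 1 - x \<bullet> x / c) has_derivative (\<lambda>h. - (2 * (x \<bullet> h) / c))) (at x)"
      using c by (auto intro!: derivative_eq_intros simp: inner_commute)
    from DERIV_compose_FDERIV[OF positive_part_square_derivative this]
    show ?thesis .
  qed
  moreover have "Ck 0 (\<lambda>x. ?f' x b)" for b :: 'a
    by (auto intro!: continuous_intros simp: divide_inverse)
  ultimately show ?thesis unfolding One_nat_def by (rule Ck_SucI)
qed

text \<open>Supplies admissible substitutes for the sign function in the duality between L^1 and
  bounded functions. The bound 1 has to survive the approximation, because it is the normalisation
  of the fields in \<open>total_variation\<close>.\<close>

lemma C1_bounded_approximation:
  fixes g :: "'a::euclidean_space \<Rightarrow> real"
  assumes g: "g \<in> borel_measurable borel" and bound: "\<And>x. \<bar>g x\<bar> \<le> 1"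
  obtains \<zeta> :: "nat \<Rightarrow> 'a \<Rightarrow> real"
  where "\<And>n. Ck 1 (\<zeta> n)" "\<And>n x. \<bar>\<zeta> n x\<bar> \<le> 1" "\<And>n x. norm x > real (Suc n) \<Longrightarrow> \<zeta> n x = 0"
    "AE x in lborel. (\<lambda>n. \<zeta> n x) \<longlonglongrightarrow> g x"
proof -
  have "g \<in> borel_measurable lebesgue" using g by (simp add: measurable_completion)
  \<comment> \<open>The content of \<open>measurable_on\<close> that matters: \<open>g\<close> is a
    limit of continuous functions off a negligible set.\<close>
  then have "g measurable_on UNIV" by (rule lebesgue_measurable_imp_measurable_on) simp
  then obtain N h where N: "negligible N" and h: "\<And>n. continuous_on UNIV (h n)"
    and lim: "\<And>x. x \<notin> N \<Longrightarrow> (\<lambda>n. h n x) \<longlonglongrightarrow> g x"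
    by (auto simp: measurable_on_def)
  \<comment> \<open>Clamping to \<open>[-1, 1]\<close> does not change the limit, since
    \<open>g\<close> already takes values there.\<close>
  define c where "c n x = max (-1) (min 1 (h n x))" for n :: nat and x
  have c: "continuous_on UNIV (c n)" "\<bar>c n x\<bar> \<le> 1" for n x
    unfolding c_def by (auto intro!: continuous_intros h)
  have "\<exists>p. real_polynomial_function p \<and> (\<forall>x\<in>cball 0 (real (Suc n)). \<bar>c n x - p x\<bar> < 1 / Suc n)" for n
    by (rule Stone_Weierstrass_real_polynomial_function[of "cball 0 (real (Suc n))" "c n" "1 / Suc n"])
      (auto intro: continuous_on_subset[OF c(1)])
  then obtain p where p: "\<And>n. real_polynomial_function (p n)"
    "\<And>n x. norm x \<le> real (Suc n) \<Longrightarrow> \<bar>c n x - p n x\<bar> < 1 / Suc n"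
    by (metis mem_cball_0)
  define cut where "cut n x = (max 0 (1 - x \<bullet> x / (real (Suc n))\<^sup>2))\<^sup>2" for n :: nat and x :: 'a
  \<comment> \<open>On the ball of radius \<open>Suc n\<close> the polynomial exceeds modulus 1 by
    at most \<open>1 / Suc n\<close>. Dividing by \<open>1 + 1 / Suc n\<close> restores the bound 1,
    and \<open>cut\<close> removes the values outside the ball.\<close>
  define \<zeta> where "\<zeta> n x = cut n x * (1 / (1 + 1 / real (Suc n)) * p n x)" for n x
  have cut0: "cut n x = 0" if "norm x > real (Suc n)" for n x
  proof -
    have "(real (Suc n))\<^sup>2 \<le> (norm x)\<^sup>2" using that by (intro power_mono) auto
    then show ?thesis by (simp add: cut_def power2_norm_eq_inner field_simps)
  qed
  have cut1: "0 \<le> cut n x" "cut n x \<le> 1" for n x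
    by (auto simp: cut_def intro!: power_le_one)
  show ?thesis
  proof (rule that)
    show "Ck 1 (\<zeta> n)" for n
      unfolding \<zeta>_def cut_def
      by (intro Ck_mult C1_cutoff Ck_bounded_linear[OF bounded_linear_mult_right] Ck_real_polynomial_function p) simp
    show "\<zeta> n x = 0" if "norm x > real (Suc n)" for n x
      using cut0[OF that] by (simp add: \<zeta>_def)
    show "\<bar>\<zeta> n x\<bar> \<le> 1" for n x
    proof (cases "norm x > real (Suc n)")
      case True
      then show ?thesis using cut0 by (simp add: \<zeta>_def)
    next
      case False
      then have "\<bar>p n x\<bar> \<le> 1 + 1 / real (Suc n)" using p(2)[of x n] c(2)[of n x] by linarith
      moreover have pos: "1 + 1 / real (Suc n) > 0" by (simp add: add_pos_pos)
      ultimately have "\<bar>1 / (1 + 1 / real (Suc n)) * p n x\<bar> \<le> 1"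
      proof -
        assume "\<bar>p n x\<bar> \<le> 1 + 1 / real (Suc n)"
        then have "\<bar>p n x\<bar> / (1 + 1 / real (Suc n)) \<le> 1" using pos by (simp only: divide_le_eq_1_pos)
        then show ?thesis using pos by (simp only: abs_mult abs_divide abs_one abs_of_pos) simp
      qed
      then show ?thesis unfolding \<zeta>_def abs_mult[of "cut n x"]
        using cut1[of n x] by (metis abs_ge_zero abs_of_nonneg mult_le_one)
    qed
    have conv: "(\<lambda>n. \<zeta> n x) \<longlonglongrightarrow> g x" if "x \<notin> N" for x
    proof -
      have inv: "(\<lambda>n. 1 / real (Suc n)) \<longlonglongrightarrow> 0"
        using LIMSEQ_inverse_real_of_nat by (simp add: divide_inverse)
      have "(\<lambda>n. c n x) \<longlonglongrightarrow> max (-1) (min 1 (g x))"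
        unfolding c_def by (intro tendsto_intros lim that)
      moreover have "max (-1) (min 1 (g x)) = g x" using bound[of x] by auto
      ultimately have cg: "(\<lambda>n. c n x) \<longlonglongrightarrow> g x" by simp
      have "(\<lambda>n. c n x - p n x) \<longlonglongrightarrow> 0"
      proof (rule Lim_null_comparison[OF _ inv])
        obtain m where m: "norm x \<le> real m" using real_arch_simple by blast
        show "\<forall>\<^sub>F n in sequentially. norm (c n x - p n x) \<le> 1 / real (Suc n)"
          using eventually_ge_at_top[of m]
        proof eventually_elim
          case (elim n)
          then show ?case using p(2)[of x n] m by simp
        qed
      qed
      from tendsto_diff[OF cg this] have pg: "(\<lambda>n. p n x) \<longlonglongrightarrow> g x" by simp
      have "(\<lambda>n. cut n x) \<longlonglongrightarrow> (max 0 (1 - x \<bullet> x * 0\<^sup>2))\<^sup>2"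
      proof -
        have "cut n x = (max 0 (1 - x \<bullet> x * (1 / real (Suc n))\<^sup>2))\<^sup>2" for n
          by (simp add: cut_def power_divide)
        then show ?thesis by (auto simp only: intro!: tendsto_intros inv)
      qed
      then have "(\<lambda>n. \<zeta> n x) \<longlonglongrightarrow> (max 0 (1 - x \<bullet> x * 0\<^sup>2))\<^sup>2 * (1 / (1 + 0) * g x)"
        unfolding \<zeta>_def by (intro tendsto_intros inv pg) auto
      then show ?thesis by simp
    qed
    have "AE x in lebesgue. x \<notin> N"
      using N by (simp add: negligible_iff_null_sets AE_not_in)
    then have "AE x in lborel. x \<notin> N" by (simp add: AE_completion_iff)
    then show "AE x in lborel. (\<lambda>n. \<zeta> n x) \<longlonglongrightarrow> g x"
      by eventually_elim (rule conv)
  qed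
qed

text \<open>The test field \<open>- (h / norm h) * Z\<close>, with \<open>Z\<close> the average of \<open>\<zeta>\<close> over the segment from \<open>x - h\<close>
  to \<open>x\<close>, has divergence \<open>(\<zeta> (x - h) - \<zeta> x) / norm h\<close>.\<close>

lemma BV_translation_test:
  fixes u :: "'a::euclidean_space \<Rightarrow> real"
  assumes u: "total_variation u < \<infinity>"
    and \<zeta>: "Ck 1 \<zeta>" "\<And>x. \<bar>\<zeta> x\<bar> \<le> 1" "\<And>x. norm x > R \<Longrightarrow> \<zeta> x = 0" and h: "h \<noteq> 0"
  shows "(LINT x|lborel. u x * (\<zeta> (x - h) - \<zeta> x)) \<le> norm h * BV_seminorm u"
proof -
  have \<zeta>d: "\<zeta> differentiable at x" for x using \<zeta>(1) by simp
  define G where "G x = (\<Sum>b\<in>Basis. frechet_derivative \<zeta> (at x) b *\<^sub>R b)" for x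
  have G: "(\<zeta> has_derivative (\<lambda>k. k \<bullet> G x)) (at x)" for x
    using GDERIV_partials[OF \<zeta>d] by (simp add: gderiv_def G_def)
  have Gc: "continuous_on UNIV G"
    unfolding G_def using \<zeta>(1) by (auto intro!: continuous_intros)
  have \<zeta>c: "continuous_on UNIV \<zeta>" using Ck_imp_continuous[OF \<zeta>(1)] .
  define Z where "Z x = integral (cbox 0 1) (\<lambda>t::real. \<zeta> (x - t *\<^sub>R h))" for x
  define G' where "G' x = integral (cbox 0 1) (\<lambda>t::real. G (x - t *\<^sub>R h))" for x
  have cG: "continuous_on UNIV (\<lambda>t::real. G (x - t *\<^sub>R h))" for x
    by (rule continuous_on_compose2[OF Gc]) (auto intro!: continuous_intros)
  have c\<zeta>: "continuous_on UNIV (\<lambda>t::real. \<zeta> (x - t *\<^sub>R h))" for x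
    by (rule continuous_on_compose2[OF \<zeta>c]) (auto intro!: continuous_intros)
  have iG: "(\<lambda>t::real. G (x - t *\<^sub>R h)) integrable_on cbox 0 1" for x
    by (rule integrable_continuous, rule continuous_on_subset[OF cG]) simp
  have i\<zeta>: "(\<lambda>t::real. \<zeta> (x - t *\<^sub>R h)) integrable_on cbox 0 1" for x
    by (rule integrable_continuous, rule continuous_on_subset[OF c\<zeta>]) simp
  have Zd: "(Z has_derivative (\<lambda>k. k \<bullet> G' x)) (at x)" for x
  proof -
    \<comment> \<open>Differentiation under the integral sign: the gradient of the average
      \<open>Z\<close> is the average \<open>G'\<close> of the gradients along the segment.\<close>
    have "((\<lambda>x. integral (cbox 0 1) (\<lambda>t::real. \<zeta> (x - t *\<^sub>R h))) has_derivative
        integral (cbox 0 1) (\<lambda>t::real. blinfun_inner_left (G (x - t *\<^sub>R h)))) (at x within UNIV)"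
    proof (rule leibniz_rule)
      show "((\<lambda>x. \<zeta> (x - t *\<^sub>R h)) has_derivative blinfun_inner_left (G (x - t *\<^sub>R h))) (at x within UNIV)" for x t
      proof -
        have "((\<lambda>x. x - t *\<^sub>R h) has_derivative (\<lambda>k. k)) (at x)" by (auto intro!: derivative_eq_intros)
        from has_derivative_compose[OF this G] show ?thesis by simp
      qed
      have "continuous_on (UNIV \<times> cbox 0 1) (\<lambda>p::'a\<times>real. G (fst p - snd p *\<^sub>R h))"
        by (rule continuous_on_compose2[OF Gc]) (auto intro!: continuous_intros)
      then show "continuous_on (UNIV \<times> cbox 0 1) (\<lambda>(x, t::real). blinfun_inner_left (G (x - t *\<^sub>R h)))"
        unfolding case_prod_beta by (rule bounded_linear.continuous_on[OF bounded_linear_blinfun_inner_left])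
    qed (use i\<zeta> in auto)
    moreover have "blinfun_apply (integral (cbox 0 1) (\<lambda>t::real. blinfun_inner_left (G (x - t *\<^sub>R h)))) = (\<lambda>k. k \<bullet> G' x)"
    proof
      fix k
      have cb: "continuous_on UNIV (\<lambda>t::real. blinfun_inner_left (G (x - t *\<^sub>R h)))"
        by (rule bounded_linear.continuous_on[OF bounded_linear_blinfun_inner_left cG])
      have "blinfun_apply (integral (cbox 0 1) (\<lambda>t::real. blinfun_inner_left (G (x - t *\<^sub>R h)))) k
          = integral (cbox 0 1) (\<lambda>t::real. blinfun_inner_left (G (x - t *\<^sub>R h)) k)"
        by (rule blinfun_apply_integral, rule integrable_continuous, rule continuous_on_subset[OF cb]) simp
      also have "\<dots> = k \<bullet> G' x"
        using integral_linear[OF iG[of x] bounded_linear_inner_right[of k]] by (simp add: o_def G'_def)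
      finally show "blinfun_apply (integral (cbox 0 1) (\<lambda>t::real. blinfun_inner_left (G (x - t *\<^sub>R h)))) k = k \<bullet> G' x" .
    qed
    ultimately show ?thesis unfolding Z_def[abs_def] by simp
  qed
  have G'c: "continuous_on UNIV G'"
    unfolding G'_def
  proof (rule integral_continuous_on_param)
    have "continuous_on (UNIV \<times> cbox 0 1) (\<lambda>p::'a\<times>real. G (fst p - snd p *\<^sub>R h))"
      by (rule continuous_on_compose2[OF Gc]) (auto intro!: continuous_intros)
    then show "continuous_on (UNIV \<times> cbox 0 1) (\<lambda>(x, t::real). G (x - t *\<^sub>R h))"
      by (simp add: case_prod_beta)
  qed
  have hG': "h \<bullet> G' x = \<zeta> x - \<zeta> (x - h)" for x
  proof -
    have "((\<lambda>t. - (h \<bullet> G (x - t *\<^sub>R h))) has_integral (\<zeta> (x - 1 *\<^sub>R h) - \<zeta> (x - 0 *\<^sub>R h))) {0..1::real}"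
    proof (rule fundamental_theorem_of_calculus)
      fix t :: real
      have "((\<lambda>t. x - t *\<^sub>R h) has_derivative (\<lambda>k. - (k *\<^sub>R h))) (at t within {0..1})"
        by (auto intro!: derivative_eq_intros)
      from has_derivative_compose[OF this G]
      show "((\<lambda>t. \<zeta> (x - t *\<^sub>R h)) has_vector_derivative - (h \<bullet> G (x - t *\<^sub>R h))) (at t within {0..1})"
        by (simp add: has_vector_derivative_def)
    qed simp
    moreover have "((\<lambda>t. h \<bullet> G (x - t *\<^sub>R h)) has_integral (h \<bullet> G' x)) {0..1::real}"
      using has_integral_linear[OF integrable_integral[OF iG[of x]] bounded_linear_inner_right[of h]]
      by (simp add: o_def G'_def)
    ultimately have "- (h \<bullet> G' x) = \<zeta> (x - 1 *\<^sub>R h) - \<zeta> (x - 0 *\<^sub>R h)"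
      using has_integral_unique[OF has_integral_neg] by blast
    then show ?thesis by simp
  qed
  define \<Psi> where "\<Psi> x = (- (1 / norm h) * Z x) *\<^sub>R h" for x
  have \<Psi>d: "(\<Psi> has_derivative (\<lambda>k. (- (1 / norm h) * (k \<bullet> G' x)) *\<^sub>R h)) (at x)" for x
    unfolding \<Psi>_def by (rule has_derivative_scaleR_left has_derivative_mult_right Zd)+
  \<comment> \<open>The field is a scalar times the fixed vector \<open>h\<close>, so its divergence
    is the derivative of the scalar along \<open>h\<close>. By \<open>hG'\<close> this is an
    increment of \<zeta>.\<close>
  have div\<Psi>: "divergence \<Psi> x = (\<zeta> (x - h) - \<zeta> x) / norm h" for x
  proof -
    have "divergence \<Psi> x = (\<Sum>b\<in>Basis. ((- (1 / norm h) * (b \<bullet> G' x)) *\<^sub>R h) \<bullet> b)"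
      unfolding divergence_def by (simp only: frechet_derivative_at[OF \<Psi>d[of x], symmetric])
    also have "\<dots> = - (1 / norm h) * (\<Sum>b\<in>Basis. (h \<bullet> b) * (G' x \<bullet> b))"
      by (simp add: sum_distrib_left inner_commute mult_ac sum_negf)
    also have "\<dots> = - (1 / norm h) * (h \<bullet> G' x)" by (simp add: euclidean_inner[symmetric])
    finally show ?thesis by (simp add: hG' diff_divide_distrib)
  qed
  have \<Psi>1: "Ck 1 \<Psi>"
    unfolding One_nat_def
  proof (rule Ck_SucI[OF \<Psi>d])
    show "Ck 0 (\<lambda>x. (- (1 / norm h) * (b \<bullet> G' x)) *\<^sub>R h)" for b
      using h by (auto intro!: continuous_intros G'c)
  qed
  have \<Psi>2: "compact (support \<Psi>)"
    unfolding compact_support_iff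
  proof (intro exI allI impI)
    fix x assume "\<Psi> x \<noteq> 0"
    show "norm x \<le> R + norm h"
    proof (rule ccontr)
      assume *: "\<not> norm x \<le> R + norm h"
      have "\<zeta> (x - t *\<^sub>R h) = 0" if "t \<in> cbox 0 1" for t :: real
      proof (rule \<zeta>(3))
        have "norm (t *\<^sub>R h) \<le> norm h" using that by (simp add: mult_left_le_one_le)
        then show "norm (x - t *\<^sub>R h) > R" using * norm_triangle_ineq2[of x "t *\<^sub>R h"] by linarith
      qed
      then have "Z x = integral (cbox 0 1) (\<lambda>t::real. 0)" unfolding Z_def by (intro integral_cong) auto
      with \<open>\<Psi> x \<noteq> 0\<close> show False by (simp add: \<Psi>_def)
    qed
  qed
  have \<Psi>3: "norm (\<Psi> x) \<le> 1" for x
  proof -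
    have "norm (Z x) \<le> 1 * Henstock_Kurzweil_Integration.content (cbox 0 (1::real))"
      unfolding Z_def by (rule integrable_bound) (use \<zeta>(2) i\<zeta> in auto)
    then show ?thesis using h by (simp add: \<Psi>_def)
  qed
  have "ereal (LINT x|lborel. u x * divergence \<Psi> x) \<le> total_variation u"
    unfolding total_variation_def by (rule SUP_upper) (use \<Psi>1 \<Psi>2 \<Psi>3 in auto)
  \<comment> \<open>\<open>BV_seminorm\<close> is a conversion to a real and is faithful only for a
    finite value. Finiteness from above is assumed; from below it follows from the test just
    made.\<close>
  also have "total_variation u = ereal (BV_seminorm u)"
  proof -
    have "\<bar>total_variation u\<bar> \<noteq> \<infinity>"
      using u \<open>ereal (LINT x|lborel. u x * divergence \<Psi> x) \<le> total_variation u\<close> by auto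
    then show ?thesis unfolding BV_seminorm_def by (simp add: ereal_real')
  qed
  finally have "(LINT x|lborel. u x * divergence \<Psi> x) \<le> BV_seminorm u" by simp
  moreover have "(LINT x|lborel. u x * divergence \<Psi> x) = (LINT x|lborel. u x * (\<zeta> (x - h) - \<zeta> x)) / norm h"
    by (simp add: div\<Psi>)
  ultimately show ?thesis using h by (simp add: field_simps)
qed

text \<open>As \<open>\<bar>a\<bar> = a * sgn a\<close>, the left side is a limit of integrals
  against smooth approximations of the sign of the increment. In each of them a change of variables
  moves the translation from \<open>u\<close> to the test function.\<close>

lemma BV_translation:
  fixes u :: "'a::euclidean_space \<Rightarrow> real"
  assumes u: "integrable lborel u" "total_variation u < \<infinity>"
  shows "(LINT x|lborel. \<bar>u (x + h) - u x\<bar>) \<le> norm h * BV_seminorm u"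
proof (cases "h = 0")
  case False
  have [measurable]: "u \<in> borel_measurable borel" using u(1) borel_measurable_integrable by auto
  have uh: "integrable lborel (\<lambda>x. u (x + h))"
    using lborel_integrable_translate(1)[OF u(1), of h] by (simp add: add.commute)
  let ?g = "\<lambda>x. sgn (u (x + h) - u x)"
  have gm: "?g \<in> borel_measurable borel" by measurable
  have g1: "\<bar>?g x\<bar> \<le> 1" for x by (simp add: sgn_if)
  obtain \<zeta> :: "nat \<Rightarrow> 'a \<Rightarrow> real" where \<zeta>: "\<And>n. Ck 1 (\<zeta> n)" "\<And>n x. \<bar>\<zeta> n x\<bar> \<le> 1"
    "\<And>n x. norm x > real (Suc n) \<Longrightarrow> \<zeta> n x = 0" "AE x in lborel. (\<lambda>n. \<zeta> n x) \<longlonglongrightarrow> ?g x"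
    by (rule C1_bounded_approximation[OF gm g1]) blast
  have [measurable]: "\<zeta> n \<in> borel_measurable borel" for n
    using Ck_imp_continuous[OF \<zeta>(1)] borel_measurable_continuous_onI by blast
  have bnd: "\<bar>a * \<zeta> n x\<bar> \<le> \<bar>a\<bar>" for a n x
    using mult_left_mono[OF \<zeta>(2)[of n x], of "\<bar>a\<bar>"] by (simp add: abs_mult)
  have le: "(LINT x|lborel. (u (x + h) - u x) * \<zeta> n x) \<le> norm h * BV_seminorm u" for n
  proof -
    have i1: "integrable lborel (\<lambda>x. u (x + h) * \<zeta> n x)"
      by (rule Bochner_Integration.integrable_bound[OF uh]) (use bnd in auto)
    have i2: "integrable lborel (\<lambda>x. u x * \<zeta> n x)"
      by (rule Bochner_Integration.integrable_bound[OF u(1)]) (use bnd in auto)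
    have i3: "integrable lborel (\<lambda>x. u x * \<zeta> n (x - h))"
      by (rule Bochner_Integration.integrable_bound[OF u(1)]) (use bnd \<zeta>(2) in \<open>auto simp: abs_mult mult_left_le\<close>)
    have "(LINT x|lborel. u (x + h) * \<zeta> n x) = (LINT x|lborel. u x * \<zeta> n (x - h))"
      using lborel_integral_translate(1)[of "\<lambda>x. u x * \<zeta> n (x - h)" h] by (simp add: add.commute)
    then have "(LINT x|lborel. (u (x + h) - u x) * \<zeta> n x) = (LINT x|lborel. u x * (\<zeta> n (x - h) - \<zeta> n x))"
      using i1 i2 i3 by (simp add: left_diff_distrib right_diff_distrib)
    also have "\<dots> \<le> norm h * BV_seminorm u"
      by (rule BV_translation_test[OF u(2) \<zeta>(1,2,3) False])
    finally show ?thesis .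
  qed
  have "(\<lambda>n. LINT x|lborel. (u (x + h) - u x) * \<zeta> n x) \<longlonglongrightarrow> (LINT x|lborel. (u (x + h) - u x) * ?g x)"
  proof (rule integral_dominated_convergence[where w="\<lambda>x. \<bar>u (x + h) - u x\<bar>"])
    show "integrable lborel (\<lambda>x. \<bar>u (x + h) - u x\<bar>)" using u uh by auto
    show "AE x in lborel. (\<lambda>n. (u (x + h) - u x) * \<zeta> n x) \<longlonglongrightarrow> (u (x + h) - u x) * ?g x"
      using \<zeta>(4) by eventually_elim (intro tendsto_intros)
    show "AE x in lborel. norm ((u (x + h) - u x) * \<zeta> n x) \<le> \<bar>u (x + h) - u x\<bar>" for n
      using bnd by simp
  qed measurable
  then have "(LINT x|lborel. (u (x + h) - u x) * ?g x) \<le> norm h * BV_seminorm u"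
    by (rule LIMSEQ_le_const2) (use le in blast)
  then show ?thesis by (simp add: abs_sgn)
qed simp

section \<open>Integrability of doubled integrands\<close>

lemma borel_measurable_fst_euclidean [measurable]:
  "fst \<in> borel_measurable (borel :: ('a::euclidean_space \<times> 'b::euclidean_space) measure)"
  by (intro borel_measurable_continuous_onI continuous_intros)

lemma borel_measurable_snd_euclidean [measurable]:
  "snd \<in> borel_measurable (borel :: ('a::euclidean_space \<times> 'b::euclidean_space) measure)"
  by (intro borel_measurable_continuous_onI continuous_intros)

section \<open>Fubini, Tonelli and changes of variable on products\<close>

lemma lborel_Fubini:
  fixes f :: "'a::euclidean_space \<times> 'b::euclidean_space \<Rightarrow> 'c::{banach, second_countable_topology}"
  assumes "integrable lborel f"
  shows "(LINT x|lborel. LINT y|lborel. f (x, y)) = (LINT z|lborel. f z)"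
    "(LINT y|lborel. LINT x|lborel. f (x, y)) = (LINT z|lborel. f z)"
    "integrable lborel (\<lambda>x. LINT y|lborel. f (x, y))"
    "integrable lborel (\<lambda>y. LINT x|lborel. f (x, y))"
    "AE x in lborel. integrable lborel (\<lambda>y. f (x, y))"
    "AE y in lborel. integrable lborel (\<lambda>x. f (x, y))"
proof -
  have f: "integrable (lborel \<Otimes>\<^sub>M lborel) f" using assms by (simp add: lborel_prod)
  then have f': "integrable (lborel \<Otimes>\<^sub>M lborel) (\<lambda>(x, y). f (x, y))" by simp
  show "(LINT x|lborel. LINT y|lborel. f (x, y)) = (LINT z|lborel. f z)"
    using lborel_pair.integral_fst'[OF f] by (simp add: lborel_prod)
  show "(LINT y|lborel. LINT x|lborel. f (x, y)) = (LINT z|lborel. f z)"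
    using lborel_pair.integral_snd[OF f'] by (simp add: lborel_prod)
  show "integrable lborel (\<lambda>x. LINT y|lborel. f (x, y))"
    by (rule lborel_pair.integrable_fst'[OF f])
  show "integrable lborel (\<lambda>y. LINT x|lborel. f (x, y))"
    using lborel_pair.integrable_snd[OF f'] .
  show "AE x in lborel. integrable lborel (\<lambda>y. f (x, y))"
    by (rule lborel_pair.AE_integrable_fst'[OF f])
  show "AE y in lborel. integrable lborel (\<lambda>x. f (x, y))"
    using lborel_pair.AE_integrable_snd[OF f'] .
qed

lemma lborel_Tonelli:
  fixes f :: "'a::euclidean_space \<times> 'b::euclidean_space \<Rightarrow> ennreal"
  assumes "f \<in> borel_measurable borel"
  shows "(\<integral>\<^sup>+z. f z \<partial>lborel) = (\<integral>\<^sup>+x. \<integral>\<^sup>+y. f (x, y) \<partial>lborel \<partial>lborel)"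
    "(\<integral>\<^sup>+z. f z \<partial>lborel) = (\<integral>\<^sup>+y. \<integral>\<^sup>+x. f (x, y) \<partial>lborel \<partial>lborel)"
proof -
  have f: "f \<in> borel_measurable (lborel \<Otimes>\<^sub>M lborel)" using assms by (simp add: lborel_prod)
  show "(\<integral>\<^sup>+z. f z \<partial>lborel) = (\<integral>\<^sup>+x. \<integral>\<^sup>+y. f (x, y) \<partial>lborel \<partial>lborel)"
    using lborel.nn_integral_fst[OF f] by (simp add: lborel_prod)
  show "(\<integral>\<^sup>+z. f z \<partial>lborel) = (\<integral>\<^sup>+y. \<integral>\<^sup>+x. f (x, y) \<partial>lborel \<partial>lborel)"
    using lborel_pair.nn_integral_snd[OF f] by (simp add: lborel_prod)
qed

lemma lborel_integrable_swap:
  fixes f :: "'a::euclidean_space \<times> 'b::euclidean_space \<Rightarrow> 'c::{banach, second_countable_topology}"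
  assumes "integrable lborel f"
  shows "integrable lborel (\<lambda>z. f (snd z, fst z))"
proof -
  have "integrable (lborel \<Otimes>\<^sub>M lborel) f" using assms by (simp add: lborel_prod)
  from lborel_pair.integrable_product_swap[OF this] show ?thesis
    by (simp add: lborel_prod case_prod_unfold)
qed

lemma lborel_integral_swap:
  fixes f :: "'a::euclidean_space \<times> 'b::euclidean_space \<Rightarrow> 'c::{banach, second_countable_topology}"
  assumes "f \<in> borel_measurable borel"
  shows "(LINT z|lborel. f (snd z, fst z)) = (LINT z|lborel. f z)"
proof -
  have "f \<in> borel_measurable (lborel \<Otimes>\<^sub>M lborel)" using assms by (simp add: lborel_prod)
  from lborel_pair.integral_product_swap[OF this] show ?thesis
    by (simp add: lborel_prod case_prod_unfold)
qed

lemma lborel_nn_integral_reflect: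
  fixes f :: "'a::euclidean_space \<Rightarrow> ennreal"
  assumes [measurable]: "f \<in> borel_measurable borel"
  shows "(\<integral>\<^sup>+x. f (t - x) \<partial>lborel) = (\<integral>\<^sup>+x. f x \<partial>lborel)" "(\<integral>\<^sup>+x. f (x - t) \<partial>lborel) = (\<integral>\<^sup>+x. f x \<partial>lborel)"
proof -
  show "(\<integral>\<^sup>+x. f (t - x) \<partial>lborel) = (\<integral>\<^sup>+x. f x \<partial>lborel)"
    by (subst (2) lborel_affine[of "-1" t]) (auto simp: nn_integral_density nn_integral_distr)
  show "(\<integral>\<^sup>+x. f (x - t) \<partial>lborel) = (\<integral>\<^sup>+x. f x \<partial>lborel)"
    by (subst (2) lborel_affine[of "1" "-t"]) (auto simp: nn_integral_density nn_integral_distr)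
qed

lemma nn_integral_abs_eq: "integrable M J \<Longrightarrow> (\<integral>\<^sup>+x. ennreal \<bar>J x\<bar> \<partial>M) = ennreal (LINT x|M. \<bar>J x\<bar>)"
  for J :: "_ \<Rightarrow> real"
  by (rule nn_integral_eq_integral) auto

text \<open>A Schur-type bound: a uniform bound on the sections of \<open>H\<close> lets the second
  variable be integrated out first, which leaves a multiple of the L^1 norm of
  \<open>V\<close>.\<close>

lemma integrable_kernel_fst:
  fixes V :: "'a::euclidean_space \<Rightarrow> real" and H :: "'a \<times> 'b::euclidean_space \<Rightarrow> real"
  assumes V: "integrable lborel V" and H[measurable]: "H \<in> borel_measurable borel"
    and bound: "\<And>p. (\<integral>\<^sup>+q. ennreal \<bar>H (p, q)\<bar> \<partial>lborel) \<le> ennreal C"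
  shows "integrable lborel (\<lambda>z. V (fst z) * H z)"
proof (rule integrableI_bounded)
  have [measurable]: "V \<in> borel_measurable borel" using borel_measurable_integrable[OF V] by simp
  show "(\<lambda>z. V (fst z) * H z) \<in> borel_measurable lborel" by measurable
  have "(\<integral>\<^sup>+z. ennreal (norm (V (fst z) * H z)) \<partial>lborel)
      = (\<integral>\<^sup>+p. \<integral>\<^sup>+q. ennreal \<bar>V p\<bar> * ennreal \<bar>H (p, q)\<bar> \<partial>lborel \<partial>lborel)"
    by (subst lborel_Tonelli(1)) (auto simp: abs_mult ennreal_mult)
  also have "\<dots> = (\<integral>\<^sup>+p. ennreal \<bar>V p\<bar> * (\<integral>\<^sup>+q. ennreal \<bar>H (p, q)\<bar> \<partial>lborel) \<partial>lborel)"
    by (intro nn_integral_cong nn_integral_cmult) measurable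
  also have "\<dots> \<le> (\<integral>\<^sup>+p. ennreal \<bar>V p\<bar> * ennreal C \<partial>lborel)"
    by (intro nn_integral_mono mult_left_mono bound) simp
  also have "\<dots> = (\<integral>\<^sup>+p. ennreal \<bar>V p\<bar> \<partial>lborel) * ennreal C"
    by (rule nn_integral_multc) measurable
  also have "\<dots> < \<infinity>"
    unfolding nn_integral_abs_eq[OF V] by (simp add: ennreal_mult_less_top)
  finally show "(\<integral>\<^sup>+z. ennreal (norm (V (fst z) * H z)) \<partial>lborel) < \<infinity>" .
qed

lemma integrable_kernel_snd:
  fixes U :: "'b::euclidean_space \<Rightarrow> real" and H :: "'a::euclidean_space \<times> 'b \<Rightarrow> real"
  assumes U: "integrable lborel U" and H[measurable]: "H \<in> borel_measurable borel"
    and bound: "\<And>q. (\<integral>\<^sup>+p. ennreal \<bar>H (p, q)\<bar> \<partial>lborel) \<le> ennreal C"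
  shows "integrable lborel (\<lambda>z. U (snd z) * H z)"
proof -
  have "integrable lborel (\<lambda>z. U (fst z) * H (snd z, fst z))"
    by (rule integrable_kernel_fst[OF U]) (use bound in auto)
  from lborel_integrable_swap[OF this] show ?thesis by simp
qed

text \<open>The reason that no cutoff in space is needed. The factor
  \<open>\<bar>V p\<bar> + \<bar>U q\<bar>\<close> is not integrable over pairs, but each summand is
  integrable in one variable and \<open>H\<close> handles the other.\<close>

lemma integrable_doubling:
  fixes V :: "'a::euclidean_space \<Rightarrow> real" and U :: "'b::euclidean_space \<Rightarrow> real"
    and H G :: "'a \<times> 'b \<Rightarrow> real"
  assumes V: "integrable lborel V" and U: "integrable lborel U" and H[measurable]: "H \<in> borel_measurable borel"
    and bound1: "\<And>p. (\<integral>\<^sup>+q. ennreal \<bar>H (p, q)\<bar> \<partial>lborel) \<le> ennreal C"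
    and bound2: "\<And>q. (\<integral>\<^sup>+p. ennreal \<bar>H (p, q)\<bar> \<partial>lborel) \<le> ennreal C'"
    and G: "G \<in> borel_measurable borel"
    and le: "\<And>p q. \<bar>G (p, q)\<bar> \<le> (\<bar>V p\<bar> + \<bar>U q\<bar>) * \<bar>H (p, q)\<bar>"
  shows "integrable lborel G"
proof (rule Bochner_Integration.integrable_bound)
  show "integrable lborel (\<lambda>z. \<bar>V (fst z) * H z\<bar> + \<bar>U (snd z) * H z\<bar>)"
    by (intro Bochner_Integration.integrable_add integrable_abs
        integrable_kernel_fst[OF V H bound1] integrable_kernel_snd[OF U H bound2])
  have "\<bar>G z\<bar> \<le> \<bar>V (fst z) * H z\<bar> + \<bar>U (snd z) * H z\<bar>" for z
    using le[of "fst z" "snd z"] by (simp add: abs_mult distrib_right)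
  then show "AE z in lborel. norm (G z) \<le> norm (\<bar>V (fst z) * H z\<bar> + \<bar>U (snd z) * H z\<bar>)"
    by (intro AE_I2) (metis abs_of_nonneg abs_ge_zero add_nonneg_nonneg real_norm_def)
qed (use G in simp)

lemma nn_integral_slab:
  fixes J :: "'a::euclidean_space \<Rightarrow> real"
  assumes J: "integrable lborel J" and T: "T > 0"
  shows "(\<integral>\<^sup>+q. ennreal \<bar>indicator {0<..<T} (snd q) * J (x - fst q)\<bar> \<partial>lborel) = ennreal (T * L1_norm J)"
    "(\<integral>\<^sup>+p. ennreal \<bar>indicator {0<..<T} (snd p) * J (fst p - x)\<bar> \<partial>lborel) = ennreal (T * L1_norm J)"
proof -
  have [measurable]: "J \<in> borel_measurable borel" using borel_measurable_integrable[OF J] by simp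
  have time: "(\<integral>\<^sup>+t. ennreal (indicator {0<..<T} t) * c \<partial>lborel) = ennreal T * c" for c
    using T by (subst nn_integral_multc) (auto simp: ennreal_indicator)
  have space: "(\<integral>\<^sup>+y. ennreal \<bar>J (x - y)\<bar> \<partial>lborel) = ennreal (L1_norm J)"
    "(\<integral>\<^sup>+y. ennreal \<bar>J (y - x)\<bar> \<partial>lborel) = ennreal (L1_norm J)"
    using lborel_nn_integral_reflect[of "\<lambda>y. ennreal \<bar>J y\<bar>" x] nn_integral_abs_eq[OF J] by simp_all
  have "(\<integral>\<^sup>+q. ennreal \<bar>indicator {0<..<T} (snd q) * J (x - fst q)\<bar> \<partial>lborel)
      = (\<integral>\<^sup>+t. \<integral>\<^sup>+y. ennreal (indicator {0<..<T} t) * ennreal \<bar>J (x - y)\<bar> \<partial>lborel \<partial>lborel)"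
    by (subst lborel_Tonelli(2)) (auto simp: abs_mult ennreal_mult)
  also have "\<dots> = (\<integral>\<^sup>+t. ennreal (indicator {0<..<T} t) * ennreal (L1_norm J) \<partial>lborel)"
    by (intro nn_integral_cong, subst nn_integral_cmult) (simp_all add: space)
  finally show "(\<integral>\<^sup>+q. ennreal \<bar>indicator {0<..<T} (snd q) * J (x - fst q)\<bar> \<partial>lborel) = ennreal (T * L1_norm J)"
    using T by (simp add: time ennreal_mult)
  have "(\<integral>\<^sup>+q. ennreal \<bar>indicator {0<..<T} (snd q) * J (fst q - x)\<bar> \<partial>lborel)
      = (\<integral>\<^sup>+t. \<integral>\<^sup>+y. ennreal (indicator {0<..<T} t) * ennreal \<bar>J (y - x)\<bar> \<partial>lborel \<partial>lborel)"
    by (subst lborel_Tonelli(2)) (auto simp: abs_mult ennreal_mult)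
  also have "\<dots> = (\<integral>\<^sup>+t. ennreal (indicator {0<..<T} t) * ennreal (L1_norm J) \<partial>lborel)"
    by (intro nn_integral_cong, subst nn_integral_cmult) (simp_all add: space)
  finally show "(\<integral>\<^sup>+q. ennreal \<bar>indicator {0<..<T} (snd q) * J (fst q - x)\<bar> \<partial>lborel) = ennreal (T * L1_norm J)"
    using T by (simp add: time ennreal_mult)
qed

lemma mem_Q: "p \<in> Q T \<longleftrightarrow> 0 < snd p \<and> snd p < T"
  by (cases p) (auto simp: Q_def)

lemma indicator_Q [simp]: "indicator (Q T) p = (indicator {0<..<T} (snd p) :: 'b::zero_neq_one)"
  by (auto simp: mem_Q indicator_def)

lemma Q_borel [measurable]: "Q T \<in> sets borel"
  unfolding Q_def by (intro borel_open open_Times) auto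

abbreviation doubled_integral :: "real \<Rightarrow> (('a::euclidean_space \<times> real) \<times> ('a \<times> real) \<Rightarrow> real) \<Rightarrow> real" where
  "doubled_integral T G \<equiv> LINT z:Q T \<times> Q T|lborel. G z"

abbreviation doubled_integrable :: "real \<Rightarrow> (('a::euclidean_space \<times> real) \<times> ('a \<times> real) \<Rightarrow> real) \<Rightarrow> bool" where
  "doubled_integrable T \<equiv> set_integrable lborel (Q T \<times> Q T)"

lemma integrable_doubling_Q:
  fixes V U :: "'a::euclidean_space \<times> real \<Rightarrow> real" and J :: "'a \<Rightarrow> real"
  assumes V: "integrable lborel V" and U: "integrable lborel U" and J: "integrable lborel J" and T: "T > 0"
    and G[measurable]: "G \<in> borel_measurable borel"
    and le: "\<And>p q. p \<in> Q T \<Longrightarrow> q \<in> Q T \<Longrightarrow> \<bar>G (p, q)\<bar> \<le> (\<bar>V p\<bar> + \<bar>U q\<bar>) * \<bar>J (fst p - fst q)\<bar>"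
  shows "doubled_integrable T G"
proof -
  have [measurable]: "J \<in> borel_measurable borel" using borel_measurable_integrable[OF J] by simp
  \<comment> \<open>In time the kernel is only the indicator of the interval, so integrating it out
    costs the factor \<open>T\<close>; in space it costs the L^1 norm of \<open>J\<close>.\<close>
  define H where "H z = indicator {0<..<T} (snd (fst z)) * (indicator {0<..<T} (snd (snd z)) * J (fst (fst z) - fst (snd z)))"
    for z :: "('a \<times> real) \<times> ('a \<times> real)"
  have [measurable]: "H \<in> borel_measurable borel" unfolding H_def by measurable
  have "integrable lborel (\<lambda>z. indicator (Q T \<times> Q T) z *\<^sub>R G z)"
  proof (rule integrable_doubling[OF V U, of H "T * L1_norm J" "T * L1_norm J"])
    show "(\<integral>\<^sup>+q. ennreal \<bar>H (p, q)\<bar> \<partial>lborel) \<le> ennreal (T * L1_norm J)" for p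
    proof -
      have "(\<integral>\<^sup>+q. ennreal \<bar>H (p, q)\<bar> \<partial>lborel)
          \<le> (\<integral>\<^sup>+q. ennreal \<bar>indicator {0<..<T} (snd q) * J (fst p - fst q)\<bar> \<partial>lborel)"
        by (intro nn_integral_mono) (auto simp: H_def indicator_def)
      then show ?thesis by (simp only: nn_integral_slab(1)[OF J T])
    qed
    show "(\<integral>\<^sup>+p. ennreal \<bar>H (p, q)\<bar> \<partial>lborel) \<le> ennreal (T * L1_norm J)" for q
    proof -
      have "(\<integral>\<^sup>+p. ennreal \<bar>H (p, q)\<bar> \<partial>lborel)
          \<le> (\<integral>\<^sup>+p. ennreal \<bar>indicator {0<..<T} (snd p) * J (fst p - fst q)\<bar> \<partial>lborel)"
        by (intro nn_integral_mono) (auto simp: H_def indicator_def)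
      then show ?thesis by (simp only: nn_integral_slab(2)[OF J T])
    qed
    have "Q T \<times> Q T \<in> sets (borel :: (('a \<times> real) \<times> ('a \<times> real)) measure)"
      unfolding Q_def by (intro borel_open open_Times) auto
    then show "(\<lambda>z. indicator (Q T \<times> Q T) z *\<^sub>R G z) \<in> borel_measurable borel"
      by measurable
    show "\<bar>indicator (Q T \<times> Q T) (p, q) *\<^sub>R G (p, q)\<bar> \<le> (\<bar>V p\<bar> + \<bar>U q\<bar>) * \<bar>H (p, q)\<bar>" for p q
      using le[of p q] by (cases "p \<in> Q T \<and> q \<in> Q T") (auto simp: indicator_times H_def mem_Q)
  qed measurable
  then show ?thesis by (simp add: set_integrable_def)
qed

lemma integrable_doubling_slice:
  fixes V :: "'a::euclidean_space \<times> real \<Rightarrow> real" and U J :: "'a \<Rightarrow> real"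
  assumes V: "integrable lborel V" and U: "integrable lborel U" and J: "integrable lborel J" and T: "T > 0"
    and G[measurable]: "G \<in> borel_measurable borel"
    and le: "\<And>p y. p \<in> Q T \<Longrightarrow> \<bar>G (p, y)\<bar> \<le> (\<bar>V p\<bar> + \<bar>U y\<bar>) * \<bar>J (fst p - y)\<bar>"
  shows "set_integrable lborel (Q T \<times> UNIV) G"
proof -
  have [measurable]: "J \<in> borel_measurable borel" using borel_measurable_integrable[OF J] by simp
  define H where "H z = indicator {0<..<T} (snd (fst z)) * J (fst (fst z) - snd z)"
    for z :: "('a \<times> real) \<times> 'a"
  have [measurable]: "H \<in> borel_measurable borel" unfolding H_def by measurable
  have "integrable lborel (\<lambda>z. indicator (Q T \<times> UNIV) z *\<^sub>R G z)"
  proof (rule integrable_doubling[OF V U, of H "L1_norm J" "T * L1_norm J"])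
    show "(\<integral>\<^sup>+q. ennreal \<bar>H (p, q)\<bar> \<partial>lborel) \<le> ennreal (L1_norm J)" for p
    proof -
      have "(\<integral>\<^sup>+q. ennreal \<bar>H (p, q)\<bar> \<partial>lborel) \<le> (\<integral>\<^sup>+q. ennreal \<bar>J (fst p - q)\<bar> \<partial>lborel)"
        by (intro nn_integral_mono) (auto simp: H_def indicator_def)
      then show ?thesis
        using lborel_nn_integral_reflect(1)[of "\<lambda>y. ennreal \<bar>J y\<bar>" "fst p"] by (simp add: nn_integral_abs_eq[OF J])
    qed
    show "(\<integral>\<^sup>+p. ennreal \<bar>H (p, q)\<bar> \<partial>lborel) \<le> ennreal (T * L1_norm J)" for q
      unfolding H_def fst_conv snd_conv by (simp only: nn_integral_slab(2)[OF J T])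
    have "Q T \<times> UNIV \<in> sets (borel :: (('a \<times> real) \<times> 'a) measure)"
      unfolding Q_def by (intro borel_open open_Times) auto
    then show "(\<lambda>z. indicator (Q T \<times> UNIV) z *\<^sub>R G z) \<in> borel_measurable borel"
      by measurable
    show "\<bar>indicator (Q T \<times> UNIV) (p, q) *\<^sub>R G (p, q)\<bar> \<le> (\<bar>V p\<bar> + \<bar>U q\<bar>) * \<bar>H (p, q)\<bar>" for p q
      using le[of p q] by (cases "p \<in> Q T") (auto simp: indicator_times H_def mem_Q)
  qed measurable
  then show ?thesis by (simp add: set_integrable_def)
qed

section \<open>The mollified distance\<close>

text \<open>The functional called \<open>P K g w\<close> in the overview. Here \<open>g\<close> is a
  function of \<open>y\<close> and \<open>w\<close> of \<open>x\<close>; as \<open>K\<close> need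
  not be even, exchanging the two functions reflects the kernel
  (\<open>mollified_dist_swap\<close>).\<close>

definition mollified_dist :: "('a::euclidean_space \<Rightarrow> real) \<Rightarrow> ('a \<Rightarrow> real) \<Rightarrow> ('a \<Rightarrow> real) \<Rightarrow> real" where
  "mollified_dist K g w = (LINT (x, y)|lborel. \<bar>g y - w x\<bar> * K (x - y))"

lemma mollified_dist_eq: "mollified_dist K g w = (LINT z|lborel. \<bar>g (snd z) - w (fst z)\<bar> * K (fst z - snd z))"
  by (simp add: mollified_dist_def case_prod_unfold)

lemma mollified_dist_integrable:
  fixes g w K :: "'a::euclidean_space \<Rightarrow> real"
  assumes g: "integrable lborel g" and w: "integrable lborel w" and K: "integrable lborel K"
  shows "integrable lborel (\<lambda>z. \<bar>g (snd z) - w (fst z)\<bar> * K (fst z - snd z))"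
proof (rule integrable_doubling[OF w g, of "\<lambda>z. K (fst z - snd z)" "L1_norm K" "L1_norm K"])
  have [measurable]: "g \<in> borel_measurable borel" "w \<in> borel_measurable borel" "K \<in> borel_measurable borel"
    using assms[THEN borel_measurable_integrable] by simp_all
  show "(\<lambda>z. K (fst z - snd z)) \<in> borel_measurable borel"
    "(\<lambda>z. \<bar>g (snd z) - w (fst z)\<bar> * K (fst z - snd z)) \<in> borel_measurable borel" by measurable
  show "(\<integral>\<^sup>+q. ennreal \<bar>K (fst (p, q) - snd (p, q))\<bar> \<partial>lborel) \<le> ennreal (L1_norm K)" for p
    using lborel_nn_integral_reflect(1)[of "\<lambda>y. ennreal \<bar>K y\<bar>" p] by (simp add: nn_integral_abs_eq[OF K])
  show "(\<integral>\<^sup>+p. ennreal \<bar>K (fst (p, q) - snd (p, q))\<bar> \<partial>lborel) \<le> ennreal (L1_norm K)" for q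
    using lborel_nn_integral_reflect(2)[of "\<lambda>y. ennreal \<bar>K y\<bar>" q] by (simp add: nn_integral_abs_eq[OF K])
  show "\<bar>\<bar>g (snd (p, q)) - w (fst (p, q))\<bar> * K (fst (p, q) - snd (p, q))\<bar>
      \<le> (\<bar>w p\<bar> + \<bar>g q\<bar>) * \<bar>K (fst (p, q) - snd (p, q))\<bar>" for p q
    by (auto simp: abs_mult intro!: mult_right_mono)
qed

locale averaging_kernel =
  fixes K :: "'a::euclidean_space \<Rightarrow> real"
  assumes integrable_kernel: "integrable lborel K"
    and kernel_nonneg: "\<And>x. K x \<ge> 0"
    and kernel_integral: "(LINT x|lborel. K x) = 1"
begin

lemma kernel_measurable [measurable]: "K \<in> borel_measurable borel"
  using borel_measurable_integrable[OF integrable_kernel] by simp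

text \<open>Unit mass of \<open>K\<close> allows a dummy variable to be inserted into a single
  integral, which can then be compared pointwise with the double integral in
  \<open>mollified_dist\<close>.\<close>

lemma average_fst:
  assumes a: "integrable lborel a"
  shows "integrable lborel (\<lambda>z. a (fst z) * K (fst z - snd z))"
    "(LINT z|lborel. a (fst z) * K (fst z - snd z)) = (LINT x|lborel. a x)"
proof -
  show i: "integrable lborel (\<lambda>z. a (fst z) * K (fst z - snd z))"
  proof (rule integrable_kernel_fst[OF a, of _ "L1_norm K"])
    show "(\<integral>\<^sup>+q. ennreal \<bar>K (fst (p, q) - snd (p, q))\<bar> \<partial>lborel) \<le> ennreal (L1_norm K)" for p
      using lborel_nn_integral_reflect(1)[of "\<lambda>y. ennreal \<bar>K y\<bar>" p]
      by (simp add: nn_integral_abs_eq[OF integrable_kernel])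
  qed measurable
  show "(LINT z|lborel. a (fst z) * K (fst z - snd z)) = (LINT x|lborel. a x)"
    by (subst lborel_Fubini(1)[OF i, symmetric])
      (simp add: lborel_integral_translate(2)[of K] kernel_integral)
qed

lemma average_snd:
  assumes a: "integrable lborel a"
  shows "integrable lborel (\<lambda>z. a (snd z) * K (fst z - snd z))"
    "(LINT z|lborel. a (snd z) * K (fst z - snd z)) = (LINT x|lborel. a x)"
proof -
  show i: "integrable lborel (\<lambda>z. a (snd z) * K (fst z - snd z))"
  proof (rule integrable_kernel_snd[OF a, of _ "L1_norm K"])
    show "(\<integral>\<^sup>+p. ennreal \<bar>K (fst (p, q) - snd (p, q))\<bar> \<partial>lborel) \<le> ennreal (L1_norm K)" for q
      using lborel_nn_integral_reflect(2)[of "\<lambda>y. ennreal \<bar>K y\<bar>" q]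
      by (simp add: nn_integral_abs_eq[OF integrable_kernel])
  qed measurable
  have "(LINT x|lborel. K (x - y)) = 1" for y
    using lborel_integral_translate(1)[of K "- y"] by (simp add: kernel_integral add.commute)
  then show "(LINT z|lborel. a (snd z) * K (fst z - snd z)) = (LINT x|lborel. a x)"
    by (subst lborel_Fubini(2)[OF i, symmetric]) simp
qed

text \<open>After the pointwise triangle inequality each error depends on one variable only, and the
  unit mass of \<open>K\<close> integrates out the other.\<close>

lemma mollified_dist_le:
  assumes g: "integrable lborel g" "integrable lborel g'" and w: "integrable lborel w" "integrable lborel w'"
  shows "mollified_dist K g w \<le> mollified_dist K g' w' + L1_norm (\<lambda>x. g x - g' x) + L1_norm (\<lambda>x. w x - w' x)"
proof -
  have i: "integrable lborel (\<lambda>x. \<bar>g x - g' x\<bar>)" "integrable lborel (\<lambda>x. \<bar>w x - w' x\<bar>)"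
    using g w by auto
  note i' = mollified_dist_integrable[OF g(2) w(2) integrable_kernel] average_snd[OF i(1)] average_fst[OF i(2)]
  have "mollified_dist K g w \<le> (LINT z|lborel. \<bar>g' (snd z) - w' (fst z)\<bar> * K (fst z - snd z)
      + \<bar>g (snd z) - g' (snd z)\<bar> * K (fst z - snd z) + \<bar>w (fst z) - w' (fst z)\<bar> * K (fst z - snd z))"
    unfolding mollified_dist_eq
  proof (rule integral_mono)
    show "\<bar>g (snd z) - w (fst z)\<bar> * K (fst z - snd z) \<le> \<bar>g' (snd z) - w' (fst z)\<bar> * K (fst z - snd z)
      + \<bar>g (snd z) - g' (snd z)\<bar> * K (fst z - snd z) + \<bar>w (fst z) - w' (fst z)\<bar> * K (fst z - snd z)" for z
      unfolding distrib_right[symmetric] by (intro mult_right_mono kernel_nonneg) linarith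
  qed (use i' mollified_dist_integrable[OF g(1) w(1) integrable_kernel] in auto)
  then show ?thesis using i' by (simp add: mollified_dist_eq)
qed

text \<open>Comparing the two functions at \<open>x\<close> leaves the self-distance of
  \<open>g\<close>, comparing them at \<open>y\<close> that of \<open>w\<close>. Both forms are
  used, because the self-distance must be that of a function for which it is controlled:
  \<open>u (., T)\<close> at the end, \<open>u0\<close> when the initial value is recovered.\<close>

lemma L1_norm_le_mollified_dist:
  assumes g: "integrable lborel g" and w: "integrable lborel w"
  shows "L1_norm (\<lambda>x. g x - w x) \<le> mollified_dist K g w + mollified_dist K g g"
    "L1_norm (\<lambda>x. g x - w x) \<le> mollified_dist K g w + mollified_dist K w w"
proof -
  have i: "integrable lborel (\<lambda>x. \<bar>g x - w x\<bar>)" using g w by auto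
  note m = mollified_dist_integrable[OF _ _ integrable_kernel]
  have "L1_norm (\<lambda>x. g x - w x) \<le> (LINT z|lborel. \<bar>g (snd z) - w (fst z)\<bar> * K (fst z - snd z)
      + \<bar>g (snd z) - g (fst z)\<bar> * K (fst z - snd z))"
    unfolding average_fst(2)[OF i, symmetric]
  proof (rule integral_mono)
    show "\<bar>g (fst z) - w (fst z)\<bar> * K (fst z - snd z) \<le> \<bar>g (snd z) - w (fst z)\<bar> * K (fst z - snd z)
      + \<bar>g (snd z) - g (fst z)\<bar> * K (fst z - snd z)" for z
      unfolding distrib_right[symmetric] by (intro mult_right_mono kernel_nonneg) linarith
  qed (use average_fst[OF i] m g w in auto)
  then show "L1_norm (\<lambda>x. g x - w x) \<le> mollified_dist K g w + mollified_dist K g g"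
    using m g w by (simp add: mollified_dist_eq)
  have "L1_norm (\<lambda>x. g x - w x) \<le> (LINT z|lborel. \<bar>g (snd z) - w (fst z)\<bar> * K (fst z - snd z)
      + \<bar>w (snd z) - w (fst z)\<bar> * K (fst z - snd z))"
    unfolding average_snd(2)[OF i, symmetric]
  proof (rule integral_mono)
    show "\<bar>g (snd z) - w (snd z)\<bar> * K (fst z - snd z) \<le> \<bar>g (snd z) - w (fst z)\<bar> * K (fst z - snd z)
      + \<bar>w (snd z) - w (fst z)\<bar> * K (fst z - snd z)" for z
      unfolding distrib_right[symmetric] by (intro mult_right_mono kernel_nonneg) linarith
  qed (use average_snd[OF i] m g w in auto)
  then show "L1_norm (\<lambda>x. g x - w x) \<le> mollified_dist K g w + mollified_dist K w w"
    using m g w by (simp add: mollified_dist_eq)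
qed

text \<open>With \<open>z = x - y\<close> the double integral becomes an average over
  \<open>z\<close>, weighted by \<open>K z\<close>, of the L^1 sizes of the increments of
  \<open>g\<close> by \<open>z\<close>. Each of these is at most
  \<open>norm z * BV_seminorm g\<close>.\<close>

lemma mollified_dist_BV:
  assumes g: "integrable lborel g" "total_variation g < \<infinity>" and K1: "integrable lborel (\<lambda>z. norm z * K z)"
  shows "mollified_dist K g g \<le> (LINT z|lborel. norm z * K z) * BV_seminorm g"
proof -
  have [measurable]: "g \<in> borel_measurable borel" using borel_measurable_integrable[OF g(1)] by simp
  have shift: "integrable lborel (\<lambda>x. g (x + h))" for h
    using lborel_integrable_translate(1)[OF g(1), of h] by (simp add: add.commute)
  \<comment> \<open>Nonnegativity is read off the translation estimate for a unit vector, whose left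
    side is nonnegative.\<close>
  have BV0: "0 \<le> BV_seminorm g"
  proof -
    obtain b :: 'a where b: "b \<in> Basis" using nonempty_Basis by blast
    have "0 \<le> (LINT x|lborel. \<bar>g (x + b) - g x\<bar>)" by (intro integral_nonneg_AE AE_I2) auto
    also have "\<dots> \<le> BV_seminorm g" using BV_translation[OF g, of b] b by simp
    finally show ?thesis .
  qed
  \<comment> \<open>Nonnegative integrals are used so that the order of integration and the
    variables can be changed before any integrability is known.\<close>
  have "ennreal (mollified_dist K g g) = (\<integral>\<^sup>+z. ennreal (\<bar>g (snd z) - g (fst z)\<bar> * K (fst z - snd z)) \<partial>lborel)"
    unfolding mollified_dist_eq
    by (rule nn_integral_eq_integral[symmetric])
      (use mollified_dist_integrable[OF g(1) g(1) integrable_kernel] kernel_nonneg in auto)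
  also have "\<dots> = (\<integral>\<^sup>+y. \<integral>\<^sup>+x. ennreal (\<bar>g y - g x\<bar> * K (x - y)) \<partial>lborel \<partial>lborel)"
    by (subst lborel_Tonelli(2)) auto
  also have "\<dots> = (\<integral>\<^sup>+y. \<integral>\<^sup>+z. ennreal (\<bar>g y - g (z + y)\<bar> * K z) \<partial>lborel \<partial>lborel)"
  proof (rule nn_integral_cong)
    show "(\<integral>\<^sup>+x. ennreal (\<bar>g y - g x\<bar> * K (x - y)) \<partial>lborel) = (\<integral>\<^sup>+z. ennreal (\<bar>g y - g (z + y)\<bar> * K z) \<partial>lborel)" for y
      using lborel_nn_integral_reflect(2)[of "\<lambda>z. ennreal (\<bar>g y - g (z + y)\<bar> * K z)" y] by simp
  qed
  also have "\<dots> = (\<integral>\<^sup>+z. ennreal (\<bar>g (fst z) - g (snd z + fst z)\<bar> * K (snd z)) \<partial>lborel)"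
    by (subst lborel_Tonelli(1)) auto
  also have "\<dots> = (\<integral>\<^sup>+z. \<integral>\<^sup>+y. ennreal (\<bar>g y - g (z + y)\<bar> * K z) \<partial>lborel \<partial>lborel)"
    by (subst lborel_Tonelli(2)) auto
  also have "\<dots> \<le> (\<integral>\<^sup>+z. ennreal (norm z * K z * BV_seminorm g) \<partial>lborel)"
  proof (rule nn_integral_mono)
    fix z
    have i: "integrable lborel (\<lambda>y. \<bar>g y - g (z + y)\<bar> * K z)"
      using shift[of z] g(1) by (auto simp: add.commute)
    have "(\<integral>\<^sup>+y. ennreal (\<bar>g y - g (z + y)\<bar> * K z) \<partial>lborel) = ennreal (LINT y|lborel. \<bar>g y - g (z + y)\<bar> * K z)"
      by (rule nn_integral_eq_integral[OF i]) (simp add: kernel_nonneg)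
    also have "(LINT y|lborel. \<bar>g y - g (z + y)\<bar> * K z) = (LINT y|lborel. \<bar>g (y + z) - g y\<bar>) * K z"
      by (simp add: abs_minus_commute add.commute)
    also have "\<dots> \<le> norm z * BV_seminorm g * K z"
      by (intro mult_right_mono BV_translation g kernel_nonneg)
    finally show "(\<integral>\<^sup>+y. ennreal (\<bar>g y - g (z + y)\<bar> * K z) \<partial>lborel) \<le> ennreal (norm z * K z * BV_seminorm g)"
      by (simp add: mult_ac ennreal_leI)
  qed
  also have "\<dots> = ennreal (LINT z|lborel. norm z * K z * BV_seminorm g)"
    by (rule nn_integral_eq_integral) (use K1 BV0 kernel_nonneg in auto)
  finally have "mollified_dist K g g \<le> (LINT z|lborel. norm z * K z * BV_seminorm g)"
    by (subst (asm) ennreal_le_iff) (auto intro!: integral_nonneg_AE simp: BV0 kernel_nonneg)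
  then show ?thesis by simp
qed

end

lemma mollified_dist_swap:
  fixes g w K :: "'a::euclidean_space \<Rightarrow> real"
  assumes "integrable lborel g" "integrable lborel w" "integrable lborel K"
  shows "mollified_dist (\<lambda>z. K (- z)) w g = mollified_dist K g w"
proof -
  have [measurable]: "g \<in> borel_measurable borel" "w \<in> borel_measurable borel" "K \<in> borel_measurable borel"
    using assms[THEN borel_measurable_integrable] by simp_all
  show ?thesis
    using lborel_integral_swap[of "\<lambda>z. \<bar>g (snd z) - w (fst z)\<bar> * K (fst z - snd z)"]
    by (simp add: mollified_dist_eq abs_minus_commute)
qed

section \<open>Continuous curves in \<open>L\<^sup>1\<close>\<close>

lemma Linf_C_L1_integrable: "Linf_C_L1 T u \<Longrightarrow> t \<in> {0..T} \<Longrightarrow> integrable lborel (\<lambda>x. u (x, t))"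
  by (simp add: Linf_C_L1_def)

lemma L1_norm_triangle:
  fixes f g h :: "'a::euclidean_space \<Rightarrow> real"
  assumes "integrable lborel f" "integrable lborel g" "integrable lborel h"
  shows "L1_norm (\<lambda>x. f x - h x) \<le> L1_norm (\<lambda>x. f x - g x) + L1_norm (\<lambda>x. g x - h x)"
proof -
  have "L1_norm (\<lambda>x. f x - h x) \<le> (LINT x|lborel. \<bar>f x - g x\<bar> + \<bar>g x - h x\<bar>)"
    by (rule integral_mono) (use assms in auto)
  then show ?thesis using assms by simp
qed

lemma L1_norm_sym: "L1_norm (\<lambda>x. f x - g x) = L1_norm (\<lambda>x. g x - f x)"
  by (simp add: abs_minus_commute)

lemma Linf_C_L1_bounded:
  assumes u: "Linf_C_L1 T u"
  obtains M where "\<And>t. t \<in> {0..T} \<Longrightarrow> L1_norm (\<lambda>x. u (x, t)) \<le> M"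
proof -
  let ?N = "\<lambda>t. L1_norm (\<lambda>x. u (x, t))"
  have "continuous_on {0..T} ?N"
    unfolding continuous_on_def
  proof
    fix t assume t: "t \<in> {0..T}"
    have "((\<lambda>s. ?N s - ?N t) \<longlongrightarrow> 0) (at t within {0..T})"
    proof (rule Lim_null_comparison)
      show "((\<lambda>s. L1_norm (\<lambda>x. u (x, s) - u (x, t))) \<longlongrightarrow> 0) (at t within {0..T})"
        using u t by (simp add: Linf_C_L1_def)
      show "\<forall>\<^sub>F s in at t within {0..T}. norm (?N s - ?N t) \<le> L1_norm (\<lambda>x. u (x, s) - u (x, t))"
        unfolding eventually_at_filter
      proof (intro always_eventually allI impI)
        fix s assume s: "s \<in> {0..T}"
        note i = Linf_C_L1_integrable[OF u s] Linf_C_L1_integrable[OF u t]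
        have "?N s - ?N t = (LINT x|lborel. \<bar>u (x, s)\<bar> - \<bar>u (x, t)\<bar>)" using i by simp
        also have "norm \<dots> \<le> (LINT x|lborel. norm (\<bar>u (x, s)\<bar> - \<bar>u (x, t)\<bar>))" by (rule integral_norm_bound)
        also have "\<dots> \<le> L1_norm (\<lambda>x. u (x, s) - u (x, t))"
          by (rule integral_mono) (use i in auto)
        finally show "norm (?N s - ?N t) \<le> L1_norm (\<lambda>x. u (x, s) - u (x, t))" .
      qed
    qed
    then show "(?N \<longlongrightarrow> ?N t) (at t within {0..T})"
      by (simp add: LIM_zero_iff)
  qed
  then have "compact (?N ` {0..T})" by (rule compact_continuous_image) simp
  then obtain M where "\<And>t. t \<in> {0..T} \<Longrightarrow> norm (?N t) \<le> M"
    by (meson bounded_iff compact_imp_bounded imageI)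
  then show ?thesis by (intro that[of M]) (metis abs_le_D1 real_norm_def)
qed

text \<open>Membership in L^infinity gives joint measurability on \<open>Q T\<close>; integrability
  comes from the uniform L^1 bound on the slices over a finite time interval.\<close>

lemma Linf_C_L1_set_integrable:
  assumes u: "Linf_C_L1 T u"
  shows "set_integrable lborel (Q T) u"
proof -
  obtain M where M: "\<And>t. t \<in> {0..T} \<Longrightarrow> L1_norm (\<lambda>x. u (x, t)) \<le> M"
    using Linf_C_L1_bounded[OF u] by blast
  let ?U = "\<lambda>p. indicator (Q T) p *\<^sub>R u p"
  have "u \<in> borel_measurable (restrict_space lborel (Q T))"
    using u by (simp add: Linf_C_L1_def L_infinity_def)
  then have meas[measurable]: "?U \<in> borel_measurable borel"
    by (subst (asm) borel_measurable_restrict_space_iff) auto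
  have "integrable lborel ?U"
  proof (rule integrableI_bounded)
    have "(\<integral>\<^sup>+p. ennreal (norm (?U p)) \<partial>lborel) = (\<integral>\<^sup>+t. \<integral>\<^sup>+x. ennreal (norm (?U (x, t))) \<partial>lborel \<partial>lborel)"
      by (rule lborel_Tonelli(2)) measurable
    also have "\<dots> \<le> (\<integral>\<^sup>+t. ennreal M * indicator {0<..<T} t \<partial>lborel)"
    proof (rule nn_integral_mono)
      fix t
      show "(\<integral>\<^sup>+x. ennreal (norm (?U (x, t))) \<partial>lborel) \<le> ennreal M * indicator {0<..<T} t"
      proof (cases "t \<in> {0<..<T}")
        case True
        then have t: "t \<in> {0..T}" by auto
        show ?thesis using True M[OF t] nn_integral_abs_eq[OF Linf_C_L1_integrable[OF u t]]
          by (simp add: ennreal_leI)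
      qed simp
    qed
    also have "\<dots> = ennreal M * emeasure lborel {0<..<T}"
      by (rule nn_integral_cmult_indicator) simp
    also have "\<dots> < \<infinity>" by (cases "0 \<le> T") (auto simp: ennreal_mult_less_top)
    finally show "(\<integral>\<^sup>+p. ennreal (norm (?U p)) \<partial>lborel) < \<infinity>" .
  qed (use meas in simp)
  then show ?thesis by (simp add: set_integrable_def)
qed

lemma modulus_upper:
  assumes u: "Linf_C_L1 T u" and "t \<in> {0..T}" "s \<in> {0..T}" "\<bar>t - s\<bar> \<le> \<delta>"
  shows "L1_norm (\<lambda>x. u (x, t) - u (x, s)) \<le> modulus T u \<delta>"
  unfolding modulus_def
proof (rule cSup_upper)
  obtain M where M: "\<And>t. t \<in> {0..T} \<Longrightarrow> L1_norm (\<lambda>x. u (x, t)) \<le> M"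
    using Linf_C_L1_bounded[OF u] by blast
  \<comment> \<open>A supremum of reals is informative only for a set bounded above. The triangle
    inequality through the zero function gives \<open>2 * M\<close>.\<close>
  show "bdd_above {L1_norm (\<lambda>x. u (x, t) - u (x, s)) |t s. t \<in> {0..T} \<and> s \<in> {0..T} \<and> \<bar>t - s\<bar> \<le> \<delta>}"
  proof (rule bdd_aboveI)
    fix d assume "d \<in> {L1_norm (\<lambda>x. u (x, t) - u (x, s)) |t s. t \<in> {0..T} \<and> s \<in> {0..T} \<and> \<bar>t - s\<bar> \<le> \<delta>}"
    then obtain t s where ts: "t \<in> {0..T}" "s \<in> {0..T}" and d: "d = L1_norm (\<lambda>x. u (x, t) - u (x, s))" by blast
    show "d \<le> 2 * M"
      using L1_norm_triangle[of "\<lambda>x. u (x, t)" "\<lambda>_. 0" "\<lambda>x. u (x, s)"] M[OF ts(1)] M[OF ts(2)]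
        Linf_C_L1_integrable[OF u ts(1)] Linf_C_L1_integrable[OF u ts(2)] by (simp add: d)
  qed
qed (use assms in blast)

text \<open>The curve is given only through L^1 distances of its slices, so the Heine-Cantor
  argument is carried out by hand: a Lebesgue number for the cover by balls on which the distance to
  the centre stays below \<open>e / 2\<close>.\<close>

lemma Linf_C_L1_uniformly_continuous:
  assumes u: "Linf_C_L1 T u" and e: "e > 0"
  obtains \<delta> where "\<delta> > 0"
    "\<And>t s. t \<in> {0..T} \<Longrightarrow> s \<in> {0..T} \<Longrightarrow> \<bar>t - s\<bar> \<le> \<delta> \<Longrightarrow> L1_norm (\<lambda>x. u (x, t) - u (x, s)) < e"
proof -
  let ?D = "\<lambda>t s. L1_norm (\<lambda>x. u (x, t) - u (x, s))"
  have "\<exists>\<delta>>0. \<forall>s. s \<in> {0..T} \<and> \<bar>s - t\<bar> < \<delta> \<longrightarrow> ?D s t < e / 2" if t: "t \<in> {0..T}" for t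
  proof -
    have "((\<lambda>s. ?D s t) \<longlongrightarrow> 0) (at t within {0..T})"
      using u t by (simp add: Linf_C_L1_def)
    then have "\<forall>\<^sub>F s in at t within {0..T}. ?D s t < e / 2"
      by (rule order_tendstoD) (use e in simp)
    then obtain \<delta> where "\<delta> > 0" "\<forall>s\<in>{0..T}. s \<noteq> t \<and> dist s t < \<delta> \<longrightarrow> ?D s t < e / 2"
      by (auto simp: eventually_at)
    then have "?D s t < e / 2" if "s \<in> {0..T}" "\<bar>s - t\<bar> < \<delta>" for s
      using that e by (cases "s = t") (auto simp: dist_real_def)
    with \<open>\<delta> > 0\<close> show ?thesis by blast
  qed
  then have "\<forall>t\<in>{0..T}. \<exists>\<delta>. \<delta> > 0 \<and> (\<forall>s. s \<in> {0..T} \<and> \<bar>s - t\<bar> < \<delta> \<longrightarrow> ?D s t < e / 2)" by blast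
  from bchoice[OF this] obtain \<rho>
    where *: "\<forall>t\<in>{0..T}. \<rho> t > 0 \<and> (\<forall>s. s \<in> {0..T} \<and> \<bar>s - t\<bar> < \<rho> t \<longrightarrow> ?D s t < e / 2)" by blast
  have \<rho>: "\<And>t. t \<in> {0..T} \<Longrightarrow> \<rho> t > 0"
    "\<And>t s. t \<in> {0..T} \<Longrightarrow> s \<in> {0..T} \<Longrightarrow> \<bar>s - t\<bar> < \<rho> t \<Longrightarrow> ?D s t < e / 2"
    using * by blast+
  have cov: "{0..T} \<subseteq> \<Union> ((\<lambda>t. ball t (\<rho> t)) ` {0..T})" using \<rho>(1) by auto
  obtain d where d: "d > 0" "\<And>x. x \<in> {0..T} \<Longrightarrow> \<exists>G \<in> (\<lambda>t. ball t (\<rho> t)) ` {0..T}. ball x d \<subseteq> G"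
    by (rule Heine_Borel_lemma[OF compact_Icc cov]) (blast intro: open_ball)+
  show ?thesis
  proof (rule that[of "d / 2"])
    fix t s assume ts: "t \<in> {0..T}" "s \<in> {0..T}" "\<bar>t - s\<bar> \<le> d / 2"
    obtain c where c: "c \<in> {0..T}" "ball t d \<subseteq> ball c (\<rho> c)" using d(2)[OF ts(1)] by blast
    have "t \<in> ball c (\<rho> c)" "s \<in> ball c (\<rho> c)"
      using c(2) ts(3) d(1) by (auto simp: dist_real_def subset_iff)
    then have "?D t c < e / 2" "?D s c < e / 2"
      using \<rho>(2) c(1) ts by (auto simp: dist_real_def abs_minus_commute)
    moreover have "?D t s \<le> ?D t c + ?D c s"
      by (rule L1_norm_triangle) (use Linf_C_L1_integrable[OF u] ts c in auto)
    ultimately show "?D t s < e" by (simp add: L1_norm_sym[of "\<lambda>x. u (x, c)"])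
  qed (use d in simp)
qed

section \<open>Levy measures\<close>

lemma levy_borel_measurable:
  assumes "sets M = sets (restrict_space borel (- {0}))" "f \<in> borel_measurable borel"
  shows "f \<in> borel_measurable M"
  using measurable_restrict_space1[OF assms(2)] measurable_cong_sets[OF assms(1) refl] by blast

lemma levy_space:
  fixes M :: "'a::euclidean_space measure"
  assumes "sets M = sets (restrict_space borel (- {0}))"
  shows "space M = - {0}"
  using sets_eq_imp_space_eq[OF assms] by (simp add: space_restrict_space)

lemma levy_sets:
  fixes M :: "'a::euclidean_space measure"
  assumes "sets M = sets (restrict_space borel (- {0}))" "S \<in> sets borel" "0 \<notin> S"
  shows "S \<in> sets M"
proof -
  have "S = - {0} \<inter> S" using assms(3) by auto
  then show ?thesis using assms(2) unfolding assms(1) by (auto simp: sets_restrict_space)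
qed

lemma levy_measure_sets: "levy_measure \<mu> \<Longrightarrow> sets \<mu> = sets (restrict_space borel (- {0}))"
  by (simp add: levy_measure_def)

lemma levy_integrable_min:
  assumes \<mu>: "levy_measure \<mu>"
  shows "integrable \<mu> (\<lambda>z. min ((norm z)\<^sup>2) 1)"
proof (rule integrableI_bounded)
  show "(\<lambda>z. min ((norm z)\<^sup>2) 1) \<in> borel_measurable \<mu>"
    by (rule levy_borel_measurable[OF levy_measure_sets[OF \<mu>]]) measurable
qed (use \<mu> in \<open>simp add: levy_measure_def\<close>)

text \<open>The two facts on which all small-jump estimates rest. Reflection preserves them because
  the punctured space and the norm are symmetric.\<close>

lemma dual_properties:
  fixes \<mu> :: "'a::euclidean_space measure"
  assumes \<mu>: "levy_measure \<mu>"
  shows "sets (dual \<mu>) = sets (restrict_space borel (- {0}))"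
    "integrable (dual \<mu>) (\<lambda>z. min ((norm z)\<^sup>2) 1)"
proof -
  show s: "sets (dual \<mu>) = sets (restrict_space borel (- {0}))"
    using levy_measure_sets[OF \<mu>] by (simp add: dual_def)
  have "uminus \<in> measurable (restrict_space borel (- {0})) (restrict_space borel (- {0::'a}))"
    by (rule measurable_restrict_space2)
      (auto simp: space_restrict_space intro!: measurable_restrict_space1)
  then have m: "uminus \<in> measurable \<mu> \<mu>"
    using measurable_cong_sets[OF levy_measure_sets[OF \<mu>] levy_measure_sets[OF \<mu>]] by blast
  have "(\<lambda>z. min ((norm z)\<^sup>2) 1) \<in> borel_measurable \<mu>"
    by (rule levy_borel_measurable[OF levy_measure_sets[OF \<mu>]]) measurable
  then show "integrable (dual \<mu>) (\<lambda>z. min ((norm z)\<^sup>2) 1)"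
    using levy_integrable_min[OF \<mu>] by (simp add: dual_def integrable_distr_eq[OF m])
qed

section \<open>Small jumps acting on a test function\<close>

abbreviation annulus :: "real \<Rightarrow> 'a::euclidean_space set" where
  "annulus r \<equiv> {z. 0 < norm z \<and> norm z \<le> r}"

lemma annulus_borel [measurable]: "annulus r \<in> sets borel"
  by measurable

text \<open>\<open>levy_small\<close> applied to \<open>\<xi> \<mapsto> K (x - \<xi>)\<close> at
  \<open>y\<close> depends only on \<open>w = x - y\<close>. As a function of \<open>w\<close> it
  can be handled like any other kernel in the difference.\<close>

definition small_jump :: "'a::euclidean_space measure \<Rightarrow> real \<Rightarrow> ('a \<Rightarrow> real) \<Rightarrow> 'a \<Rightarrow> real" where
  "small_jump \<nu> r K w =
     (LINT z:annulus r|\<nu>. taylor_remainder K w z)"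

lemma levy_small_reflect:
  assumes K: "K \<in> Cc_infinity"
  shows "levy_small \<nu> r (\<lambda>\<xi>. c * K (x - \<xi>)) y = c * small_jump \<nu> r K (x - y)"
proof -
  have "c * K (x - (y + z)) - c * K (x - y) - (z \<bullet> grad (\<lambda>\<xi>. c * K (x - \<xi>)) y) * indicator {z. norm z \<le> 1} z
     = c * (K (x - y - z) - K (x - y) + (z \<bullet> grad K (x - y)) * indicator {z. norm z \<le> 1} z)" for z
    by (simp add: grad_reflect[OF K] algebra_simps diff_diff_eq)
  then show ?thesis unfolding levy_small_def small_jump_def by simp
qed

context
  fixes \<nu> :: "'a::euclidean_space measure" and K :: "'a \<Rightarrow> real"
  assumes sets_\<nu>: "sets \<nu> = sets (restrict_space borel (- {0}))"
    and integrable_\<nu>: "integrable \<nu> (\<lambda>z. min ((norm z)\<^sup>2) 1)"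
    and K: "K \<in> Cc_infinity"
begin

lemma small_jump_integrand_measurable:
  "(\<lambda>z. indicator (annulus r) z *\<^sub>R
      taylor_remainder K w z) \<in> borel_measurable \<nu>"
proof (rule levy_borel_measurable[OF sets_\<nu>])
  have [measurable]: "K \<in> borel_measurable borel" by (rule Cc_infinity_borel[OF K])
  have [measurable]: "{z::'a. norm z \<le> 1} \<in> sets borel"
    by measurable
  show "(\<lambda>z. indicator (annulus r) z *\<^sub>R
      taylor_remainder K w z) \<in> borel_measurable borel"
    by measurable
qed

text \<open>\<open>C\<close> is uniform in \<open>w\<close> and \<open>r\<close>, so the dependence
  on \<open>r\<close> sits entirely in the mass of the annulus. This is what makes the limit
  \<open>r \<rightarrow> 0\<close> work.\<close>

lemma small_jump_bound:
  obtains C where "C \<ge> 0"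
    "\<And>w r. \<bar>small_jump \<nu> r K w\<bar> \<le> C * (LINT z:annulus r|\<nu>. min ((norm z)\<^sup>2) 1)"
proof -
  obtain C where C: "C \<ge> 0"
    "\<And>w z. \<bar>taylor_remainder K w z\<bar> \<le> C * min ((norm z)\<^sup>2) 1"
    using Taylor2_bound[OF K] by blast
  show ?thesis
  proof (rule that[OF C(1)])
    fix w r
    let ?S = "annulus r :: 'a set"
    have S: "?S \<in> sets \<nu>" by (rule levy_sets[OF sets_\<nu> annulus_borel]) simp
    have i: "integrable \<nu> (\<lambda>z. indicator ?S z *\<^sub>R min ((norm z)\<^sup>2) 1)"
      by (rule integrable_mult_indicator[OF S integrable_\<nu>])
    have "\<bar>small_jump \<nu> r K w\<bar> \<le> (LINT z|\<nu>. norm (indicator ?S z *\<^sub>R taylor_remainder K w z))"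
      unfolding small_jump_def set_lebesgue_integral_def real_norm_def[symmetric] by (rule integral_norm_bound)
    also have "\<dots> \<le> (LINT z|\<nu>. C * (indicator ?S z *\<^sub>R min ((norm z)\<^sup>2) 1))"
    proof (rule integral_mono_AE')
      show "integrable \<nu> (\<lambda>z. C * (indicator ?S z *\<^sub>R min ((norm z)\<^sup>2) 1))" using i by (rule integrable_mult_right)
    qed (use C in \<open>auto simp: indicator_def\<close>)
    finally show "\<bar>small_jump \<nu> r K w\<bar> \<le> C * (LINT z:?S|\<nu>. min ((norm z)\<^sup>2) 1)"
      by (simp add: set_lebesgue_integral_def)
  qed
qed

lemma small_jump_vanishes:
  obtains R where "R \<ge> 0" "\<And>r w. norm w > R + r \<Longrightarrow> small_jump \<nu> r K w = 0"
proof -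
  obtain R where R: "R \<ge> 0" "\<And>x. norm x > R \<Longrightarrow> K x = 0" "\<And>x. norm x > R \<Longrightarrow> grad K x = 0"
    using grad_vanishes[OF K] by blast
  show ?thesis
  proof (rule that[OF R(1)])
    fix r and w :: 'a assume w: "norm w > R + r"
    have "indicator (annulus r) z *\<^sub>R taylor_remainder K w z = 0" for z
    proof (cases "0 < norm z \<and> norm z \<le> r")
      case True
      then have "norm (w - z) > R" "norm w > R" using w norm_triangle_ineq2[of w z] norm_ge_zero[of z] by linarith+
      then show ?thesis using R by simp
    qed (auto simp: indicator_def)
    then show "small_jump \<nu> r K w = 0" unfolding small_jump_def set_lebesgue_integral_def by (simp only: Bochner_Integration.integral_zero)
  qed
qed

text \<open>Dominated convergence, with the Taylor bound as a majorant independent of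
  \<open>w\<close>. Together with the bounded support it makes \<open>small_jump\<close> an
  integrable kernel.\<close>

lemma small_jump_continuous: "continuous_on UNIV (small_jump \<nu> r K)"
proof -
  obtain C where C: "C \<ge> 0"
    "\<And>w z. \<bar>taylor_remainder K w z\<bar> \<le> C * min ((norm z)\<^sup>2) 1"
    using Taylor2_bound[OF K] by blast
  have Kc: "continuous_on UNIV K" by (rule Cc_infinity_continuous[OF K])
  have gc: "continuous_on UNIV (grad K)" by (rule grad_continuous[OF K])
  show ?thesis
    unfolding continuous_on_sequentially comp_def
  proof (intro ballI allI impI)
    fix X :: "nat \<Rightarrow> 'a" and w assume "(\<forall>n. X n \<in> UNIV) \<and> X \<longlonglongrightarrow> w"
    then have X: "X \<longlonglongrightarrow> w" by simp
    show "(\<lambda>n. small_jump \<nu> r K (X n)) \<longlonglongrightarrow> small_jump \<nu> r K w"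
      unfolding small_jump_def set_lebesgue_integral_def
    proof (rule integral_dominated_convergence[where w="\<lambda>z. C * min ((norm z)\<^sup>2) 1"])
      show "integrable \<nu> (\<lambda>z. C * min ((norm z)\<^sup>2) 1)" using integrable_\<nu> by simp
      show "AE z in \<nu>. norm (indicator (annulus r) z *\<^sub>R
          taylor_remainder K (X n) z) \<le> C * min ((norm z)\<^sup>2) 1" for n
        using C by (auto simp: indicator_def)
      show "AE z in \<nu>. (\<lambda>n. indicator (annulus r) z *\<^sub>R
          taylor_remainder K (X n) z) \<longlonglongrightarrow>
         indicator (annulus r) z *\<^sub>R
          taylor_remainder K w z"
      proof (intro AE_I2 tendsto_intros)
        fix z
        show "(\<lambda>n. K (X n - z)) \<longlonglongrightarrow> K (w - z)"
          by (rule continuous_on_tendsto_compose[OF Kc]) (auto intro!: tendsto_intros X)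
        show "(\<lambda>n. K (X n)) \<longlonglongrightarrow> K w"
          by (rule continuous_on_tendsto_compose[OF Kc]) (auto intro!: tendsto_intros X)
        show "(\<lambda>n. grad K (X n)) \<longlonglongrightarrow> grad K w"
          by (rule continuous_on_tendsto_compose[OF gc]) (auto intro!: tendsto_intros X)
      qed
    qed (rule small_jump_integrand_measurable)+
  qed
qed

lemma small_jump_integrable: "integrable lborel (small_jump \<nu> r K)"
proof -
  obtain R where "\<And>w. norm w > R + r \<Longrightarrow> small_jump \<nu> r K w = 0"
    by (rule small_jump_vanishes) blast
  then show ?thesis
    by (intro integrable_continuous_vanishing[OF small_jump_continuous, where R="R + r"])
qed

end

text \<open>The origin is not a point of the underlying space, so the annuli shrink to the empty set
  and every point eventually leaves them.\<close>

lemma small_jump_mass_tendsto: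
  fixes \<nu> :: "'a::euclidean_space measure"
  assumes sets_\<nu>: "sets \<nu> = sets (restrict_space borel (- {0}))"
    and integrable_\<nu>: "integrable \<nu> (\<lambda>z. min ((norm z)\<^sup>2) 1)"
  shows "(\<lambda>n. LINT z:annulus (1 / real (Suc n))|\<nu>. min ((norm z)\<^sup>2) 1) \<longlonglongrightarrow> 0"
proof -
  have S: "(annulus r) \<in> sets \<nu>" for r by (rule levy_sets[OF sets_\<nu> annulus_borel]) simp
  have "(\<lambda>n. LINT z|\<nu>. indicator (annulus (1 / real (Suc n))) z *\<^sub>R min ((norm z)\<^sup>2) 1)
      \<longlonglongrightarrow> (LINT z|\<nu>. 0)"
  proof (rule integral_dominated_convergence[OF _ _ integrable_\<nu>])
    show "(\<lambda>z. indicator (annulus (1 / real (Suc n))) z *\<^sub>R min ((norm z)\<^sup>2) 1) \<in> borel_measurable \<nu>" for n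
      using integrable_mult_indicator[OF S integrable_\<nu>] by (rule borel_measurable_integrable)
    show "AE z in \<nu>. (\<lambda>n. indicator (annulus (1 / real (Suc n))) z *\<^sub>R min ((norm z)\<^sup>2) 1) \<longlonglongrightarrow> 0"
    proof (rule AE_I2)
      fix z assume "z \<in> space \<nu>"
      then have z: "norm z > 0" using levy_space[OF sets_\<nu>] by simp
      then have "\<forall>\<^sub>F n in sequentially. inverse (real (Suc n)) < norm z"
        using order_tendstoD(2)[OF LIMSEQ_inverse_real_of_nat] by blast
      then have "\<forall>\<^sub>F n in sequentially. indicator (annulus (1 / real (Suc n))) z *\<^sub>R min ((norm z)\<^sup>2) 1 = 0"
        by eventually_elim (auto simp: divide_inverse)
      then show "(\<lambda>n. indicator (annulus (1 / real (Suc n))) z *\<^sub>R min ((norm z)\<^sup>2) 1) \<longlonglongrightarrow> 0"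
        by (rule tendsto_eventually)
    qed
  qed (auto simp: indicator_def)
  then show ?thesis by (simp add: set_lebesgue_integral_def)
qed

text \<open>The jumps longer than \<open>r\<close>, as a measure on all Borel sets. The original
  measure lives on the punctured space and may be infinite, while product measures and translations
  call for a finite measure on \<open>borel\<close>.\<close>

definition large_jumps :: "'a::euclidean_space measure \<Rightarrow> real \<Rightarrow> 'a measure" where
  "large_jumps \<mu> r = distr (density \<mu> (indicator {z. norm z > r})) borel (\<lambda>z. z)"

lemma sets_large_jumps [measurable_cong]: "sets (large_jumps \<mu> r) = sets borel"
  by (simp add: large_jumps_def)

lemma
  assumes \<mu>: "levy_measure \<mu>" and r: "r > 0"
  shows finite_large_jumps: "finite_measure (large_jumps \<mu> r)"
    and levy_large_eq: "\<phi> \<in> borel_measurable borel \<Longrightarrow>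
      levy_large \<mu> r \<phi> x = (LINT z|large_jumps \<mu> r. \<phi> (x + z) - \<phi> x)"
proof -
  note sets_\<mu> = levy_measure_sets[OF \<mu>]
  have S: "{z. norm z > r} \<in> sets \<mu>" by (rule levy_sets[OF sets_\<mu>]) (use r in auto)
  have id: "(\<lambda>z. z) \<in> measurable (density \<mu> (indicator {z. norm z > r})) borel"
    by (simp add: levy_borel_measurable[OF sets_\<mu>])
  show "finite_measure (large_jumps \<mu> r)"
  proof (rule finite_measureI)
    have "emeasure (large_jumps \<mu> r) (space (large_jumps \<mu> r)) = (\<integral>\<^sup>+z. indicator {z. norm z > r} z \<partial>\<mu>)"
      unfolding large_jumps_def
      by (subst emeasure_distr[OF id]) (use S in \<open>auto simp: emeasure_density intro!: nn_integral_cong\<close>)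
    \<comment> \<open>A Chebyshev bound: where \<open>norm z > r\<close> the integrand
      \<open>min ((norm z)\<^sup>2) 1\<close> is at least \<open>min (r\<^sup>2) 1\<close>.\<close>
    also have "\<dots> \<le> (\<integral>\<^sup>+z. ennreal (min ((norm z)\<^sup>2) 1 / min (r\<^sup>2) 1) \<partial>\<mu>)"
    proof (rule nn_integral_mono)
      fix z
      have "1 \<le> min ((norm z)\<^sup>2) 1 / min (r\<^sup>2) 1" if "norm z > r"
      proof -
        have "r\<^sup>2 \<le> (norm z)\<^sup>2" using that r by (intro power_mono) auto
        then have "min (r\<^sup>2) 1 \<le> min ((norm z)\<^sup>2) 1" by simp
        moreover have "min (r\<^sup>2) 1 > 0" using r by simp
        ultimately show ?thesis by (simp only: le_divide_eq_1_pos)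
      qed
      then show "indicator {z. norm z > r} z \<le> ennreal (min ((norm z)\<^sup>2) 1 / min (r\<^sup>2) 1)"
        by (auto simp: indicator_def simp flip: ennreal_1 intro!: ennreal_leI)
    qed
    also have "\<dots> = ennreal (LINT z|\<mu>. min ((norm z)\<^sup>2) 1 / min (r\<^sup>2) 1)"
      by (rule nn_integral_eq_integral) (use levy_integrable_min[OF \<mu>] in auto)
    finally show "emeasure (large_jumps \<mu> r) (space (large_jumps \<mu> r)) \<noteq> \<infinity>"
      by (auto simp: top_unique)
  qed
  assume \<phi>[measurable]: "\<phi> \<in> borel_measurable borel"
  have m: "(\<lambda>z. \<phi> (x + z) - \<phi> x) \<in> borel_measurable borel" by measurable
  have "(LINT z|large_jumps \<mu> r. \<phi> (x + z) - \<phi> x)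
      = (LINT z|density \<mu> (indicator {z. norm z > r}). \<phi> (x + z) - \<phi> x)"
    unfolding large_jumps_def by (rule integral_distr[OF id m])
  also have "\<dots> = (LINT z|density \<mu> (\<lambda>z. ennreal (indicator {z. norm z > r} z)). \<phi> (x + z) - \<phi> x)"
    by (simp add: ennreal_indicator)
  also have "\<dots> = levy_large \<mu> r \<phi> x"
    unfolding levy_large_def set_lebesgue_integral_def
    by (rule integral_density) (use S levy_borel_measurable[OF sets_\<mu> m] in auto)
  finally show "levy_large \<mu> r \<phi> x = (LINT z|large_jumps \<mu> r. \<phi> (x + z) - \<phi> x)" by simp
qed

text \<open>Lebesgue measure is invariant under each single shift \<open>h z\<close>; integrating
  over the finite measure gives the total mass as a factor. The map \<open>h\<close> embeds a
  spatial jump, either into one space-time point or diagonally into a pair of them.\<close>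

lemma shift_integrable:
  fixes a :: "'c::euclidean_space \<Rightarrow> real" and h :: "'a::euclidean_space \<Rightarrow> 'c"
  assumes \<nu>: "finite_measure \<nu>" "sets \<nu> = sets borel" and a: "integrable lborel a"
    and h[measurable]: "h \<in> borel_measurable borel"
  shows "integrable (lborel \<Otimes>\<^sub>M \<nu>) (\<lambda>(q, z). a (q + h z))"
    "integrable lborel (\<lambda>q. LINT z|\<nu>. a (q + h z))"
    "(LINT q|lborel. LINT z|\<nu>. a (q + h z)) = measure \<nu> UNIV * (LINT q|lborel. a q)"
proof -
  interpret \<nu>: finite_measure \<nu> by fact
  interpret P: pair_sigma_finite lborel \<nu> ..
  interpret P': pair_sigma_finite \<nu> lborel ..
  have [measurable_cong]: "sets \<nu> = sets borel" by fact
  have [measurable]: "a \<in> borel_measurable borel" using borel_measurable_integrable[OF a] by simp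
  have shift: "integrable lborel (\<lambda>q. a (q + c))" "(LINT q|lborel. a (q + c)) = (LINT q|lborel. a q)"
    "(LINT q|lborel. \<bar>a (q + c)\<bar>) = (LINT q|lborel. \<bar>a q\<bar>)" for c
    using lborel_integrable_translate(1)[OF a, of c] lborel_integral_translate(1)[of a c]
      lborel_integral_translate(1)[of "\<lambda>x. \<bar>a x\<bar>" c] by (simp_all add: add.commute)
  have "integrable (\<nu> \<Otimes>\<^sub>M lborel) (\<lambda>p. a (snd p + h (fst p)))"
    by (rule P'.Fubini_integrable) (auto simp: shift)
  from P'.integrable_product_swap[OF this]
  show i: "integrable (lborel \<Otimes>\<^sub>M \<nu>) (\<lambda>(q, z). a (q + h z))" by simp
  show "integrable lborel (\<lambda>q. LINT z|\<nu>. a (q + h z))"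
    using P.integrable_fst[OF i] .
  have "(LINT q|lborel. LINT z|\<nu>. a (q + h z)) = (LINT z|\<nu>. LINT q|lborel. a (q + h z))"
    using P.integral_fst[OF i] P.integral_snd[OF i] by simp
  also have "\<dots> = (LINT z|\<nu>. (LINT q|lborel. a q))" by (simp add: shift)
  also have "\<dots> = measure \<nu> UNIV * (LINT q|lborel. a q)"
    using sets_eq_imp_space_eq[OF \<nu>(2)] by simp
  finally show "(LINT q|lborel. LINT z|\<nu>. a (q + h z)) = measure \<nu> UNIV * (LINT q|lborel. a q)" .
qed

section \<open>Doubling of variables\<close>

lemma set_Fubini:
  fixes G :: "'a::euclidean_space \<times> 'b::euclidean_space \<Rightarrow> real"
  assumes G: "set_integrable lborel (S \<times> S') G"
  shows "(LINT p:S|lborel. LINT q:S'|lborel. G (p, q)) = (LINT z:S \<times> S'|lborel. G z)"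
    "set_integrable lborel S (\<lambda>p. LINT q:S'|lborel. G (p, q))"
    "(LINT q:S'|lborel. LINT p:S|lborel. G (p, q)) = (LINT z:S \<times> S'|lborel. G z)"
proof -
  note F = lborel_Fubini[OF G[unfolded set_integrable_def]]
  have eq: "(LINT q|lborel. indicator (S \<times> S') (p, q) *\<^sub>R G (p, q)) = indicator S p *\<^sub>R (LINT q:S'|lborel. G (p, q))" for p
    unfolding set_lebesgue_integral_def by (auto simp: indicator_times indicator_def)
  show "(LINT p:S|lborel. LINT q:S'|lborel. G (p, q)) = (LINT z:S \<times> S'|lborel. G z)"
    using F(1) unfolding eq by (simp add: set_lebesgue_integral_def)
  show "set_integrable lborel S (\<lambda>p. LINT q:S'|lborel. G (p, q))"
    using F(3) unfolding eq by (simp add: set_integrable_def)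
  have eq': "(LINT p|lborel. indicator (S \<times> S') (p, q) *\<^sub>R G (p, q)) = indicator S' q *\<^sub>R (LINT p:S|lborel. G (p, q))" for q
    unfolding set_lebesgue_integral_def by (auto simp: indicator_times indicator_def)
  show "(LINT q:S'|lborel. LINT p:S|lborel. G (p, q)) = (LINT z:S \<times> S'|lborel. G z)"
    using F(2) unfolding eq' by (simp add: set_lebesgue_integral_def)
qed

lemma set_integral_nonneg_AE:
  fixes g :: "_ \<Rightarrow> real"
  assumes "AE p in N. p \<in> S \<longrightarrow> 0 \<le> g p"
  shows "0 \<le> (LINT p:S|N. g p)"
  unfolding set_lebesgue_integral_def
  by (rule integral_nonneg_AE) (use assms in eventually_elim, auto simp: indicator_def)

text \<open>Turns the boundary integrals into time averages of \<open>mollified_dist\<close>.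
  Integrability of every slice of \<open>V\<close>, not of almost every one, identifies the inner
  integral at each time of the interval.\<close>

lemma slice_Fubini:
  fixes V :: "'a::euclidean_space \<times> real \<Rightarrow> real"
  assumes V: "integrable lborel V" "\<And>t. t \<in> {0<..<T} \<Longrightarrow> integrable lborel (\<lambda>x. V (x, t))"
    and g: "integrable lborel g" and K: "integrable lborel K" and T: "T > 0"
    and \<rho>[measurable]: "\<rho> \<in> borel_measurable borel" and M: "\<And>t. \<bar>\<rho> t\<bar> \<le> M"
  shows "set_integrable lborel (Q T \<times> UNIV) (\<lambda>z. \<bar>g (snd z) - V (fst z)\<bar> * (\<rho> (snd (fst z)) * K (fst (fst z) - snd z)))"
    "set_integrable lborel (Q T) (\<lambda>p. LINT y|lborel. \<bar>g y - V p\<bar> * (\<rho> (snd p) * K (fst p - y)))"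
    "(LINT z:Q T \<times> UNIV|lborel. \<bar>g (snd z) - V (fst z)\<bar> * (\<rho> (snd (fst z)) * K (fst (fst z) - snd z)))
      = (LINT t:{0<..<T}|lborel. \<rho> t * mollified_dist K g (\<lambda>x. V (x, t)))"
    "(LINT p:Q T|lborel. LINT y|lborel. \<bar>g y - V p\<bar> * (\<rho> (snd p) * K (fst p - y)))
      = (LINT t:{0<..<T}|lborel. \<rho> t * mollified_dist K g (\<lambda>x. V (x, t)))"
    "set_integrable lborel {0<..<T} (\<lambda>t. \<rho> t * mollified_dist K g (\<lambda>x. V (x, t)))"
proof -
  have [measurable]: "V \<in> borel_measurable borel" "g \<in> borel_measurable borel" "K \<in> borel_measurable borel"
    using V(1) g K by (auto dest: borel_measurable_integrable)
  let ?G = "\<lambda>z. \<bar>g (snd z) - V (fst z)\<bar> * (\<rho> (snd (fst z)) * K (fst (fst z) - snd z))"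
  show G: "set_integrable lborel (Q T \<times> UNIV) ?G"
  proof (rule integrable_doubling_slice[OF V(1) g _ T, of "\<lambda>x. M * K x"])
    show "integrable lborel (\<lambda>x. M * K x)" using K by simp
    fix p and y :: 'a
    have "\<bar>\<rho> (snd p) * K (fst p - y)\<bar> \<le> \<bar>M * K (fst p - y)\<bar>"
      unfolding abs_mult using M[of "snd p"] by (intro mult_right_mono) auto
    then show "\<bar>?G (p, y)\<bar> \<le> (\<bar>V p\<bar> + \<bar>g y\<bar>) * \<bar>M * K (fst p - y)\<bar>"
      unfolding abs_mult[of "\<bar>_\<bar>"] by (intro mult_mono) auto
  qed measurable
  note F = set_Fubini[OF G, unfolded fst_conv snd_conv, unfolded set_lebesgue_integral_def[of _ UNIV]]
  show i: "set_integrable lborel (Q T) (\<lambda>p. LINT y|lborel. \<bar>g y - V p\<bar> * (\<rho> (snd p) * K (fst p - y)))"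
    using F(2) by simp
  have eq: "(LINT x|lborel. indicator (Q T) (x, t) *\<^sub>R (LINT y|lborel. \<bar>g y - V (x, t)\<bar> * (\<rho> t * K (x - y))))
      = indicator {0<..<T} t *\<^sub>R (\<rho> t * mollified_dist K g (\<lambda>x. V (x, t)))" for t
  proof (cases "t \<in> {0<..<T}")
    case True
    have "(LINT x|lborel. LINT y|lborel. \<bar>g y - V (x, t)\<bar> * (\<rho> t * K (x - y)))
        = \<rho> t * (LINT x|lborel. LINT y|lborel. \<bar>g y - V (x, t)\<bar> * K (x - y))"
      by (simp add: mult.left_commute)
    also have "\<dots> = \<rho> t * mollified_dist K g (\<lambda>x. V (x, t))"
      using lborel_Fubini(1)[OF mollified_dist_integrable[OF g V(2)[OF True] K]] by (simp add: mollified_dist_eq)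
    finally show ?thesis using True by simp
  qed simp
  note F' = lborel_Fubini[OF i[unfolded set_integrable_def]]
  show "(LINT p:Q T|lborel. LINT y|lborel. \<bar>g y - V p\<bar> * (\<rho> (snd p) * K (fst p - y)))
      = (LINT t:{0<..<T}|lborel. \<rho> t * mollified_dist K g (\<lambda>x. V (x, t)))"
    unfolding set_lebesgue_integral_def F'(2)[symmetric] by (simp only: snd_conv fst_conv eq)
  then show "(LINT z:Q T \<times> UNIV|lborel. ?G z) = (LINT t:{0<..<T}|lborel. \<rho> t * mollified_dist K g (\<lambda>x. V (x, t)))"
    using F(1) by simp
  show "set_integrable lborel {0<..<T} (\<lambda>t. \<rho> t * mollified_dist K g (\<lambda>x. V (x, t)))"
    using F'(4) by (simp only: snd_conv fst_conv eq set_integrable_def)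
qed

section \<open>Lipschitz data and the doubled integrands\<close>

locale doubling =
  fixes T :: real and f :: "real \<Rightarrow> 'a::euclidean_space" and A :: "real \<Rightarrow> real"
    and \<mu> :: "'a measure" and L M :: real
  assumes T_pos: "T > 0"
    and L_nonneg: "L \<ge> 0"
    and f_Lipschitz: "\<And>a b. norm (f a - f b) \<le> L * \<bar>a - b\<bar>"
    and A_Lipschitz: "\<And>a b. \<bar>A a - A b\<bar> \<le> L * \<bar>a - b\<bar>"
    and A_mono: "mono A" and A_zero: "A 0 = 0" and A_bounded: "\<And>x. \<bar>A x\<bar> \<le> M"
    and levy: "levy_measure \<mu>"
begin

lemma f_measurable [measurable]: "f \<in> borel_measurable borel"
proof (rule borel_measurable_continuous_onI)
  have "L-lipschitz_on UNIV f"
    by (rule lipschitz_onI) (use f_Lipschitz L_nonneg in \<open>auto simp: dist_norm\<close>)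
  then show "continuous_on UNIV f" by (rule lipschitz_on_continuous_on)
qed

lemma A_measurable [measurable]: "A \<in> borel_measurable borel"
proof (rule borel_measurable_continuous_onI)
  have "L-lipschitz_on UNIV A"
    by (rule lipschitz_onI) (use A_Lipschitz L_nonneg in \<open>auto simp: dist_norm\<close>)
  then show "continuous_on UNIV A" by (rule lipschitz_on_continuous_on)
qed

definition flux :: "'a \<Rightarrow> real \<Rightarrow> real \<Rightarrow> 'a" where
  "flux b k l = entropy_flux f k l + \<bar>A k - A l\<bar> *\<^sub>R b"

text \<open>Symmetry in the two states makes the first-order terms cancel when the solution is
  compared with itself.\<close>

lemma flux_sym: "flux b k l = flux b l k"
proof -
  have "sgn (k - l) *\<^sub>R (f k - f l) = sgn (l - k) *\<^sub>R (f l - f k)"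
    by (cases k l rule: linorder_cases) (auto simp: algebra_simps)
  then show ?thesis by (simp add: flux_def entropy_flux_def abs_minus_commute)
qed

lemma flux_bound: "norm (flux b k l) \<le> L * (1 + norm b) * (\<bar>l\<bar> + \<bar>k\<bar>)"
proof -
  have "norm (flux b k l) \<le> \<bar>sgn (k - l)\<bar> * norm (f k - f l) + \<bar>A k - A l\<bar> * norm b"
    unfolding flux_def entropy_flux_def by (rule order_trans[OF norm_triangle_ineq]) simp
  also have "\<dots> \<le> 1 * (L * \<bar>k - l\<bar>) + (L * \<bar>k - l\<bar>) * norm b"
    by (intro add_mono mult_mono f_Lipschitz A_Lipschitz) (auto simp: sgn_if L_nonneg)
  also have "\<dots> = L * (1 + norm b) * \<bar>k - l\<bar>" by (simp add: algebra_simps)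
  also have "\<dots> \<le> L * (1 + norm b) * (\<bar>l\<bar> + \<bar>k\<bar>)"
    by (intro mult_left_mono) (auto simp: L_nonneg)
  finally show ?thesis .
qed

lemma flux_measurable [measurable]:
  assumes [measurable]: "g \<in> borel_measurable N" "h \<in> borel_measurable N"
  shows "(\<lambda>x. flux b (g x) (h x)) \<in> borel_measurable N"
  unfolding flux_def entropy_flux_def by measurable

lemma A_U_integrable:
  assumes U: "integrable N U"
  shows "integrable N (\<lambda>q. A (U q))"
proof (rule Bochner_Integration.integrable_bound)
  show "integrable N (\<lambda>q. L * U q)" using U by simp
  have [measurable]: "U \<in> borel_measurable N" using U by simp
  show "(\<lambda>q. A (U q)) \<in> borel_measurable N" by measurable
  show "AE q in N. norm (A (U q)) \<le> norm (L * U q)"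
    using A_Lipschitz[of _ 0] L_nonneg by (simp add: A_zero abs_mult)
qed

text \<open>\<open>levy_large\<close> of \<open>A (U)\<close>, written with the finite measure of
  large jumps and as a function of the space-time point, so that it can be treated as an integrable
  function on the product space.\<close>

definition nonlocal :: "real \<Rightarrow> ('a \<times> real \<Rightarrow> real) \<Rightarrow> 'a \<times> real \<Rightarrow> real" where
  "nonlocal r U q = (LINT z|large_jumps \<mu> r. A (U (fst q + z, snd q)) - A (U q))"

lemma nonlocal_integrable:
  assumes U: "integrable lborel U" and r: "r > 0"
  shows "integrable lborel (nonlocal r U)"
proof -
  let ?\<nu> = "large_jumps \<mu> r"
  interpret \<nu>: finite_measure ?\<nu> by (rule finite_large_jumps[OF levy r])
  have [measurable]: "U \<in> borel_measurable borel" using borel_measurable_integrable[OF U] by simp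
  have m: "(\<lambda>z::'a. (z, 0::real)) \<in> borel_measurable borel" by measurable
  have i: "integrable lborel (\<lambda>q. LINT z|?\<nu>. A (U (q + (z, 0))))"
    by (rule shift_integrable(2)[OF finite_large_jumps[OF levy r] sets_large_jumps A_U_integrable[OF U] m])
  have "nonlocal r U q = (LINT z|?\<nu>. A (U (q + (z, 0)))) - measure ?\<nu> UNIV * A (U q)" for q
  proof -
    \<comment> \<open>Boundedness of \<open>A\<close> makes the inner integral exist at every
      \<open>q\<close>, so the splitting holds everywhere and not only almost everywhere.\<close>
    have "integrable ?\<nu> (\<lambda>z. A (U (q + (z, 0))))"
      by (rule \<nu>.integrable_const_bound[of _ M]) (use A_bounded in auto)
    then show ?thesis
      using sets_eq_imp_space_eq[OF sets_large_jumps[of \<mu> r]]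
      by (cases q) (simp add: nonlocal_def)
  qed
  then have eq: "nonlocal r U = (\<lambda>q. (LINT z|?\<nu>. A (U (q + (z, 0)))) - measure ?\<nu> UNIV * A (U q))" by blast
  show ?thesis unfolding eq using i A_U_integrable[OF U] by simp
qed

lemma levy_large_nonlocal:
  assumes U: "U \<in> borel_measurable borel" and r: "r > 0"
  shows "levy_large \<mu> r (\<lambda>\<eta>. A (U (\<eta>, s))) y = nonlocal r U (y, s)"
proof -
  note [measurable] = U
  have "(\<lambda>\<eta>. A (U (\<eta>, s))) \<in> borel_measurable borel" by measurable
  from levy_large_eq[OF levy r this, of y] show ?thesis by (simp add: nonlocal_def)
qed

text \<open>Below \<open>z = (p, q)\<close> with \<open>p = (x, t)\<close> the variable of the comparison function and
  \<open>q = (y, s)\<close> that of the entropy solution. The test function is \<open>\<sigma> (s - c t) K (x - y)\<close>;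
  \<open>c = 1\<close> gives the usual doubling, \<open>c = 0\<close> a cutoff in \<open>s\<close> alone.\<close>

definition time_term :: "('a \<times> real \<Rightarrow> real) \<Rightarrow> ('a \<times> real \<Rightarrow> real) \<Rightarrow> (real \<Rightarrow> real) \<Rightarrow> real \<Rightarrow> ('a \<Rightarrow> real)
    \<Rightarrow> ('a \<times> real) \<times> ('a \<times> real) \<Rightarrow> real" where
  "time_term U V \<sigma> c K z = \<bar>U (snd z) - V (fst z)\<bar>
      * (deriv \<sigma> (snd (snd z) - c * snd (fst z)) * K (fst (fst z) - fst (snd z)))"

definition flux_term :: "'a \<Rightarrow> ('a \<times> real \<Rightarrow> real) \<Rightarrow> ('a \<times> real \<Rightarrow> real) \<Rightarrow> (real \<Rightarrow> real) \<Rightarrow> real \<Rightarrow> ('a \<Rightarrow> real)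
    \<Rightarrow> ('a \<times> real) \<times> ('a \<times> real) \<Rightarrow> real" where
  "flux_term b U V \<sigma> c K z = flux b (U (snd z)) (V (fst z))
      \<bullet> (\<sigma> (snd (snd z) - c * snd (fst z)) *\<^sub>R grad K (fst (fst z) - fst (snd z)))"

definition small_term :: "real \<Rightarrow> ('a \<times> real \<Rightarrow> real) \<Rightarrow> ('a \<times> real \<Rightarrow> real) \<Rightarrow> (real \<Rightarrow> real) \<Rightarrow> real \<Rightarrow> ('a \<Rightarrow> real)
    \<Rightarrow> ('a \<times> real) \<times> ('a \<times> real) \<Rightarrow> real" where
  "small_term r U V \<sigma> c K z = \<bar>A (U (snd z)) - A (V (fst z))\<bar>
      * (\<sigma> (snd (snd z) - c * snd (fst z)) * small_jump (dual \<mu>) r K (fst (fst z) - fst (snd z)))"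

definition large_term :: "real \<Rightarrow> ('a \<times> real \<Rightarrow> real) \<Rightarrow> ('a \<times> real \<Rightarrow> real) \<Rightarrow> (real \<Rightarrow> real) \<Rightarrow> real \<Rightarrow> ('a \<Rightarrow> real)
    \<Rightarrow> ('a \<times> real) \<times> ('a \<times> real) \<Rightarrow> real" where
  "large_term r U V \<sigma> c K z = sgn (U (snd z) - V (fst z)) * nonlocal r U (snd z)
      * (\<sigma> (snd (snd z) - c * snd (fst z)) * K (fst (fst z) - fst (snd z)))"

text \<open>The last three terms are treated for bounded Borel \<sigma> because the constant weight
  1 is needed as well: it gives the majorants in the limit at the initial time. The time term
  involves the derivative of \<sigma> and keeps the smooth class.\<close>

lemma terms_integrable:
  assumes U: "integrable lborel U" and V: "integrable lborel V"
    and K: "K \<in> Cc_infinity" and r: "r > 0"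
  shows time_term_integrable: "\<sigma> \<in> Cc_infinity \<Longrightarrow> doubled_integrable T (time_term U V \<sigma> c K)"
    and space_terms_integrable: "\<And>S. \<sigma> \<in> borel_measurable borel \<Longrightarrow> (\<And>s. \<bar>\<sigma> s\<bar> \<le> S) \<Longrightarrow>
      doubled_integrable T (flux_term b U V \<sigma> c K)
    \<and> doubled_integrable T (small_term r U V \<sigma> c K)
    \<and> doubled_integrable T (large_term r U V \<sigma> c K)"
proof -
  have [measurable]: "U \<in> borel_measurable borel" "V \<in> borel_measurable borel"
    "nonlocal r U \<in> borel_measurable borel" "small_jump (dual \<mu>) r K \<in> borel_measurable borel"
    using U V nonlocal_integrable[OF U r] small_jump_integrable[OF dual_properties[OF levy] K]
    by (auto dest: borel_measurable_integrable)
  have [measurable]: "K \<in> borel_measurable borel" "grad K \<in> borel_measurable borel"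
    using K by (auto intro: Cc_infinity_borel borel_measurable_continuous_onI grad_continuous)
  have Ki: "integrable lborel K" by (rule Cc_infinity_integrable[OF K])
  have gi: "integrable lborel (\<lambda>x. norm (grad K x))"
  proof -
    obtain R where "\<And>x. norm x > R \<Longrightarrow> grad K x = 0" by (rule grad_vanishes[OF K]) blast
    then have "integrable lborel (grad K)" by (rule integrable_continuous_vanishing[OF grad_continuous[OF K]])
    then show ?thesis by simp
  qed
  show "doubled_integrable T (time_term U V \<sigma> c K)" if \<sigma>: "\<sigma> \<in> Cc_infinity"
  proof -
    obtain S' where S': "S' \<ge> 0" "\<And>x. \<bar>deriv \<sigma> x\<bar> \<le> S'" using Cc_infinity_bounded[OF Cc_infinity_deriv[OF \<sigma>]] by blast
    have [measurable]: "deriv \<sigma> \<in> borel_measurable borel"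
      using \<sigma> by (intro Cc_infinity_borel Cc_infinity_deriv)
    show ?thesis
    proof (rule integrable_doubling_Q[OF V U _ T_pos, of "\<lambda>x. S' * K x"])
      show "integrable lborel (\<lambda>x. S' * K x)" using Ki by simp
      show "time_term U V \<sigma> c K \<in> borel_measurable borel" unfolding time_term_def by measurable
      show "\<bar>time_term U V \<sigma> c K (p, q)\<bar> \<le> (\<bar>V p\<bar> + \<bar>U q\<bar>) * \<bar>S' * K (fst p - fst q)\<bar>" for p q
        unfolding time_term_def abs_mult using S' by (intro mult_mono) auto
    qed
  qed
  fix S assume \<sigma>[measurable]: "\<sigma> \<in> borel_measurable borel" and S: "\<And>s. \<bar>\<sigma> s\<bar> \<le> S"
  have S: "S \<ge> 0" "\<And>x. \<bar>\<sigma> x\<bar> \<le> S" using order_trans[OF abs_ge_zero S[of 0]] S by blast+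
  have "doubled_integrable T (flux_term b U V \<sigma> c K)"
  proof (rule integrable_doubling_Q[OF V U _ T_pos, of "\<lambda>x. (L * (1 + norm b) * S) * norm (grad K x)"])
    show "integrable lborel (\<lambda>x. (L * (1 + norm b) * S) * norm (grad K x))" using gi by simp
    show "flux_term b U V \<sigma> c K \<in> borel_measurable borel" unfolding flux_term_def by measurable
    fix p q
    have "\<bar>flux_term b U V \<sigma> c K (p, q)\<bar> \<le> norm (flux b (U q) (V p)) * norm (\<sigma> (snd q - c * snd p) *\<^sub>R grad K (fst p - fst q))"
      unfolding flux_term_def fst_conv snd_conv by (rule Cauchy_Schwarz_ineq2)
    also have "\<dots> \<le> (L * (1 + norm b) * (\<bar>V p\<bar> + \<bar>U q\<bar>)) * (S * norm (grad K (fst p - fst q)))"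
      using S L_nonneg by (intro mult_mono flux_bound) (auto intro: mult_right_mono)
    finally show "\<bar>flux_term b U V \<sigma> c K (p, q)\<bar>
        \<le> (\<bar>V p\<bar> + \<bar>U q\<bar>) * \<bar>(L * (1 + norm b) * S) * norm (grad K (fst p - fst q))\<bar>"
      using S L_nonneg by (simp add: abs_mult mult_ac)
  qed
  moreover have "doubled_integrable T (small_term r U V \<sigma> c K)"
  proof (rule integrable_doubling_Q[OF V U _ T_pos, of "\<lambda>x. (L * S) * small_jump (dual \<mu>) r K x"])
    show "integrable lborel (\<lambda>x. (L * S) * small_jump (dual \<mu>) r K x)"
      using small_jump_integrable[OF dual_properties[OF levy] K] by simp
    show "small_term r U V \<sigma> c K \<in> borel_measurable borel" unfolding small_term_def by measurable
    fix p q
    have "\<bar>A (U q) - A (V p)\<bar> \<le> L * (\<bar>V p\<bar> + \<bar>U q\<bar>)"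
      by (rule order_trans[OF A_Lipschitz]) (intro mult_left_mono, auto simp: L_nonneg)
    then have "\<bar>small_term r U V \<sigma> c K (p, q)\<bar> \<le> (L * (\<bar>V p\<bar> + \<bar>U q\<bar>)) * (S * \<bar>small_jump (dual \<mu>) r K (fst p - fst q)\<bar>)"
      unfolding small_term_def abs_mult fst_conv snd_conv using S L_nonneg by (intro mult_mono) auto
    then show "\<bar>small_term r U V \<sigma> c K (p, q)\<bar> \<le> (\<bar>V p\<bar> + \<bar>U q\<bar>) * \<bar>(L * S) * small_jump (dual \<mu>) r K (fst p - fst q)\<bar>"
      using S L_nonneg by (simp add: abs_mult mult_ac)
  qed
  moreover have "doubled_integrable T (large_term r U V \<sigma> c K)"
  proof (rule integrable_doubling_Q[OF V nonlocal_integrable[OF U r] _ T_pos, of "\<lambda>x. S * K x"])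
    show "integrable lborel (\<lambda>x. S * K x)" using Ki by simp
    show "large_term r U V \<sigma> c K \<in> borel_measurable borel" unfolding large_term_def by measurable
    fix p q
    have "\<bar>sgn (U q - V p) * nonlocal r U q\<bar> \<le> \<bar>V p\<bar> + \<bar>nonlocal r U q\<bar>"
      by (auto simp: sgn_if)
    then show "\<bar>large_term r U V \<sigma> c K (p, q)\<bar> \<le> (\<bar>V p\<bar> + \<bar>nonlocal r U q\<bar>) * \<bar>S * K (fst p - fst q)\<bar>"
      unfolding large_term_def abs_mult[of "_ * _" "_ * _"] abs_mult[of "\<sigma> _"] abs_mult[of S] fst_conv snd_conv
      using S by (intro mult_mono) auto
  qed
  ultimately show "doubled_integrable T (flux_term b U V \<sigma> c K)
    \<and> doubled_integrable T (small_term r U V \<sigma> c K)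
    \<and> doubled_integrable T (large_term r U V \<sigma> c K)" by blast
qed

text \<open>The comparison function \<open>V\<close> satisfies no equation; it enters only through
  the constants \<open>k = V p\<close>. One statement therefore covers \<open>v\<close>, the
  solution itself and \<open>u0\<close> extended constantly in time.\<close>

lemma doubled_entropy_inequality:
  assumes u: "entropy_solution T f A \<mu> u0 u" and u0: "integrable lborel u0"
    and U: "integrable lborel U" "\<And>p. p \<in> Q T \<Longrightarrow> U p = u p"
    and V: "integrable lborel V" "\<And>t. t \<in> {0<..<T} \<Longrightarrow> integrable lborel (\<lambda>x. V (x, t))"
    and K: "K \<in> Cc_infinity" "\<And>x. K x \<ge> 0" and \<sigma>: "\<sigma> \<in> Cc_infinity" "\<And>x. \<sigma> x \<ge> 0" and r: "r > 0"
  shows "0 \<le> doubled_integral T (time_term U V \<sigma> c K)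
      - doubled_integral T (flux_term (levy_drift (dual \<mu>) r) U V \<sigma> c K)
      + doubled_integral T (small_term r U V \<sigma> c K)
      + doubled_integral T (large_term r U V \<sigma> c K)
      - (LINT t:{0<..<T}|lborel. \<sigma> (T - c * t) * mollified_dist K (\<lambda>x. u (x, T)) (\<lambda>x. V (x, t)))
      + (LINT t:{0<..<T}|lborel. \<sigma> (0 - c * t) * mollified_dist K u0 (\<lambda>x. V (x, t)))"
proof -
  let ?b = "levy_drift (dual \<mu>) r"
  have [measurable]: "U \<in> borel_measurable borel" using borel_measurable_integrable[OF U(1)] by simp
  have [measurable]: "\<sigma> \<in> borel_measurable borel" by (rule Cc_infinity_borel[OF \<sigma>(1)])
  obtain S where S: "S \<ge> 0" "\<And>x. \<bar>\<sigma> x\<bar> \<le> S" using Cc_infinity_bounded[OF \<sigma>(1)] by blast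
  note st = space_terms_integrable[OF U(1) V(1) K(1) r Cc_infinity_borel[OF \<sigma>(1)] S(2)]
  have ti: "doubled_integrable T (time_term U V \<sigma> c K)"
    "doubled_integrable T (flux_term ?b U V \<sigma> c K)"
    "doubled_integrable T (small_term r U V \<sigma> c K)"
    "doubled_integrable T (large_term r U V \<sigma> c K)"
    using time_term_integrable[OF U(1) V(1) K(1) r \<sigma>(1)] st by blast+
  have Ki: "integrable lborel K" by (rule Cc_infinity_integrable[OF K(1)])
  have Lc: "Linf_C_L1 T u" using u by (simp add: entropy_solution_def)
  have uT: "integrable lborel (\<lambda>x. u (x, T))" using Linf_C_L1_integrable[OF Lc, of T] T_pos by simp
  have bi: "set_integrable lborel (Q T) (\<lambda>p. LINT y|lborel. \<bar>g y - V p\<bar> * (\<sigma> (a - c * snd p) * K (fst p - y)))"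
    "(LINT p:Q T|lborel. LINT y|lborel. \<bar>g y - V p\<bar> * (\<sigma> (a - c * snd p) * K (fst p - y)))
      = (LINT t:{0<..<T}|lborel. \<sigma> (a - c * t) * mollified_dist K g (\<lambda>x. V (x, t)))"
    if g: "integrable lborel g" for g a
    by (rule slice_Fubini[OF V g Ki T_pos, of "\<lambda>t. \<sigma> (a - c * t)" S]; use S in simp)+
  note F = ti[THEN set_Fubini(1)] and Fi = ti[THEN set_Fubini(2)]
  define E where "E p = (LINT q:Q T|lborel. time_term U V \<sigma> c K (p, q)) - (LINT q:Q T|lborel. flux_term ?b U V \<sigma> c K (p, q))
      + (LINT q:Q T|lborel. small_term r U V \<sigma> c K (p, q)) + (LINT q:Q T|lborel. large_term r U V \<sigma> c K (p, q))
      - (LINT y|lborel. \<bar>u (y, T) - V p\<bar> * (\<sigma> (T - c * snd p) * K (fst p - y)))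
      + (LINT y|lborel. \<bar>u0 y - V p\<bar> * (\<sigma> (0 - c * snd p) * K (fst p - y)))" for p
  have main: "0 \<le> E p"
    if p: "p \<in> Q T" and sec: "set_integrable lborel (Q T) (\<lambda>q. time_term U V \<sigma> c K (p, q))"
      "set_integrable lborel (Q T) (\<lambda>q. flux_term ?b U V \<sigma> c K (p, q))"
      "set_integrable lborel (Q T) (\<lambda>q. small_term r U V \<sigma> c K (p, q))"
      "set_integrable lborel (Q T) (\<lambda>q. large_term r U V \<sigma> c K (p, q))" for p
  proof -
    obtain x t where xt: "p = (x, t)" by (cases p)
    \<comment> \<open>The doubled test function does not have compact support in all variables
      jointly, but it does in \<open>(y, s)\<close> once \<open>(x, t)\<close> is fixed.\<close>
    define \<phi> where "\<phi> q = \<sigma> (- (c * t) + snd q) * K (x + - fst q)" for q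
    have "(\<lambda>s. \<sigma> (- (c * t) + s)) \<in> Cc_infinity"
      by (rule Cc_infinity_compose_affine[OF \<sigma>(1) bounded_linear_ident, of 1]) auto
    moreover have "(\<lambda>y. K (x + - y)) \<in> Cc_infinity"
      by (rule Cc_infinity_compose_affine[OF K(1) bounded_linear_minus[OF bounded_linear_ident], of 1]) auto
    ultimately have \<phi>: "\<phi> \<in> Cc_infinity"
      unfolding \<phi>_def by (rule Cc_infinity_tensor[rotated])
    have \<phi>0: "\<phi> q \<ge> 0" for q by (simp add: \<phi>_def K \<sigma>)
    have \<phi>_eq: "\<phi> (y, s) = \<sigma> (s - c * t) * K (x - y)" for y s by (simp add: \<phi>_def)
    have d: "deriv (\<lambda>\<tau>. \<phi> (y, \<tau>)) s = deriv \<sigma> (s - c * t) * K (x - y)" for y s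
      unfolding \<phi>_eq
      by (rule DERIV_imp_deriv)
        (auto intro!: derivative_eq_intros DERIV_chain2[OF Cc_infinity_has_real_derivative[OF \<sigma>(1)]])
    have g: "grad (\<lambda>\<xi>. \<phi> (\<xi>, s)) y = - (\<sigma> (s - c * t) *\<^sub>R grad K (x - y))" for y s
      unfolding \<phi>_eq by (rule grad_reflect[OF K(1)])
    have l: "levy_small (dual \<mu>) r (\<lambda>\<xi>. \<phi> (\<xi>, s)) y = \<sigma> (s - c * t) * small_jump (dual \<mu>) r K (x - y)" for y s
      unfolding \<phi>_eq by (rule levy_small_reflect[OF K(1)])
    \<comment> \<open>The operator sees the whole spatial slice at time \<open>s\<close>. Membership
      in \<open>Q T\<close> restricts only the time, so \<open>U\<close> and \<open>u\<close> agree
      on that entire slice.\<close>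
    have n: "levy_large \<mu> r (\<lambda>\<xi>. A (u (\<xi>, s))) y = nonlocal r U (y, s)" if "(y, s) \<in> Q T" for y s
    proof -
      have "(\<lambda>\<xi>. A (u (\<xi>, s))) = (\<lambda>\<xi>. A (U (\<xi>, s)))"
        using that U(2) by (auto simp: mem_Q)
      then show ?thesis using levy_large_nonlocal[OF _ r, of U s y] by simp
    qed
    have "0 \<le> (LINT (y, s):Q T|lborel.
            \<bar>u (y, s) - V p\<bar> * deriv (\<lambda>\<tau>. \<phi> (y, \<tau>)) s
          + (entropy_flux f (u (y, s)) (V p) + \<bar>A (u (y, s)) - A (V p)\<bar> *\<^sub>R ?b) \<bullet> grad (\<lambda>\<xi>. \<phi> (\<xi>, s)) y)
      + (LINT (y, s):Q T|lborel.
            \<bar>A (u (y, s)) - A (V p)\<bar> * levy_small (dual \<mu>) r (\<lambda>\<xi>. \<phi> (\<xi>, s)) y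
          + sgn (u (y, s) - V p) * levy_large \<mu> r (\<lambda>\<xi>. A (u (\<xi>, s))) y * \<phi> (y, s))
      - (LINT y|lborel. \<bar>u (y, T) - V p\<bar> * \<phi> (y, T))
      + (LINT y|lborel. \<bar>u0 y - V p\<bar> * \<phi> (y, 0))"
      using u r \<phi> \<phi>0 unfolding entropy_solution_def by blast
    also have "(LINT (y, s):Q T|lborel.
            \<bar>u (y, s) - V p\<bar> * deriv (\<lambda>\<tau>. \<phi> (y, \<tau>)) s
          + (entropy_flux f (u (y, s)) (V p) + \<bar>A (u (y, s)) - A (V p)\<bar> *\<^sub>R ?b) \<bullet> grad (\<lambda>\<xi>. \<phi> (\<xi>, s)) y)
      = (LINT q:Q T|lborel. time_term U V \<sigma> c K (p, q) - flux_term ?b U V \<sigma> c K (p, q))"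
      by (rule set_lebesgue_integral_cong)
        (auto simp: U(2) d g time_term_def flux_term_def flux_def xt inner_minus_right)
    also have "\<dots> = (LINT q:Q T|lborel. time_term U V \<sigma> c K (p, q)) - (LINT q:Q T|lborel. flux_term ?b U V \<sigma> c K (p, q))"
      by (rule set_integral_diff(2)[OF sec(1,2)])
    also have "(LINT (y, s):Q T|lborel.
            \<bar>A (u (y, s)) - A (V p)\<bar> * levy_small (dual \<mu>) r (\<lambda>\<xi>. \<phi> (\<xi>, s)) y
          + sgn (u (y, s) - V p) * levy_large \<mu> r (\<lambda>\<xi>. A (u (\<xi>, s))) y * \<phi> (y, s))
      = (LINT q:Q T|lborel. small_term r U V \<sigma> c K (p, q) + large_term r U V \<sigma> c K (p, q))"
      by (rule set_lebesgue_integral_cong)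
        (auto simp: U(2) l[unfolded \<phi>_eq] n \<phi>_eq small_term_def large_term_def xt)
    also have "\<dots> = (LINT q:Q T|lborel. small_term r U V \<sigma> c K (p, q)) + (LINT q:Q T|lborel. large_term r U V \<sigma> c K (p, q))"
      by (rule set_integral_add(2)[OF sec(3,4)])
    finally show ?thesis by (simp add: E_def \<phi>_eq xt)
  qed
  \<comment> \<open>Fubini yields integrable sections only for almost every \<open>p\<close>. This
    is why \<open>main\<close> takes their integrability as a premise and the inequality is
    integrated in its almost everywhere form.\<close>
  have AE_sec: "AE p in lborel. p \<in> Q T \<longrightarrow> set_integrable lborel (Q T) (\<lambda>q. G (p, q))"
    if "doubled_integrable T G" for G :: "('a \<times> real) \<times> ('a \<times> real) \<Rightarrow> real"
    using lborel_Fubini(5)[OF that[unfolded set_integrable_def]]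
    by eventually_elim (auto simp: set_integrable_def indicator_times mem_Q)
  have "0 \<le> (LINT p:Q T|lborel. E p)"
  proof (rule set_integral_nonneg_AE)
    show "AE p in lborel. p \<in> Q T \<longrightarrow> 0 \<le> E p"
      using AE_sec[OF ti(1)] AE_sec[OF ti(2)] AE_sec[OF ti(3)] AE_sec[OF ti(4)]
      by eventually_elim (blast intro: main)
  qed
  then show ?thesis
    by (simp only: E_def F bi[OF uT] bi[OF u0] set_integral_add set_integral_diff Fi)
qed

end

section \<open>Boundary terms in time\<close>

text \<open>The bound on \<open>m\<close> is required only where the weight is nonzero. Mollifier
  weights confine \<open>t\<close> to a \<delta>-neighbourhood of an end point, and only there does
  the modulus of continuity help.\<close>

lemma weighted_average_bounds:
  fixes \<rho> m :: "real \<Rightarrow> real"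
  assumes \<rho>: "set_integrable lborel I \<rho>" "\<And>t. t \<in> I \<Longrightarrow> \<rho> t \<ge> 0"
    and m: "set_integrable lborel I (\<lambda>t. \<rho> t * m t)"
  shows "(\<And>t. t \<in> I \<Longrightarrow> \<rho> t \<noteq> 0 \<Longrightarrow> c \<le> m t) \<Longrightarrow> (LINT t:I|lborel. \<rho> t) * c \<le> (LINT t:I|lborel. \<rho> t * m t)"
    "(\<And>t. t \<in> I \<Longrightarrow> \<rho> t \<noteq> 0 \<Longrightarrow> m t \<le> c) \<Longrightarrow> (LINT t:I|lborel. \<rho> t * m t) \<le> (LINT t:I|lborel. \<rho> t) * c"
proof -
  have i: "set_integrable lborel I (\<lambda>t. \<rho> t * c)" using \<rho>(1) by simp
  have eq: "(LINT t:I|lborel. \<rho> t) * c = (LINT t:I|lborel. \<rho> t * c)" by simp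
  show "(LINT t:I|lborel. \<rho> t) * c \<le> (LINT t:I|lborel. \<rho> t * m t)"
    if "\<And>t. t \<in> I \<Longrightarrow> \<rho> t \<noteq> 0 \<Longrightarrow> c \<le> m t"
    unfolding eq
  proof (rule set_integral_mono[OF i m])
    show "\<rho> t * c \<le> \<rho> t * m t" if "t \<in> I" for t
      using that \<rho>(2)[of t] \<open>\<And>t. t \<in> I \<Longrightarrow> \<rho> t \<noteq> 0 \<Longrightarrow> c \<le> m t\<close>[of t]
      by (cases "\<rho> t = 0") (auto intro: mult_left_mono)
  qed
  show "(LINT t:I|lborel. \<rho> t * m t) \<le> (LINT t:I|lborel. \<rho> t) * c"
    if "\<And>t. t \<in> I \<Longrightarrow> \<rho> t \<noteq> 0 \<Longrightarrow> m t \<le> c"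
    unfolding eq
  proof (rule set_integral_mono[OF m i])
    show "\<rho> t * m t \<le> \<rho> t * c" if "t \<in> I" for t
      using that \<rho>(2)[of t] \<open>\<And>t. t \<in> I \<Longrightarrow> \<rho> t \<noteq> 0 \<Longrightarrow> m t \<le> c\<close>[of t]
      by (cases "\<rho> t = 0") (auto intro: mult_left_mono)
  qed
qed

text \<open>\<open>\<sigma>\<close> need not be even, so the end points of the time interval see the two complementary parts
  of its mass.\<close>

lemma time_weights:
  fixes \<theta> :: "real \<Rightarrow> real"
  assumes \<theta>: "mollifier_kernel \<theta>" and \<delta>: "0 < \<delta>" "\<delta> < T"
  obtains a b where "a \<ge> 0" "b \<ge> 0" "a + b = 1"
    "(LINT t:{0<..<T}|lborel. rescaled \<theta> \<delta> (t - T)) = a"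
    "(LINT t:{0<..<T}|lborel. rescaled \<theta> \<delta> (T - t)) = b"
    "(LINT t:{0<..<T}|lborel. rescaled \<theta> \<delta> t) = b"
    "(LINT t:{0<..<T}|lborel. rescaled \<theta> \<delta> (- t)) = a"
proof -
  let ?\<sigma> = "rescaled \<theta> \<delta>"
  note R = mollifier_rescaled[OF \<theta> \<delta>(1)]
  have \<sigma>i: "integrable lborel ?\<sigma>" by (rule Cc_infinity_integrable[OF R(1)])
  have [measurable]: "?\<sigma> \<in> borel_measurable borel" by (rule Cc_infinity_borel[OF R(1)])
  \<comment> \<open>\<open>p\<close> and \<open>m\<close> carry the mass on the two sides of 0.
    Since \<open>\<delta> < T\<close>, no mass is lost by restricting to \<open>(-T, T)\<close>; the
    weights at the end point \<open>T\<close> are shifts or reflections of these two.\<close>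
  define p where "p t = indicator {0<..<T} t * ?\<sigma> t" for t
  define m where "m t = indicator {-T<..<0} t * ?\<sigma> t" for t
  have [measurable]: "p \<in> borel_measurable borel" "m \<in> borel_measurable borel"
    unfolding p_def m_def by measurable
  have pm: "integrable lborel p" "integrable lborel m"
    unfolding p_def m_def
    by (intro Bochner_Integration.integrable_bound[OF \<sigma>i], measurable, simp add: indicator_def)+
  have sum: "AE t in lborel. p t + m t = ?\<sigma> t"
    using AE_lborel_singleton[of 0]
  proof eventually_elim
    case (elim t)
    show ?case
      using elim R(4)[of t] \<delta> by (cases "\<delta> \<le> norm t") (auto simp: p_def m_def indicator_def)
  qed
  have "(LINT t|lborel. p t + m t) = (LINT t|lborel. ?\<sigma> t)"
    by (rule integral_cong_AE) (use sum in auto)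
  then have one: "(LINT t|lborel. m t) + (LINT t|lborel. p t) = 1" using pm R(3) by simp
  show ?thesis
  proof (rule that[of "LINT t|lborel. m t" "LINT t|lborel. p t"])
    show "0 \<le> (LINT t|lborel. m t)" "0 \<le> (LINT t|lborel. p t)"
      by (intro integral_nonneg_AE AE_I2; simp add: m_def p_def R(2))+
    show "(LINT t|lborel. m t) + (LINT t|lborel. p t) = 1" by (rule one)
    have "(LINT t:{0<..<T}|lborel. ?\<sigma> (t - T)) = (LINT t|lborel. m (- T + t))"
      unfolding set_lebesgue_integral_def m_def
      by (intro Bochner_Integration.integral_cong) (auto simp: indicator_def)
    then show "(LINT t:{0<..<T}|lborel. ?\<sigma> (t - T)) = (LINT t|lborel. m t)"
      using lborel_integral_translate(1)[of m "-T"] by simp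
    have "(LINT t:{0<..<T}|lborel. ?\<sigma> (T - t)) = (LINT t|lborel. p (T - t))"
      unfolding set_lebesgue_integral_def p_def
      by (intro Bochner_Integration.integral_cong) (auto simp: indicator_def)
    then show "(LINT t:{0<..<T}|lborel. ?\<sigma> (T - t)) = (LINT t|lborel. p t)"
      using lborel_integral_translate(2)[of p T] by simp
    show "(LINT t:{0<..<T}|lborel. ?\<sigma> t) = (LINT t|lborel. p t)"
      unfolding set_lebesgue_integral_def p_def by simp
    have "(LINT t:{0<..<T}|lborel. ?\<sigma> (- t)) = (LINT t|lborel. m (0 - t))"
      unfolding set_lebesgue_integral_def m_def
      by (intro Bochner_Integration.integral_cong) (auto simp: indicator_def)
    then show "(LINT t:{0<..<T}|lborel. ?\<sigma> (- t)) = (LINT t|lborel. m t)"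
      using lborel_integral_translate(2)[of m 0] by simp
  qed
qed

lemma slab_integral:
  fixes H :: "'a::euclidean_space \<Rightarrow> real"
  assumes H: "integrable lborel H" and T: "T > 0"
  shows "set_integrable lborel (Q T) (\<lambda>p. H (fst p))"
    "(LINT p:Q T|lborel. H (fst p)) = T * (LINT x|lborel. H x)"
proof -
  have [measurable]: "H \<in> borel_measurable borel" using borel_measurable_integrable[OF H] by simp
  have time: "(\<integral>\<^sup>+t. ennreal \<bar>indicator {0<..<T} t\<bar> \<partial>lborel) \<le> ennreal T"
  proof -
    have "(\<integral>\<^sup>+t. ennreal \<bar>indicator {0<..<T} t\<bar> \<partial>lborel) = (\<integral>\<^sup>+t. indicator {0<..<T} t \<partial>lborel)"
      by (intro nn_integral_cong) (simp add: ennreal_indicator)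
    then show ?thesis using T by simp
  qed
  have i: "integrable lborel (\<lambda>p::'a \<times> real. H (fst p) * indicator {0<..<T} (snd p))"
    by (rule integrable_kernel_fst[OF H, of _ T]) (use time in auto)
  then show "set_integrable lborel (Q T) (\<lambda>p. H (fst p))"
    by (simp add: set_integrable_def mult.commute)
  show "(LINT p:Q T|lborel. H (fst p)) = T * (LINT x|lborel. H x)"
    using lborel_Fubini(1)[OF i] T by (simp add: set_lebesgue_integral_def mult.commute)
qed

lemma set_integral_tendsto_zero:
  fixes g :: "'a \<Rightarrow> real" and a :: "nat \<Rightarrow> 'a \<Rightarrow> real"
  assumes g: "set_integrable N S g" and G: "\<And>n. set_integrable N S (G n)"
    and eq: "\<And>n z. z \<in> S \<Longrightarrow> G n z = a n z * g z"
    and a: "\<And>n z. z \<in> S \<Longrightarrow> \<bar>a n z\<bar> \<le> 1" "\<And>z. z \<in> S \<Longrightarrow> (\<lambda>n. a n z) \<longlonglongrightarrow> 0"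
  shows "(\<lambda>n. LINT z:S|N. G n z) \<longlonglongrightarrow> 0"
proof -
  have "(\<lambda>n. LINT z|N. indicator S z *\<^sub>R G n z) \<longlonglongrightarrow> (LINT z|N. 0)"
  proof (rule integral_dominated_convergence[where w="\<lambda>z. \<bar>indicator S z *\<^sub>R g z\<bar>"])
    show "integrable N (\<lambda>z. \<bar>indicator S z *\<^sub>R g z\<bar>)"
      using g unfolding set_integrable_def by (rule integrable_abs)
    show "(\<lambda>z. indicator S z *\<^sub>R G n z) \<in> borel_measurable N" for n
      using G[of n] unfolding set_integrable_def by (rule borel_measurable_integrable)
    show "AE z in N. norm (indicator S z *\<^sub>R G n z) \<le> \<bar>indicator S z *\<^sub>R g z\<bar>" for n
    proof (rule AE_I2)
      fix z
      show "norm (indicator S z *\<^sub>R G n z) \<le> \<bar>indicator S z *\<^sub>R g z\<bar>"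
      proof (cases "z \<in> S")
        case True
        then have "\<bar>a n z\<bar> * \<bar>g z\<bar> \<le> 1 * \<bar>g z\<bar>" by (intro mult_right_mono a) auto
        with True show ?thesis by (simp add: eq abs_mult)
      qed simp
    qed
    show "AE z in N. (\<lambda>n. indicator S z *\<^sub>R G n z) \<longlonglongrightarrow> 0"
    proof (rule AE_I2)
      fix z
      show "(\<lambda>n. indicator S z *\<^sub>R G n z) \<longlonglongrightarrow> 0"
      proof (cases "z \<in> S")
        case True
        have "(\<lambda>n. a n z * g z) \<longlonglongrightarrow> 0 * g z" by (intro tendsto_intros a True)
        with True show ?thesis by (simp add: eq)
      qed simp
    qed
  qed simp
  then show ?thesis by (simp add: set_lebesgue_integral_def)
qed

lemma averaging_kernel_rescaled:
  "mollifier_kernel \<theta> \<Longrightarrow> \<epsilon> > 0 \<Longrightarrow> averaging_kernel (rescaled \<theta> \<epsilon>)"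
  by unfold_locales (simp_all add: mollifier_rescaled Cc_infinity_integrable)

lemma averaging_kernel_reflect:
  fixes K :: "'a::euclidean_space \<Rightarrow> real"
  assumes "averaging_kernel K"
  shows "averaging_kernel (\<lambda>z. K (- z))"
proof -
  interpret averaging_kernel K by fact
  show ?thesis
    using lborel_integrable_translate(2)[OF integrable_kernel, of 0] lborel_integral_translate(2)[of K 0]
    by unfold_locales (simp_all add: kernel_nonneg kernel_integral)
qed

lemma mollified_dist_rescaled_BV:
  fixes \<theta> :: "'a::euclidean_space \<Rightarrow> real"
  assumes \<theta>: "mollifier_kernel \<theta>" "\<epsilon> > 0" and g: "integrable lborel g" "total_variation g < \<infinity>"
  shows "mollified_dist (rescaled \<theta> \<epsilon>) g g \<le> \<epsilon> * (LINT x|lborel. norm x * \<theta> x) * BV_seminorm g"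
proof -
  interpret averaging_kernel "rescaled \<theta> \<epsilon>" using \<theta> by (rule averaging_kernel_rescaled)
  have "continuous_on UNIV (\<lambda>x. norm x * rescaled \<theta> \<epsilon> x)"
    by (intro continuous_intros Cc_infinity_continuous mollifier_rescaled[OF \<theta>])
  then have "integrable lborel (\<lambda>x. norm x * rescaled \<theta> \<epsilon> x)"
    by (rule integrable_continuous_vanishing[where R=\<epsilon>]) (use mollifier_rescaled(4)[OF \<theta>] in auto)
  from mollified_dist_BV[OF g this] show ?thesis by (simp add: mollifier_rescaled(5)[OF \<theta>])
qed

section \<open>Attainment of the initial value\<close>

text \<open>For positive times the derivative is minus a unit mass concentrated in
  \<open>(0, h)\<close>. The time term is then minus an average over the first instants, while the
  value 1 at time 0 keeps the initial term intact.\<close>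

lemma initial_cutoff:
  fixes \<theta> :: "real \<Rightarrow> real"
  assumes \<theta>: "mollifier_kernel \<theta>" and h: "0 < h" "h \<le> T"
  obtains \<sigma> where "\<sigma> \<in> Cc_infinity" "\<And>s. \<sigma> s \<ge> 0" "\<And>s. \<sigma> s \<le> 1" "\<sigma> 0 = 1" "\<And>s. s \<ge> h \<Longrightarrow> \<sigma> s = 0"
    "\<And>s. s > 0 \<Longrightarrow> deriv \<sigma> s = - rescaled \<theta> (h / 2) (s - h / 2)"
proof -
  obtain F :: "real \<Rightarrow> real" where F: "\<And>x. (F has_real_derivative \<theta> x) (at x)" "\<And>x. x \<le> -1 \<Longrightarrow> F x = 0"
    "\<And>x. x \<ge> 1 \<Longrightarrow> F x = 1" "\<And>x. 0 \<le> F x" "\<And>x. F x \<le> 1" "\<And>k. Ck k F"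
    using mollifier_antiderivative[OF \<theta>] by blast
  \<comment> \<open>The first step rises between \<open>-3\<close> and \<open>-1\<close>, away from
    the times that matter, and provides compact support on the left. The second rises between 0 and
    \<open>h\<close> and brings the cutoff down to 0.\<close>
  define \<sigma> where "\<sigma> s = F (2 + 1 * s) - F (- 1 + 2 / h * s)" for s
  have pos: "\<sigma> s = 1 - F (- 1 + 2 / h * s)" if "s \<ge> 0" for s using that F(3) by (simp add: \<sigma>_def)
  have neg: "\<sigma> s = F (2 + 1 * s)" if "s < 0" for s
  proof -
    have "2 / h * s \<le> 0" using that h by (simp add: divide_simps mult_nonneg_nonpos)
    then show ?thesis using F(2) by (simp add: \<sigma>_def)
  qed
  have late: "F (- 1 + 2 / h * s) = 1" if "s \<ge> h" for s
    by (rule F(3)) (use that h in \<open>simp add: field_simps\<close>)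
  show ?thesis
  proof (rule that)
    show "\<sigma> \<in> Cc_infinity"
      unfolding \<sigma>_def
    proof (rule Cc_infinity_diff[of _ _ "3 + h"])
      show "F (2 + 1 * s) = F (- 1 + 2 / h * s)" if "3 + h < norm s" for s
      proof (cases "s \<ge> 0")
        case True
        then show ?thesis using that h late[of s] F(3)[of "2 + 1 * s"] by simp
      next
        case False
        then show ?thesis using that h neg[of s] F(2)[of "2 + 1 * s"] by (simp add: \<sigma>_def)
      qed
    qed (intro Ck_real_affine F)+
    show "\<sigma> s \<ge> 0" "\<sigma> s \<le> 1" for s
      using pos[of s] neg[of s] F(4,5) by (cases "s \<ge> 0"; simp)+
    show "\<sigma> 0 = 1" using pos[of 0] F(2)[of "-1"] by simp
    show "\<sigma> s = 0" if "s \<ge> h" for s using that h pos[of s] late[of s] by simp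
    show "deriv \<sigma> s = - rescaled \<theta> (h / 2) (s - h / 2)" if "s > 0" for s
    proof -
      have "deriv \<sigma> s = \<theta> (2 + 1 * s) - 2 / h * \<theta> (- 1 + 2 / h * s)"
      proof (rule DERIV_imp_deriv)
        have "((\<lambda>s. F (c + n * s)) has_real_derivative \<theta> (c + n * s) * n) (at s)" for c n
          by (rule DERIV_chain2[OF F(1)]) (auto intro!: derivative_eq_intros)
        from DERIV_diff[OF this[of 2 1] this[of "-1" "2 / h"]]
        show "(\<sigma> has_real_derivative \<theta> (2 + 1 * s) - 2 / h * \<theta> (- 1 + 2 / h * s)) (at s)"
          unfolding \<sigma>_def[abs_def] by (simp add: mult.commute)
      qed
      moreover have "\<theta> (2 + 1 * s) = 0" using that by (intro mollifier_kernel_vanishes[OF \<theta>]) simp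
      moreover have "- 1 + 2 / h * s = (s - h / 2) /\<^sub>R (h / 2)" using h by (simp add: field_simps)
      ultimately show ?thesis using h by (simp add: rescaled_def)
    qed
  qed
qed

text \<open>Measurability of \<open>u\<close> is known only on \<open>Q T\<close>. Extension by zero
  gives a Borel function on the whole space-time, as product measures and shifts require.\<close>

definition cut :: "real \<Rightarrow> ('a \<times> real \<Rightarrow> real) \<Rightarrow> 'a \<times> real \<Rightarrow> real" where
  "cut T u p = indicator {0<..<T} (snd p) * u p"

lemma cut_eq: "p \<in> Q T \<Longrightarrow> cut T u p = u p" for u :: "'a::euclidean_space \<times> real \<Rightarrow> real"
  by (simp add: cut_def mem_Q)

lemma cut_integrable:
  fixes u :: "'a::euclidean_space \<times> real \<Rightarrow> real"
  shows "set_integrable lborel (Q T) u \<Longrightarrow> integrable lborel (cut T u)"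
  by (simp add: set_integrable_def cut_def[abs_def])

lemma cut_slice: "t \<in> {0<..<T} \<Longrightarrow> (\<lambda>x. cut T u (x, t)) = (\<lambda>x. u (x, t))"
  by (simp add: cut_def)

context doubling
begin

text \<open>The comparison function is \<open>u0\<close> at every time and the cutoff depends on
  \<open>s\<close> alone (\<open>c = 0\<close>), so \<open>t\<close> is a dummy variable that
  contributes a factor \<open>T\<close> everywhere. As the cutoff shrinks, the spatial terms vanish
  and only the average near time 0 and the initial term survive.\<close>

lemma initial_mollified_dist_le:
  assumes \<theta>: "mollifier_kernel (\<theta> :: real \<Rightarrow> real)"
    and u: "entropy_solution T f A \<mu> u0 u" and u0: "integrable lborel u0"
    and K: "K \<in> Cc_infinity" "averaging_kernel K"
  shows "mollified_dist K (\<lambda>x. u (x, 0)) u0 \<le> mollified_dist K u0 u0"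
proof (rule field_le_epsilon)
  fix e :: real assume e: "e > 0"
  interpret averaging_kernel K by fact
  have Lc: "Linf_C_L1 T u" using u by (simp add: entropy_solution_def)
  have ui: "integrable lborel (\<lambda>x. u (x, t))" if "t \<in> {0..T}" for t
    using Linf_C_L1_integrable[OF Lc that] .
  define U where "U = cut T u"
  define V where "V = cut T (\<lambda>p. u0 (fst p))"
  have U: "integrable lborel U" "\<And>p. p \<in> Q T \<Longrightarrow> U p = u p"
    unfolding U_def by (intro cut_integrable Linf_C_L1_set_integrable[OF Lc]) (rule cut_eq)
  have Ut: "integrable lborel (\<lambda>x. U (x, t))" if "t \<in> {0<..<T}" for t
    using that ui[of t] by (simp add: U_def cut_slice)
  have V: "integrable lborel V"
    unfolding V_def by (intro cut_integrable slab_integral u0 T_pos)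
  have Vt: "(\<lambda>x. V (x, t)) = u0" if "t \<in> {0<..<T}" for t
    using that by (simp add: V_def cut_slice)
  \<comment> \<open>\<open>h n \<le> T\<close> makes the cutoff vanish at \<open>T\<close>, which
    removes the terminal boundary term.\<close>
  define h where "h n = T / real (Suc n)" for n
  have h: "0 < h n" "h n \<le> T" for n
    using T_pos by (auto simp: h_def divide_simps)
  have h0: "h \<longlonglongrightarrow> 0"
    using tendsto_mult_left[OF LIMSEQ_inverse_real_of_nat, of T] by (simp add: h_def[abs_def] divide_inverse)
  have "\<exists>\<sigma>. \<sigma> \<in> Cc_infinity \<and> (\<forall>s. \<sigma> s \<ge> 0) \<and> (\<forall>s. \<sigma> s \<le> 1) \<and> \<sigma> 0 = 1 \<and> (\<forall>s. s \<ge> h n \<longrightarrow> \<sigma> s = 0)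
      \<and> (\<forall>s. s > 0 \<longrightarrow> deriv \<sigma> s = - rescaled \<theta> (h n / 2) (s - h n / 2))" for n
    by (rule initial_cutoff[OF \<theta> h]) blast
  then obtain \<sigma> where \<sigma>: "\<And>n. \<sigma> n \<in> Cc_infinity" "\<And>n s. \<sigma> n s \<ge> 0" "\<And>n s. \<sigma> n s \<le> 1" "\<And>n. \<sigma> n 0 = 1"
    "\<And>n s. s \<ge> h n \<Longrightarrow> \<sigma> n s = 0" "\<And>n s. s > 0 \<Longrightarrow> deriv (\<sigma> n) s = - rescaled \<theta> (h n / 2) (s - h n / 2)"
    by metis
  \<comment> \<open>One fixed radius suffices: with the cutoff all spatial terms tend to 0, so no
    limit in \<open>r\<close> is taken here.\<close>
  let ?b = "levy_drift (dual \<mu>) 1"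
  have st: "doubled_integrable T (flux_term ?b U V \<tau> 0 K)
    \<and> doubled_integrable T (small_term 1 U V \<tau> 0 K)
    \<and> doubled_integrable T (large_term 1 U V \<tau> 0 K)"
    if "\<tau> \<in> borel_measurable borel" "\<And>s. \<bar>\<tau> s\<bar> \<le> 1" for \<tau> :: "real \<Rightarrow> real"
    using space_terms_integrable[OF U(1) V K(1) _ that, of 1] by simp
  \<comment> \<open>Each spatial integrand is the cutoff at \<open>s\<close> times the integrand
    with weight 1; the latter is the majorant for dominated convergence.\<close>
  have st1: "doubled_integrable T (flux_term ?b U V (\<lambda>_. 1) 0 K)
    \<and> doubled_integrable T (small_term 1 U V (\<lambda>_. 1) 0 K)
    \<and> doubled_integrable T (large_term 1 U V (\<lambda>_. 1) 0 K)"
    by (rule st) auto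
  have stn: "doubled_integrable T (flux_term ?b U V (\<sigma> n) 0 K)
    \<and> doubled_integrable T (small_term 1 U V (\<sigma> n) 0 K)
    \<and> doubled_integrable T (large_term 1 U V (\<sigma> n) 0 K)" for n
    by (rule st[OF Cc_infinity_borel[OF \<sigma>(1)]]) (use \<sigma>(2,3) in simp)
  have lim\<sigma>: "(\<lambda>n. \<sigma> n (snd (snd z))) \<longlonglongrightarrow> 0" if "z \<in> Q T \<times> Q T" for z :: "('a \<times> real) \<times> ('a \<times> real)"
  proof (rule tendsto_eventually)
    have "0 < snd (snd z)" using that by (auto simp: mem_Q mem_Times_iff)
    from order_tendstoD(2)[OF h0 this]
    show "\<forall>\<^sub>F n in sequentially. \<sigma> n (snd (snd z)) = 0"
      by eventually_elim (simp add: \<sigma>(5))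
  qed
  have abs\<sigma>: "\<bar>\<sigma> n s\<bar> \<le> 1" for n s using \<sigma>(2,3)[of n s] by simp
  have lim0: "(\<lambda>n. LINT z:Q T \<times> Q T|lborel. G (\<sigma> n) z) \<longlonglongrightarrow> 0"
    if "doubled_integrable T (G (\<lambda>_. 1))" "\<And>n. doubled_integrable T (G (\<sigma> n))"
      "\<And>\<tau> z. G \<tau> z = \<tau> (snd (snd z)) * G (\<lambda>_. 1) z" for G :: "(real \<Rightarrow> real) \<Rightarrow> ('a \<times> real) \<times> ('a \<times> real) \<Rightarrow> real"
  proof (rule set_integral_tendsto_zero[where a="\<lambda>n z. \<sigma> n (snd (snd z))", OF that(1,2)])
    show "G (\<sigma> n) z = \<sigma> n (snd (snd z)) * G (\<lambda>_. 1) z" for n z by (rule that(3))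
  qed (rule abs\<sigma>, erule lim\<sigma>)
  have lims: "(\<lambda>n. doubled_integral T (flux_term ?b U V (\<sigma> n) 0 K)) \<longlonglongrightarrow> 0"
    "(\<lambda>n. doubled_integral T (small_term 1 U V (\<sigma> n) 0 K)) \<longlonglongrightarrow> 0"
    "(\<lambda>n. doubled_integral T (large_term 1 U V (\<sigma> n) 0 K)) \<longlonglongrightarrow> 0"
  proof -
    show "(\<lambda>n. doubled_integral T (flux_term ?b U V (\<sigma> n) 0 K)) \<longlonglongrightarrow> 0"
      by (rule lim0[where G="\<lambda>\<tau>. flux_term ?b U V \<tau> 0 K", OF conjunct1[OF st1] conjunct1[OF stn]])
        (simp add: flux_term_def)
    show "(\<lambda>n. doubled_integral T (small_term 1 U V (\<sigma> n) 0 K)) \<longlonglongrightarrow> 0"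
      by (rule lim0[where G="\<lambda>\<tau>. small_term 1 U V \<tau> 0 K", OF conjunct1[OF conjunct2[OF st1]] conjunct1[OF conjunct2[OF stn]]])
        (simp add: small_term_def)
    show "(\<lambda>n. doubled_integral T (large_term 1 U V (\<sigma> n) 0 K)) \<longlonglongrightarrow> 0"
      by (rule lim0[where G="\<lambda>\<tau>. large_term 1 U V \<tau> 0 K", OF conjunct2[OF conjunct2[OF st1]] conjunct2[OF conjunct2[OF stn]]])
        (simp add: large_term_def)
  qed
  obtain \<delta> where \<delta>: "\<delta> > 0"
    "\<And>t s. t \<in> {0..T} \<Longrightarrow> s \<in> {0..T} \<Longrightarrow> \<bar>t - s\<bar> \<le> \<delta> \<Longrightarrow> L1_norm (\<lambda>x. u (x, t) - u (x, s)) < e"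
    using Linf_C_L1_uniformly_continuous[OF Lc e] by blast
  let ?m0 = "mollified_dist K (\<lambda>x. u (x, 0)) u0"
  have time: "doubled_integral T (time_term U V (\<sigma> n) 0 K) \<le> - T * (?m0 - e)" if n: "h n \<le> \<delta>" for n
  proof -
    define \<rho> where "\<rho> s = rescaled \<theta> (h n / 2) (s - h n / 2)" for s
    have h2: "h n / 2 > 0" using h[of n] by simp
    note R = mollifier_rescaled[OF \<theta> h2]
    obtain M where M: "M \<ge> 0" "\<And>x. \<bar>rescaled \<theta> (h n / 2) x\<bar> \<le> M" using Cc_infinity_bounded[OF R(1)] by blast
    obtain N where N: "N \<ge> 0" "\<And>x. \<bar>K x\<bar> \<le> N" using Cc_infinity_bounded[OF K(1)] by blast
    have [measurable]: "rescaled \<theta> (h n / 2) \<in> borel_measurable borel" by (rule Cc_infinity_borel[OF R(1)])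
    have \<rho>m[measurable]: "\<rho> \<in> borel_measurable borel" unfolding \<rho>_def by measurable
    have [measurable]: "u0 \<in> borel_measurable borel" using borel_measurable_integrable[OF u0] by simp
    have \<rho>M: "\<bar>\<rho> s\<bar> \<le> M" for s by (simp add: \<rho>_def M)
    \<comment> \<open>\<open>slice_Fubini\<close> puts the time-dependent function in the first
      variable. Here this function is \<open>U\<close>, the second one, so the kernel appears
      reflected until \<open>mollified_dist_swap\<close> undoes it.\<close>
    have K': "integrable lborel (\<lambda>z. K (- z))"
      using averaging_kernel.integrable_kernel[OF averaging_kernel_reflect[OF K(2)]] .
    note S = slice_Fubini[OF U(1) Ut u0 K' T_pos \<rho>m \<rho>M]
    have "doubled_integral T (time_term U V (\<sigma> n) 0 K)
        = (LINT q:Q T|lborel. LINT p:Q T|lborel. time_term U V (\<sigma> n) 0 K (p, q))"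
      by (rule set_Fubini(3)[symmetric], rule time_term_integrable[OF U(1) V K(1), of 1]) (simp_all add: \<sigma>)
    also have "\<dots> = (LINT q:Q T|lborel. - T * (LINT x|lborel. \<bar>u0 x - U q\<bar> * (\<rho> (snd q) * K (- (fst q - x)))))"
    proof (rule set_lebesgue_integral_cong, goal_cases)
      case 2
      show ?case
      proof (intro allI impI)
        fix q :: "'a \<times> real" assume q: "q \<in> Q T"
        define H where "H x = \<bar>u0 x - U q\<bar> * (\<rho> (snd q) * K (x - fst q))" for x
        have Kq: "integrable lborel (\<lambda>x. K (x - fst q))"
          using lborel_integrable_translate(1)[OF integrable_kernel, of "- fst q"] by simp
        have H: "integrable lborel H"
        proof (rule Bochner_Integration.integrable_bound)
          show "integrable lborel (\<lambda>x. M * N * \<bar>u0 x\<bar> + M * \<bar>U q\<bar> * \<bar>K (x - fst q)\<bar>)"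
            using u0 Kq by simp
          show "H \<in> borel_measurable lborel" unfolding H_def by measurable
          have "\<bar>H x\<bar> \<le> M * N * \<bar>u0 x\<bar> + M * \<bar>U q\<bar> * \<bar>K (x - fst q)\<bar>" for x
          proof -
            have "\<bar>H x\<bar> = \<bar>u0 x - U q\<bar> * (\<bar>\<rho> (snd q)\<bar> * \<bar>K (x - fst q)\<bar>)" by (simp add: H_def abs_mult)
            also have "\<dots> \<le> (\<bar>u0 x\<bar> + \<bar>U q\<bar>) * (M * \<bar>K (x - fst q)\<bar>)"
              using \<rho>M by (intro mult_mono mult_right_mono) auto
            also have "\<dots> = M * \<bar>K (x - fst q)\<bar> * \<bar>u0 x\<bar> + M * \<bar>U q\<bar> * \<bar>K (x - fst q)\<bar>"
              by (simp add: algebra_simps)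
            also have "\<dots> \<le> M * N * \<bar>u0 x\<bar> + M * \<bar>U q\<bar> * \<bar>K (x - fst q)\<bar>"
              using N M by (intro add_right_mono mult_right_mono mult_left_mono) auto
            finally show ?thesis .
          qed
          then show "AE x in lborel. norm (H x) \<le> norm (M * N * \<bar>u0 x\<bar> + M * \<bar>U q\<bar> * \<bar>K (x - fst q)\<bar>)"
            by (intro AE_I2) (metis abs_ge_self order_trans real_norm_def)
        qed
        \<comment> \<open>With \<open>c = 0\<close> and \<open>V\<close> constant in time on
          \<open>Q T\<close> the integrand is independent of \<open>t\<close>; the slab integral
          gives the factor \<open>T\<close>.\<close>
        have "(LINT p:Q T|lborel. time_term U V (\<sigma> n) 0 K (p, q)) = (LINT p:Q T|lborel. - H (fst p))"
        proof (rule set_lebesgue_integral_cong, goal_cases)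
          case 2
          show ?case
            using q by (auto simp: time_term_def H_def V_def cut_eq \<sigma>(6) \<rho>_def mem_Q abs_minus_commute)
        qed simp
        also have "\<dots> = - (T * (LINT x|lborel. H x))"
          unfolding slab_integral(2)[OF H T_pos, symmetric] by (simp add: set_lebesgue_integral_def)
        finally show "(LINT p:Q T|lborel. time_term U V (\<sigma> n) 0 K (p, q))
            = - T * (LINT x|lborel. \<bar>u0 x - U q\<bar> * (\<rho> (snd q) * K (- (fst q - x))))"
          by (simp add: H_def[abs_def])
      qed
    qed simp
    also have "\<dots> = - T * (LINT q:Q T|lborel. (LINT x|lborel. \<bar>u0 x - U q\<bar> * (\<rho> (snd q) * K (- (fst q - x)))))"
      by (rule set_integral_mult_right)
    also have "(LINT q:Q T|lborel. (LINT x|lborel. \<bar>u0 x - U q\<bar> * (\<rho> (snd q) * K (- (fst q - x)))))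
        = (LINT s:{0<..<T}|lborel. \<rho> s * mollified_dist (\<lambda>z. K (- z)) u0 (\<lambda>x. U (x, s)))"
      by (rule S(4))
    also have "- T * \<dots> \<le> - T * (?m0 - e)"
    proof -
      have \<rho>i: "integrable lborel \<rho>"
        using lborel_integrable_translate(1)[OF Cc_infinity_integrable[OF R(1)], of "- (h n / 2)"]
        by (simp add: \<rho>_def[abs_def])
      have \<rho>0: "\<rho> s = 0" if "s \<notin> {0<..<h n}" for s
        unfolding \<rho>_def by (rule R(4)) (use that h(1)[of n] in \<open>auto simp: abs_if field_simps\<close>)
      have "(LINT s:{0<..<T}|lborel. \<rho> s) = (LINT s|lborel. \<rho> s)"
        unfolding set_lebesgue_integral_def
      proof (rule Bochner_Integration.integral_cong)
        show "indicator {0<..<T} s *\<^sub>R \<rho> s = \<rho> s" for s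
          using \<rho>0[of s] h[of n] by (cases "s \<in> {0<..<h n}") auto
      qed simp
      also have "\<dots> = 1"
        using lborel_integral_translate(1)[of "rescaled \<theta> (h n / 2)" "- (h n / 2)"] R(3) by (simp add: \<rho>_def[abs_def])
      finally have one: "(LINT s:{0<..<T}|lborel. \<rho> s) = 1" .
      have "(LINT s:{0<..<T}|lborel. \<rho> s) * (?m0 - e)
          \<le> (LINT s:{0<..<T}|lborel. \<rho> s * mollified_dist (\<lambda>z. K (- z)) u0 (\<lambda>x. U (x, s)))"
      proof (rule weighted_average_bounds(1)[OF _ _ S(5)])
        show "set_integrable lborel {0<..<T} \<rho>"
          unfolding set_integrable_def by (rule integrable_mult_indicator[OF _ \<rho>i]) simp
        show "\<rho> t \<ge> 0" for t by (simp add: \<rho>_def R(2))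
        fix s assume s: "s \<in> {0<..<T}" and "\<rho> s \<noteq> 0"
        then have "s < h n" using \<rho>0[of s] by force
        then have "L1_norm (\<lambda>x. u (x, 0) - u (x, s)) < e" using s n T_pos by (intro \<delta>) auto
        moreover have "?m0 \<le> mollified_dist K (\<lambda>x. u (x, s)) u0 + L1_norm (\<lambda>x. u (x, 0) - u (x, s)) + L1_norm (\<lambda>x. u0 x - u0 x)"
          by (rule mollified_dist_le) (use ui[of 0] ui[of s] s T_pos u0 in auto)
        moreover have "mollified_dist (\<lambda>z. K (- z)) u0 (\<lambda>x. U (x, s)) = mollified_dist K (\<lambda>x. u (x, s)) u0"
          using mollified_dist_swap[OF Ut[OF s] u0 integrable_kernel] s by (simp add: U_def cut_slice)
        ultimately show "?m0 - e \<le> mollified_dist (\<lambda>z. K (- z)) u0 (\<lambda>x. U (x, s))" by simp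
      qed
      then show ?thesis using T_pos by (simp add: one)
    qed
    finally show ?thesis .
  qed
  let ?rhs = "\<lambda>n. - doubled_integral T (flux_term ?b U V (\<sigma> n) 0 K)
      + doubled_integral T (small_term 1 U V (\<sigma> n) 0 K)
      + doubled_integral T (large_term 1 U V (\<sigma> n) 0 K) + T * mollified_dist K u0 u0"
  have ineq: "T * (?m0 - e) \<le> ?rhs n" if n: "h n \<le> \<delta>" for n
  proof -
    have "(LINT t:{0<..<T}|lborel. mollified_dist K u0 (\<lambda>x. V (x, t))) = (LINT t:{0<..<T}|lborel. mollified_dist K u0 u0)"
      by (rule set_lebesgue_integral_cong) (auto simp: Vt)
    also have "\<dots> = T * mollified_dist K u0 u0" using T_pos by (simp add: set_lebesgue_integral_def)
    finally have "(LINT t:{0<..<T}|lborel. mollified_dist K u0 (\<lambda>x. V (x, t))) = T * mollified_dist K u0 u0" .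
    moreover have "\<sigma> n T = 0" by (rule \<sigma>(5)[OF h(2)])
    ultimately show ?thesis
      using doubled_entropy_inequality[OF u u0 U V _ K(1) kernel_nonneg \<sigma>(1)[of n] \<sigma>(2)[of n], of 1 0] time[OF n] u0 Vt
      by (simp add: \<sigma>(4) set_lebesgue_integral_def[of lborel "{0<..<T}" "\<lambda>_. 0"])
  qed
  have "T * (?m0 - e) \<le> - 0 + 0 + 0 + T * mollified_dist K u0 u0"
  proof (rule tendsto_lowerbound)
    show "?rhs \<longlonglongrightarrow> - 0 + 0 + 0 + T * mollified_dist K u0 u0"
      by (intro tendsto_intros lims)
    from order_tendstoD(2)[OF h0 \<delta>(1)]
    show "\<forall>\<^sub>F n in sequentially. T * (?m0 - e) \<le> ?rhs n"
      by eventually_elim (rule ineq, simp)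
  qed simp
  then show "?m0 \<le> mollified_dist K u0 u0 + e" using T_pos by simp
qed

text \<open>The L^1 distance is at most twice \<open>mollified_dist K u0 u0\<close> for every
  rescaled kernel. Bounded variation of \<open>u0\<close> makes this of order \<epsilon>, and here,
  unlike in the theorem, \<epsilon> may tend to 0.\<close>

lemma initial_value:
  assumes \<theta>: "mollifier_kernel (\<theta> :: real \<Rightarrow> real)" "mollifier_kernel (\<theta>d :: 'a \<Rightarrow> real)"
    and u: "entropy_solution T f A \<mu> u0 u" and u0: "integrable lborel u0" "total_variation u0 < \<infinity>"
  shows "L1_norm (\<lambda>x. u (x, 0) - u0 x) = 0"
proof -
  have Lc: "Linf_C_L1 T u" using u by (simp add: entropy_solution_def)
  have ui: "integrable lborel (\<lambda>x. u (x, 0))" using Linf_C_L1_integrable[OF Lc, of 0] T_pos by simp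
  define c where "c = 2 * ((LINT x|lborel. norm x * \<theta>d x) * BV_seminorm u0)"
  have le: "L1_norm (\<lambda>x. u (x, 0) - u0 x) \<le> \<epsilon> * c" if \<epsilon>: "\<epsilon> > 0" for \<epsilon>
  proof -
    let ?K = "rescaled \<theta>d \<epsilon>"
    interpret averaging_kernel ?K by (rule averaging_kernel_rescaled[OF \<theta>(2) \<epsilon>])
    have "L1_norm (\<lambda>x. u (x, 0) - u0 x) \<le> mollified_dist ?K (\<lambda>x. u (x, 0)) u0 + mollified_dist ?K u0 u0"
      by (rule L1_norm_le_mollified_dist(2)[OF ui u0(1)])
    also have "\<dots> \<le> 2 * mollified_dist ?K u0 u0"
      using initial_mollified_dist_le[OF \<theta>(1) u u0(1) mollifier_rescaled(1)[OF \<theta>(2) \<epsilon>] averaging_kernel_axioms] by simp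
    also have "\<dots> \<le> \<epsilon> * c"
      using mollified_dist_rescaled_BV[OF \<theta>(2) \<epsilon> u0] by (simp add: c_def)
    finally show ?thesis .
  qed
  have "L1_norm (\<lambda>x. u (x, 0) - u0 x) \<le> 0"
  proof (rule tendsto_lowerbound)
    show "((\<lambda>\<epsilon>. \<epsilon> * c) \<longlongrightarrow> 0) (at_right 0)" by (auto intro!: tendsto_eq_intros)
    show "\<forall>\<^sub>F \<epsilon> in at_right 0. L1_norm (\<lambda>x. u (x, 0) - u0 x) \<le> \<epsilon> * c"
      using eventually_at_right_less[of 0] by eventually_elim (rule le)
  qed simp
  then show ?thesis by (intro antisym) (auto intro!: integral_nonneg_AE)
qed

end

section \<open>Decay of the mollified oscillation\<close>

lemma set_integral_swap:
  fixes G :: "('a::euclidean_space \<times> 'b::euclidean_space) \<Rightarrow> real"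
  assumes "set_integrable lborel (S \<times> S') G"
  shows "(LINT z:S' \<times> S|lborel. G (snd z, fst z)) = (LINT z:S \<times> S'|lborel. G z)"
    "set_integrable lborel (S' \<times> S) (\<lambda>z. G (snd z, fst z))"
proof -
  have m: "(\<lambda>z. indicator (S \<times> S') z *\<^sub>R G z) \<in> borel_measurable borel"
    using borel_measurable_integrable[OF assms[unfolded set_integrable_def]] by simp
  have eq: "indicator (S \<times> S') (snd z, fst z) *\<^sub>R G (snd z, fst z) = indicator (S' \<times> S) z *\<^sub>R G (snd z, fst z)" for z
    by (auto simp: indicator_def mem_Times_iff)
  show "(LINT z:S' \<times> S|lborel. G (snd z, fst z)) = (LINT z:S \<times> S'|lborel. G z)"
    using lborel_integral_swap[OF m] unfolding eq by (simp add: set_lebesgue_integral_def)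
  show "set_integrable lborel (S' \<times> S) (\<lambda>z. G (snd z, fst z))"
    using lborel_integrable_swap[OF assms[unfolded set_integrable_def]] unfolding eq by (simp add: set_integrable_def)
qed

lemma Cc_infinity_reflect: "K \<in> Cc_infinity \<Longrightarrow> (\<lambda>z. K (- z)) \<in> Cc_infinity"
  for K :: "'a::euclidean_space \<Rightarrow> real"
  using Cc_infinity_compose_affine[of K uminus 1 0] by (simp add: bounded_linear_minus[OF bounded_linear_ident])

lemma deriv_reflect:
  fixes \<sigma> :: "real \<Rightarrow> real"
  assumes "\<sigma> \<in> Cc_infinity"
  shows "deriv (\<lambda>s. \<sigma> (- s)) x = - deriv \<sigma> (- x)"
proof (rule DERIV_imp_deriv)
  have "((\<lambda>s::real. - s) has_real_derivative - 1) (at x)" by (auto intro!: derivative_eq_intros)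
  from DERIV_chain2[OF Cc_infinity_has_real_derivative[OF assms] this]
  show "((\<lambda>s. \<sigma> (- s)) has_real_derivative - deriv \<sigma> (- x)) (at x)" by simp
qed

lemma grad_reflect_kernel: "K \<in> Cc_infinity \<Longrightarrow> grad (\<lambda>z. K (- z)) w = - grad K (- w)"
  for K :: "'a::euclidean_space \<Rightarrow> real"
  using grad_reflect[of K 1 0 w] by simp

context doubling
begin

text \<open>The small-jump kernels live in one fixed ball for all radii at most 1 and are bounded by
  the vanishing mass of the annulus, so a single integrable majorant times that mass bounds the
  doubled integral.\<close>

lemma small_term_tendsto:
  assumes U: "integrable lborel U" and V: "integrable lborel V" and K: "K \<in> Cc_infinity" and \<sigma>: "\<sigma> \<in> Cc_infinity"
  shows "(\<lambda>n. doubled_integral T (small_term (1 / real (Suc n)) U V \<sigma> c K)) \<longlonglongrightarrow> 0"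
proof -
  note \<mu>d = dual_properties[OF levy]
  obtain S where S: "S \<ge> 0" "\<And>x. \<bar>\<sigma> x\<bar> \<le> S" using Cc_infinity_bounded[OF \<sigma>] by blast
  define m where "m n = (LINT z:annulus (1 / real (Suc n))|dual \<mu>. min ((norm z)\<^sup>2) 1)" for n
  have m0: "m \<longlonglongrightarrow> 0" unfolding m_def[abs_def] by (rule small_jump_mass_tendsto[OF \<mu>d])
  have mpos: "m n \<ge> 0" for n
    unfolding m_def set_lebesgue_integral_def by (intro integral_nonneg_AE AE_I2) simp
  obtain C where C: "C \<ge> 0" "\<And>w r. \<bar>small_jump (dual \<mu>) r K w\<bar>
      \<le> C * (LINT z:annulus r|dual \<mu>. min ((norm z)\<^sup>2) 1)"
    by (rule small_jump_bound[OF \<mu>d K]) blast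
  obtain R where R: "R \<ge> 0" "\<And>r w. norm w > R + r \<Longrightarrow> small_jump (dual \<mu>) r K w = 0"
    by (rule small_jump_vanishes[OF \<mu>d K]) blast
  \<comment> \<open>The radius is \<open>R + 1\<close> because the radii
    \<open>1 / real (Suc n)\<close> never exceed 1.\<close>
  define J where "J w = C * indicator (cball 0 (R + 1)) w" for w :: 'a
  have J: "integrable lborel J"
    unfolding J_def by (intro integrable_mult_right integrable_real_indicator) (use emeasure_bounded_finite[of "cball (0::'a) (R + 1)"] in auto)
  have Jle: "\<bar>small_jump (dual \<mu>) (1 / real (Suc n)) K w\<bar> \<le> m n * J w" for n w
  proof (cases "norm w \<le> R + 1")
    case True
    then show ?thesis using C(2)[of "1 / real (Suc n)" w] by (simp add: J_def m_def mult.commute)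
  next
    case False
    have "1 / real (Suc n) \<le> 1" by simp
    then have "norm w > R + 1 / real (Suc n)" using False by linarith
    then show ?thesis using R(2) mpos C(1) by (simp add: J_def)
  qed
  define g where "g z = (\<bar>V (fst z)\<bar> + \<bar>U (snd z)\<bar>) * (L * S * J (fst (fst z) - fst (snd z)))"
    for z :: "('a \<times> real) \<times> ('a \<times> real)"
  have [measurable]: "U \<in> borel_measurable borel" "V \<in> borel_measurable borel" "J \<in> borel_measurable borel"
    using U V J by (auto dest: borel_measurable_integrable)
  have gi: "doubled_integrable T g"
  proof (rule integrable_doubling_Q[OF V U _ T_pos, of "\<lambda>w. L * S * J w"])
    show "integrable lborel (\<lambda>w. L * S * J w)" using J by simp
    show "g \<in> borel_measurable borel" unfolding g_def by measurable
  qed (simp add: g_def abs_mult)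
  have bound: "\<bar>small_term (1 / real (Suc n)) U V \<sigma> c K z\<bar> \<le> m n * g z" for n z
  proof -
    have "\<bar>A (U (snd z)) - A (V (fst z))\<bar> \<le> L * (\<bar>V (fst z)\<bar> + \<bar>U (snd z)\<bar>)"
      by (rule order_trans[OF A_Lipschitz]) (intro mult_left_mono, auto simp: L_nonneg)
    then have "\<bar>small_term (1 / real (Suc n)) U V \<sigma> c K z\<bar>
        \<le> (L * (\<bar>V (fst z)\<bar> + \<bar>U (snd z)\<bar>)) * (S * (m n * J (fst (fst z) - fst (snd z))))"
      unfolding small_term_def abs_mult using S L_nonneg Jle by (intro mult_mono) auto
    then show ?thesis by (simp add: g_def mult_ac)
  qed
  show ?thesis
  proof (rule Lim_null_comparison)
    show "(\<lambda>n. m n * (LINT z:Q T \<times> Q T|lborel. g z)) \<longlonglongrightarrow> 0"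
      using tendsto_mult_left_zero[OF m0] by blast
    show "\<forall>\<^sub>F n in sequentially. norm (doubled_integral T (small_term (1 / real (Suc n)) U V \<sigma> c K))
        \<le> m n * (LINT z:Q T \<times> Q T|lborel. g z)"
    proof (intro always_eventually allI)
      fix n
      have "norm (doubled_integral T (small_term (1 / real (Suc n)) U V \<sigma> c K))
          \<le> (LINT z|lborel. norm (indicator (Q T \<times> Q T) z *\<^sub>R small_term (1 / real (Suc n)) U V \<sigma> c K z))"
        unfolding set_lebesgue_integral_def by (rule integral_norm_bound)
      also have "\<dots> \<le> (LINT z|lborel. m n * (indicator (Q T \<times> Q T) z *\<^sub>R g z))"
      proof (rule integral_mono_AE')
        show "integrable lborel (\<lambda>z. m n * (indicator (Q T \<times> Q T) z *\<^sub>R g z))"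
          using gi unfolding set_integrable_def by (rule integrable_mult_right)
        show "AE z in lborel. norm (indicator (Q T \<times> Q T) z *\<^sub>R small_term (1 / real (Suc n)) U V \<sigma> c K z)
            \<le> m n * (indicator (Q T \<times> Q T) z *\<^sub>R g z)"
          by (intro AE_I2) (use bound in \<open>auto simp: indicator_def\<close>)
        show "AE z in lborel. 0 \<le> m n * (indicator (Q T \<times> Q T) z *\<^sub>R g z)"
          by (intro AE_I2) (use order_trans[OF abs_ge_zero bound] in \<open>auto simp: indicator_def\<close>)
      qed
      finally show "norm (doubled_integral T (small_term (1 / real (Suc n)) U V \<sigma> c K))
          \<le> m n * (LINT z:Q T \<times> Q T|lborel. g z)"
        by (simp add: set_lebesgue_integral_def)
    qed
  qed
qed

text \<open>The nonlocal terms of the two inequalities add up to at most the difference between the integral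
  of \<open>\<bar>A (u q) - A (u p)\<bar> \<phi>\<close> after and before the common shift \<open>(p, q) \<mapsto> (p + z, q + z)\<close>, and \<open>\<phi>\<close>
  is invariant under this shift.\<close>

lemma large_terms_cancel:
  assumes U: "integrable lborel U" and K: "K \<in> Cc_infinity" "\<And>x. K x \<ge> 0"
    and \<sigma>: "\<sigma> \<in> Cc_infinity" "\<And>s. \<sigma> s \<ge> 0" and r: "r > 0"
  shows "doubled_integral T (large_term r U U (\<lambda>s. \<sigma> (- s)) 1 K)
      + doubled_integral T (large_term r U U \<sigma> 1 (\<lambda>x. K (- x))) \<le> 0"
proof -
  let ?\<nu> = "large_jumps \<mu> r"
  interpret \<nu>: finite_measure ?\<nu> by (rule finite_large_jumps[OF levy r])
  have sp: "space ?\<nu> = UNIV" using sets_eq_imp_space_eq[OF sets_large_jumps[of \<mu> r]] by simp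
  note \<sigma>' = Cc_infinity_reflect[OF \<sigma>(1)] and K' = Cc_infinity_reflect[OF K(1)]
  obtain S where S: "S \<ge> 0" "\<And>x. \<bar>\<sigma> x\<bar> \<le> S" using Cc_infinity_bounded[OF \<sigma>(1)] by blast
  have [measurable]: "U \<in> borel_measurable borel" "K \<in> borel_measurable borel" "\<sigma> \<in> borel_measurable borel"
    using U by (auto dest: borel_measurable_integrable intro: Cc_infinity_borel K \<sigma>)
  have i1: "doubled_integrable T (large_term r U U (\<lambda>s. \<sigma> (- s)) 1 K)"
    using space_terms_integrable[OF U U K(1) r Cc_infinity_borel[OF \<sigma>'] S(2)] by blast
  have i2: "doubled_integrable T (large_term r U U \<sigma> 1 (\<lambda>x. K (- x)))"
    using space_terms_integrable[OF U U K' r Cc_infinity_borel[OF \<sigma>(1)] S(2)] by blast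
  define \<tau> where "\<tau> z = \<sigma> (snd (fst z) - snd (snd z)) * K (fst (fst z) - fst (snd z))"
    for z :: "('a \<times> real) \<times> ('a \<times> real)"
  have \<tau>0: "\<tau> z \<ge> 0" for z by (simp add: \<tau>_def K \<sigma>)
  define G where "G z = indicator (Q T \<times> Q T) z * (\<bar>A (U (snd z)) - A (U (fst z))\<bar> * \<tau> z)" for z
  define s where "s z = ((z, 0::real), (z, 0::real))" for z :: 'a
  have sm: "s \<in> borel_measurable borel"
    unfolding s_def by measurable
  have G: "integrable lborel G"
  proof -
    have "doubled_integrable T (\<lambda>z. \<bar>A (U (snd z)) - A (U (fst z))\<bar> * \<tau> z)"
    proof (rule integrable_doubling_Q[OF U U _ T_pos, of "\<lambda>x. L * S * K x"])
      show "integrable lborel (\<lambda>x. L * S * K x)" using Cc_infinity_integrable[OF K(1)] by simp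
      show "(\<lambda>z. \<bar>A (U (snd z)) - A (U (fst z))\<bar> * \<tau> z) \<in> borel_measurable borel" unfolding \<tau>_def by measurable
      fix p q
      have "\<bar>A (U q) - A (U p)\<bar> \<le> L * (\<bar>U p\<bar> + \<bar>U q\<bar>)"
        by (rule order_trans[OF A_Lipschitz]) (intro mult_left_mono, auto simp: L_nonneg)
      then have "\<bar>A (U q) - A (U p)\<bar> * \<bar>\<tau> (p, q)\<bar> \<le> (L * (\<bar>U p\<bar> + \<bar>U q\<bar>)) * (S * \<bar>K (fst p - fst q)\<bar>)"
        unfolding \<tau>_def abs_mult fst_conv snd_conv using S L_nonneg by (intro mult_mono) auto
      then show "\<bar>\<bar>A (U (snd (p, q))) - A (U (fst (p, q)))\<bar> * \<tau> (p, q)\<bar> \<le> (\<bar>U p\<bar> + \<bar>U q\<bar>) * \<bar>L * S * K (fst p - fst q)\<bar>"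
        using S L_nonneg by (simp add: abs_mult mult_ac)
    qed
    then show ?thesis by (simp add: set_integrable_def G_def[abs_def])
  qed
  note sh = shift_integrable[OF finite_large_jumps[OF levy r] sets_large_jumps G sm]
  have nl: "nonlocal r U q = (LINT z|?\<nu>. A (U (q + (z, 0))) - A (U q))" for q
    by (cases q) (simp add: nonlocal_def)
  have Ai: "integrable ?\<nu> (\<lambda>z. A (U (q + (z, 0))))" for q
    by (rule \<nu>.integrable_const_bound[of _ M]) (use A_bounded in auto)
  \<comment> \<open>Monotonicity of \<open>A\<close> enters here: wherever \<open>A a\<close> and
    \<open>A b\<close> differ, \<open>a - b\<close> has the same sign as
    \<open>A a - A b\<close>.\<close>
  have sgnA: "sgn (a - b) * (A a - A b) = \<bar>A a - A b\<bar>" for a b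
    using monoD[OF A_mono, of a b] monoD[OF A_mono, of b a] by (auto simp: sgn_if)
  have point: "indicator (Q T \<times> Q T) z * (large_term r U U (\<lambda>s. \<sigma> (- s)) 1 K z
      + large_term r U U \<sigma> 1 (\<lambda>x. K (- x)) (snd z, fst z))
      \<le> (LINT y|?\<nu>. G (z + s y)) - measure ?\<nu> UNIV * G z" for z
  proof -
    obtain p q where z: "z = (p, q)" by (cases z)
    \<comment> \<open>A common spatial shift changes neither the times nor \<open>x - y\<close>, so
      the indicator and the weight \<tau> come out unchanged.\<close>
    have shG: "G (z + s y) = indicator (Q T \<times> Q T) z * \<tau> z * \<bar>A (U (q + (y, 0))) - A (U (p + (y, 0)))\<bar>" for y
      by (auto simp: G_def s_def z \<tau>_def indicator_def mem_Q)
    have "large_term r U U (\<lambda>s. \<sigma> (- s)) 1 K z + large_term r U U \<sigma> 1 (\<lambda>x. K (- x)) (snd z, fst z)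
        = \<tau> z * (sgn (U q - U p) * nonlocal r U q + sgn (U p - U q) * nonlocal r U p)"
      by (simp add: large_term_def \<tau>_def z algebra_simps)
    also have "sgn (U p - U q) = - sgn (U q - U p)"
      using sgn_minus[of "U q - U p"] by simp
    also have "sgn (U q - U p) * nonlocal r U q + (- sgn (U q - U p)) * nonlocal r U p
        = (LINT y|?\<nu>. sgn (U q - U p) * (A (U (q + (y, 0))) - A (U (p + (y, 0)))) - \<bar>A (U q) - A (U p)\<bar>)"
    proof -
      have "sgn (U q - U p) * nonlocal r U q + (- sgn (U q - U p)) * nonlocal r U p
          = sgn (U q - U p) * (nonlocal r U q - nonlocal r U p)" by (simp add: algebra_simps)
      also have "nonlocal r U q - nonlocal r U p
          = (LINT y|?\<nu>. (A (U (q + (y, 0))) - A (U q)) - (A (U (p + (y, 0))) - A (U p)))"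
        unfolding nl using Ai by (intro Bochner_Integration.integral_diff[symmetric]) auto
      also have "sgn (U q - U p) * \<dots>
          = (LINT y|?\<nu>. sgn (U q - U p) * ((A (U (q + (y, 0))) - A (U q)) - (A (U (p + (y, 0))) - A (U p))))"
        by (rule integral_mult_right_zero[symmetric])
      also have "\<dots> = (LINT y|?\<nu>. sgn (U q - U p) * (A (U (q + (y, 0))) - A (U (p + (y, 0)))) - \<bar>A (U q) - A (U p)\<bar>)"
        unfolding sgnA[symmetric] by (intro Bochner_Integration.integral_cong) (auto simp: algebra_simps)
      finally show ?thesis .
    qed
    \<comment> \<open>After the jump the sign of \<open>U q - U p\<close> need not match the
      increment of \<open>A\<close>. Replacing the product by the absolute value is the only
      loss.\<close>
    also have "\<dots> \<le> (LINT y|?\<nu>. \<bar>A (U (q + (y, 0))) - A (U (p + (y, 0)))\<bar> - \<bar>A (U q) - A (U p)\<bar>)"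
    proof (rule integral_mono)
      show "sgn (U q - U p) * (A (U (q + (y, 0))) - A (U (p + (y, 0)))) - \<bar>A (U q) - A (U p)\<bar>
          \<le> \<bar>A (U (q + (y, 0))) - A (U (p + (y, 0)))\<bar> - \<bar>A (U q) - A (U p)\<bar>" for y
        by (auto simp: sgn_if)
    qed (use Ai in auto)
    also have "\<dots> = (LINT y|?\<nu>. \<bar>A (U (q + (y, 0))) - A (U (p + (y, 0)))\<bar>) - measure ?\<nu> UNIV * \<bar>A (U q) - A (U p)\<bar>"
      using Ai by (simp add: sp)
    finally have "large_term r U U (\<lambda>s. \<sigma> (- s)) 1 K z + large_term r U U \<sigma> 1 (\<lambda>x. K (- x)) (snd z, fst z)
        \<le> \<tau> z * ((LINT y|?\<nu>. \<bar>A (U (q + (y, 0))) - A (U (p + (y, 0)))\<bar>) - measure ?\<nu> UNIV * \<bar>A (U q) - A (U p)\<bar>)"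
      by (simp add: mult_left_mono \<tau>0)
    then have "indicator (Q T \<times> Q T) z * (large_term r U U (\<lambda>s. \<sigma> (- s)) 1 K z
        + large_term r U U \<sigma> 1 (\<lambda>x. K (- x)) (snd z, fst z))
      \<le> indicator (Q T \<times> Q T) z * (\<tau> z * ((LINT y|?\<nu>. \<bar>A (U (q + (y, 0))) - A (U (p + (y, 0)))\<bar>) - measure ?\<nu> UNIV * \<bar>A (U q) - A (U p)\<bar>))"
      by (rule mult_left_mono) simp
    also have "\<dots> = (LINT y|?\<nu>. G (z + s y)) - measure ?\<nu> UNIV * G z"
      unfolding shG integral_mult_right_zero by (simp add: G_def z algebra_simps)
    finally show ?thesis .
  qed
  have "doubled_integral T (large_term r U U (\<lambda>s. \<sigma> (- s)) 1 K)
      + doubled_integral T (large_term r U U \<sigma> 1 (\<lambda>x. K (- x)))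
    = (LINT z:Q T \<times> Q T|lborel. large_term r U U (\<lambda>s. \<sigma> (- s)) 1 K z
      + large_term r U U \<sigma> 1 (\<lambda>x. K (- x)) (snd z, fst z))"
    using set_integral_swap[OF i2] set_integral_add(2)[OF i1 set_integral_swap(2)[OF i2]] by simp
  also have "\<dots> \<le> (LINT z|lborel. (LINT y|?\<nu>. G (z + s y)) - measure ?\<nu> UNIV * G z)"
    unfolding set_lebesgue_integral_def real_scaleR_def
  proof (rule integral_mono)
    show "integrable lborel (\<lambda>z. indicator (Q T \<times> Q T) z * (large_term r U U (\<lambda>s. \<sigma> (- s)) 1 K z
      + large_term r U U \<sigma> 1 (\<lambda>x. K (- x)) (snd z, fst z)))"
      using set_integral_add(1)[OF i1 set_integral_swap(2)[OF i2]] by (simp add: set_integrable_def)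
  qed (use sh(2) G point in auto)
  \<comment> \<open>By translation invariance on pairs, both parts equal the total jump mass times
    the integral of \<open>G\<close>.\<close>
  also have "\<dots> = 0" using sh(2,3) G by simp
  finally show ?thesis .
qed

text \<open>The second copy of the inequality uses the reflected kernels, which amounts to
  exchanging the two variables. The terms \<open>B1\<close> and \<open>B4\<close> carry the weight
  \<open>a\<close>, \<open>B2\<close> and \<open>B3\<close> the weight \<open>b\<close>; neither
  inequality alone has full mass at either end, but their sum does.\<close>

lemma mollified_dist_self_le:
  assumes \<theta>: "mollifier_kernel (\<theta> :: real \<Rightarrow> real)"
    and u: "entropy_solution T f A \<mu> u0 u" and u0: "integrable lborel u0" "L1_norm (\<lambda>x. u (x, 0) - u0 x) = 0"
    and K: "K \<in> Cc_infinity" "averaging_kernel K"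
  shows "mollified_dist K (\<lambda>x. u (x, T)) (\<lambda>x. u (x, T)) \<le> mollified_dist K u0 u0"
proof (rule field_le_epsilon)
  fix e0 :: real assume "e0 > 0"
  \<comment> \<open>One \<open>e\<close> is lost at each end of the time interval.\<close>
  define e where "e = e0 / 2"
  have e: "e > 0" using \<open>e0 > 0\<close> by (simp add: e_def)
  interpret averaging_kernel K by fact
  interpret K': averaging_kernel "\<lambda>z. K (- z)" by (rule averaging_kernel_reflect[OF K(2)])
  note Kr = Cc_infinity_reflect[OF K(1)]
  have Lc: "Linf_C_L1 T u" using u by (simp add: entropy_solution_def)
  have ui: "integrable lborel (\<lambda>x. u (x, t))" if "t \<in> {0..T}" for t
    using Linf_C_L1_integrable[OF Lc that] .
  have uT: "integrable lborel (\<lambda>x. u (x, T))" using ui[of T] T_pos by simp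
  define U where "U = cut T u"
  have U: "integrable lborel U" "\<And>p. p \<in> Q T \<Longrightarrow> U p = u p"
    unfolding U_def by (intro cut_integrable Linf_C_L1_set_integrable[OF Lc]) (rule cut_eq)
  have Ut: "integrable lborel (\<lambda>x. U (x, t))" if "t \<in> {0<..<T}" for t
    using that ui[of t] by (simp add: U_def cut_slice)
  have Us: "(\<lambda>x. U (x, t)) = (\<lambda>x. u (x, t))" if "t \<in> {0<..<T}" for t
    using that by (simp add: U_def cut_slice)
  obtain d where d: "d > 0"
    "\<And>t s. t \<in> {0..T} \<Longrightarrow> s \<in> {0..T} \<Longrightarrow> \<bar>t - s\<bar> \<le> d \<Longrightarrow> L1_norm (\<lambda>x. u (x, t) - u (x, s)) < e"
    using Linf_C_L1_uniformly_continuous[OF Lc e] by blast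
  \<comment> \<open>At most \<open>d\<close> for the uniform continuity, and at most
    \<open>T / 2\<close> so that \<open>time_weights\<close> applies.\<close>
  define \<delta> where "\<delta> = min d (T / 2)"
  have \<delta>: "0 < \<delta>" "\<delta> < T" "\<delta> \<le> d" using d(1) T_pos by (auto simp: \<delta>_def)
  let ?\<sigma> = "rescaled \<theta> \<delta>"
  note R = mollifier_rescaled[OF \<theta> \<delta>(1)]
  note Rr = Cc_infinity_reflect[OF R(1)]
  obtain S where S: "S \<ge> 0" "\<And>x. \<bar>?\<sigma> x\<bar> \<le> S" using Cc_infinity_bounded[OF R(1)] by blast
  have [measurable]: "?\<sigma> \<in> borel_measurable borel" by (rule Cc_infinity_borel[OF R(1)])
  obtain a b where ab: "a \<ge> 0" "b \<ge> 0" "a + b = 1"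
    "(LINT t:{0<..<T}|lborel. ?\<sigma> (t - T)) = a" "(LINT t:{0<..<T}|lborel. ?\<sigma> (T - t)) = b"
    "(LINT t:{0<..<T}|lborel. ?\<sigma> t) = b" "(LINT t:{0<..<T}|lborel. ?\<sigma> (- t)) = a"
    using time_weights[OF \<theta> \<delta>(1,2)] by blast
  define B1 where "B1 = (LINT t:{0<..<T}|lborel. ?\<sigma> (t - T) * mollified_dist K (\<lambda>x. u (x, T)) (\<lambda>x. U (x, t)))"
  define B2 where "B2 = (LINT t:{0<..<T}|lborel. ?\<sigma> (T - t) * mollified_dist (\<lambda>z. K (- z)) (\<lambda>x. u (x, T)) (\<lambda>x. U (x, t)))"
  define B3 where "B3 = (LINT t:{0<..<T}|lborel. ?\<sigma> t * mollified_dist K u0 (\<lambda>x. U (x, t)))"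
  define B4 where "B4 = (LINT t:{0<..<T}|lborel. ?\<sigma> (- t) * mollified_dist (\<lambda>z. K (- z)) u0 (\<lambda>x. U (x, t)))"
  have ineq: "B1 + B2 - B3 - B4 \<le> doubled_integral T (small_term r U U (\<lambda>s. ?\<sigma> (- s)) 1 K)
      + doubled_integral T (small_term r U U ?\<sigma> 1 (\<lambda>z. K (- z)))" if r: "r > 0" for r
  proof -
    let ?b = "levy_drift (dual \<mu>) r"
    \<comment> \<open>\<open>\<sigma> (t - s)\<close> has opposite derivatives in \<open>t\<close>
      and \<open>s\<close>, so exchanging the variables changes only the sign and the two time terms
      cancel.\<close>
    have swap_time: "time_term U U ?\<sigma> 1 (\<lambda>z. K (- z)) (snd z, fst z) = - time_term U U (\<lambda>s. ?\<sigma> (- s)) 1 K z" for z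
      by (simp add: time_term_def deriv_reflect[OF R(1)] abs_minus_commute)
    have swap_flux: "flux_term ?b U U ?\<sigma> 1 (\<lambda>z. K (- z)) (snd z, fst z) = - flux_term ?b U U (\<lambda>s. ?\<sigma> (- s)) 1 K z" for z
      using flux_sym[of ?b "U (fst z)" "U (snd z)"]
      by (simp add: flux_term_def grad_reflect_kernel[OF K(1)] inner_minus_right)
    have tt: "doubled_integral T (time_term U U ?\<sigma> 1 (\<lambda>z. K (- z)))
        = - doubled_integral T (time_term U U (\<lambda>s. ?\<sigma> (- s)) 1 K)"
      using set_integral_swap(1)[OF time_term_integrable[OF U(1) U(1) Kr r R(1), of 1]]
      unfolding swap_time by (simp add: set_lebesgue_integral_def)
    have "doubled_integrable T (flux_term ?b U U ?\<sigma> 1 (\<lambda>z. K (- z)))"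
      using space_terms_integrable[OF U(1) U(1) Kr r Cc_infinity_borel[OF R(1)] S(2)] by blast
    from set_integral_swap(1)[OF this]
    have ff: "doubled_integral T (flux_term ?b U U ?\<sigma> 1 (\<lambda>z. K (- z)))
        = - doubled_integral T (flux_term ?b U U (\<lambda>s. ?\<sigma> (- s)) 1 K)"
      unfolding swap_flux by (simp add: set_lebesgue_integral_def)
    have I1: "0 \<le> doubled_integral T (time_term U U (\<lambda>s. ?\<sigma> (- s)) 1 K)
        - doubled_integral T (flux_term ?b U U (\<lambda>s. ?\<sigma> (- s)) 1 K)
        + doubled_integral T (small_term r U U (\<lambda>s. ?\<sigma> (- s)) 1 K)
        + doubled_integral T (large_term r U U (\<lambda>s. ?\<sigma> (- s)) 1 K) - B1 + B3"
      using doubled_entropy_inequality[OF u u0(1) U U(1) Ut K(1) kernel_nonneg Rr R(2) r, of 1]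
      by (simp add: B1_def B3_def)
    have I2: "0 \<le> doubled_integral T (time_term U U ?\<sigma> 1 (\<lambda>z. K (- z)))
        - doubled_integral T (flux_term ?b U U ?\<sigma> 1 (\<lambda>z. K (- z)))
        + doubled_integral T (small_term r U U ?\<sigma> 1 (\<lambda>z. K (- z)))
        + doubled_integral T (large_term r U U ?\<sigma> 1 (\<lambda>z. K (- z))) - B2 + B4"
      using doubled_entropy_inequality[OF u u0(1) U U(1) Ut Kr K'.kernel_nonneg R(1,2) r, of 1]
      by (simp add: B2_def B4_def)
    show ?thesis
      using I1 I2 large_terms_cancel[OF U(1) K(1) kernel_nonneg R(1,2) r] unfolding tt ff by linarith
  qed
  \<comment> \<open>The boundary terms do not depend on \<open>r\<close>, so
    \<open>r \<rightarrow> 0\<close> is taken with the time mollification held fixed.\<close>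
  have le0: "B1 + B2 - B3 - B4 \<le> 0 + 0"
  proof (rule tendsto_lowerbound)
    show "(\<lambda>n. doubled_integral T (small_term (1 / real (Suc n)) U U (\<lambda>s. ?\<sigma> (- s)) 1 K)
      + doubled_integral T (small_term (1 / real (Suc n)) U U ?\<sigma> 1 (\<lambda>z. K (- z)))) \<longlonglongrightarrow> 0 + 0"
      by (intro tendsto_intros small_term_tendsto U K Kr R Rr)
    show "\<forall>\<^sub>F n in sequentially. B1 + B2 - B3 - B4 \<le>
      doubled_integral T (small_term (1 / real (Suc n)) U U (\<lambda>s. ?\<sigma> (- s)) 1 K)
      + doubled_integral T (small_term (1 / real (Suc n)) U U ?\<sigma> 1 (\<lambda>z. K (- z)))"
      by (intro always_eventually allI ineq) simp
  qed simp
  let ?E = "mollified_dist K (\<lambda>x. u (x, T)) (\<lambda>x. u (x, T))"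
  have swT: "mollified_dist (\<lambda>z. K (- z)) (\<lambda>x. u (x, T)) (\<lambda>x. u (x, T)) = ?E"
    by (rule mollified_dist_swap[OF uT uT integrable_kernel])
  have sw0: "mollified_dist (\<lambda>z. K (- z)) u0 u0 = mollified_dist K u0 u0"
    by (rule mollified_dist_swap[OF u0(1) u0(1) integrable_kernel])
  have late: "L1_norm (\<lambda>x. u (x, T) - U (x, t)) < e" if "t \<in> {0<..<T}" "\<bar>t - T\<bar> < \<delta>" for t
    using d(2)[of T t] that \<delta> by (auto simp: Us[OF that(1)] abs_minus_commute U_def cut_def)
  have early: "L1_norm (\<lambda>x. U (x, t) - u0 x) < e" if t: "t \<in> {0<..<T}" "\<bar>t\<bar> < \<delta>" for t
  proof -
    have "L1_norm (\<lambda>x. u (x, t) - u0 x) \<le> L1_norm (\<lambda>x. u (x, t) - u (x, 0)) + L1_norm (\<lambda>x. u (x, 0) - u0 x)"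
      by (rule L1_norm_triangle) (use ui[of t] ui[of 0] t T_pos u0 in auto)
    then show ?thesis using d(2)[of t 0] t \<delta> u0(2) by (auto simp: U_def cut_def)
  qed
  have near: "\<bar>x\<bar> < \<delta>" if "?\<sigma> x \<noteq> 0" for x
    using R(4)[of x] that by force
  have \<sigma>i: "set_integrable lborel {0<..<T} (\<lambda>t. ?\<sigma> (c + t))" "set_integrable lborel {0<..<T} (\<lambda>t. ?\<sigma> (c - t))" for c
    unfolding set_integrable_def
    by (intro integrable_mult_indicator lborel_integrable_translate Cc_infinity_integrable[OF R(1)]; simp)+
  have si: "set_integrable lborel {0<..<T} (\<lambda>t. ?\<sigma> (c + k * t) * mollified_dist H g (\<lambda>x. U (x, t)))"
    if "integrable lborel g" "integrable lborel H" for c k g H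
    by (rule slice_Fubini(5)[OF U(1) Ut that T_pos, of "\<lambda>t. ?\<sigma> (c + k * t)" S]) (use S in auto)
  have "a * (?E - e) \<le> B1"
    unfolding B1_def ab(4)[symmetric]
  proof (rule weighted_average_bounds(1))
    show "?E - e \<le> mollified_dist K (\<lambda>x. u (x, T)) (\<lambda>x. U (x, t))" if t: "t \<in> {0<..<T}" "?\<sigma> (t - T) \<noteq> 0" for t
      using mollified_dist_le[OF uT uT uT Ut[OF t(1)]] late[OF t(1) near[OF t(2)]] by simp
  qed (use \<sigma>i(1)[of "-T"] si[OF uT integrable_kernel, of "-T" 1] R(2) in simp_all)
  moreover have "b * (?E - e) \<le> B2"
    unfolding B2_def ab(5)[symmetric]
  proof (rule weighted_average_bounds(1))
    show "?E - e \<le> mollified_dist (\<lambda>z. K (- z)) (\<lambda>x. u (x, T)) (\<lambda>x. U (x, t))" if t: "t \<in> {0<..<T}" "?\<sigma> (T - t) \<noteq> 0" for t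
      using K'.mollified_dist_le[OF uT uT uT Ut[OF t(1)]] late[OF t(1)] near[OF t(2)] swT by (simp add: abs_minus_commute)
  qed (use \<sigma>i(2)[of "T"] si[OF uT K'.integrable_kernel, of "T" "-1"] R(2) in simp_all)
  moreover have "B3 \<le> b * (mollified_dist K u0 u0 + e)"
    unfolding B3_def ab(6)[symmetric]
  proof (rule weighted_average_bounds(2))
    show "mollified_dist K u0 (\<lambda>x. U (x, t)) \<le> mollified_dist K u0 u0 + e" if t: "t \<in> {0<..<T}" "?\<sigma> t \<noteq> 0" for t
      using mollified_dist_le[OF u0(1) u0(1) Ut[OF t(1)] u0(1)] early[OF t(1) near[OF t(2)]] by simp
  qed (use \<sigma>i(1)[of 0] si[OF u0(1) integrable_kernel, of 0 1] R(2) in simp_all)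
  moreover have "B4 \<le> a * (mollified_dist K u0 u0 + e)"
    unfolding B4_def ab(7)[symmetric]
  proof (rule weighted_average_bounds(2))
    show "mollified_dist (\<lambda>z. K (- z)) u0 (\<lambda>x. U (x, t)) \<le> mollified_dist K u0 u0 + e" if t: "t \<in> {0<..<T}" "?\<sigma> (- t) \<noteq> 0" for t
      using K'.mollified_dist_le[OF u0(1) u0(1) Ut[OF t(1)] u0(1)] early[OF t(1)] near[OF t(2)] sw0 by simp
  qed (use \<sigma>i(2)[of 0] si[OF u0(1) K'.integrable_kernel, of 0 "-1"] R(2) in simp_all)
  ultimately have "(a + b) * (?E - e) \<le> (a + b) * (mollified_dist K u0 u0 + e)"
    using le0 unfolding distrib_right by linarith
  then show "?E \<le> mollified_dist K u0 u0 + e0" unfolding ab(3) by (simp add: e_def)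
qed

end

section \<open>The comparison estimate\<close>

lemma Q_times_borel: "Q T \<times> Q T \<in> sets lborel" "UNIV \<times> Q T \<in> sets (lborel :: ('b::euclidean_space \<times> 'a::euclidean_space \<times> real) measure)"
  unfolding Q_def sets_lborel by (intro borel_open open_Times; simp)+

theorem lemma3p1:
  fixes T r \<epsilon> \<delta> :: real
    and f :: "real \<Rightarrow> 'a::euclidean_space"
    and A :: "real \<Rightarrow> real"
    and \<mu> :: "'a measure"
    and u0 v0 :: "'a \<Rightarrow> real"
    and u v :: "'a \<times> real \<Rightarrow> real"
    and \<theta>1 :: "real \<Rightarrow> real"
    and \<theta>d :: "'a \<Rightarrow> real"
  assumes T: "T > 0"
    and f: "W1_infinity f" "f 0 = 0"
    and A: "W1_infinity A" "mono A" "A 0 = 0"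
    and u0: "L_infinity lborel u0" "integrable lborel u0" "total_variation u0 < \<infinity>"
    and \<mu>: "levy_measure \<mu>"
    and u: "entropy_solution T f A \<mu> u0 u"
    and v: "Linf_C_L1 T v"
    and v0: "integrable lborel v0" "AE x in lborel. v (x, 0) = v0 x"
    and kernels: "mollifier_kernel \<theta>1" "mollifier_kernel \<theta>d"
    and r: "r > 0" and \<epsilon>: "\<epsilon> > 0" and \<delta>: "0 < \<delta>" "\<delta> < T"
  defines "\<phi> \<equiv> doubling_test \<theta>1 \<theta>d \<epsilon> \<delta>"
    and "C\<theta> \<equiv> 2 * (LINT x|lborel. norm x * \<theta>d x)"
  shows "L1_norm (\<lambda>x. u (x, T) - v (x, T))
    \<le> L1_norm (\<lambda>x. u0 x - v0 x) + \<epsilon> * C\<theta> * BV_seminorm u0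
        + 2 * max (modulus T u \<delta>) (modulus T v \<delta>)
      - (LINT ((x, t), (y, s)):Q T \<times> Q T|lborel.
            \<bar>v (x, t) - u (y, s)\<bar> * deriv (\<lambda>\<tau>. \<phi> x \<tau> y s) t)
      - (LINT ((x, t), (y, s)):Q T \<times> Q T|lborel.
            (entropy_flux f (v (x, t)) (u (y, s))
              + \<bar>A (v (x, t)) - A (u (y, s))\<bar> *\<^sub>R levy_drift (dual \<mu>) r)
            \<bullet> grad (\<lambda>\<xi>. \<phi> \<xi> t y s) x)
      + (LINT ((x, t), (y, s)):Q T \<times> Q T|lborel.
            \<bar>A (v (x, t)) - A (u (y, s))\<bar> * levy_small (dual \<mu>) r (\<lambda>\<eta>. \<phi> x t \<eta> s) y)
      - (LINT ((x, t), (y, s)):Q T \<times> Q T|lborel.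
            sgn (v (x, t) - u (y, s)) * levy_large \<mu> r (\<lambda>\<eta>. A (u (\<eta>, s))) y * \<phi> x t y s)
      + (LINT (x, (y, s)):UNIV \<times> Q T|lborel. \<bar>v (x, T) - u (y, s)\<bar> * \<phi> x T y s)
      - (LINT (x, (y, s)):UNIV \<times> Q T|lborel. \<bar>v0 x - u (y, s)\<bar> * \<phi> x 0 y s)"
proof -
  \<comment> \<open>The time kernel of the theorem doubles as the bump function for testing the weak
    derivatives of \<open>f\<close> and \<open>A\<close>.\<close>
  obtain Lf where Lf: "Lf \<ge> 0" "\<And>a b. norm (f a - f b) \<le> Lf * \<bar>a - b\<bar>"
    using W1_infinity_Lipschitz[OF kernels(1) f(1)] by blast
  obtain LA where LA: "LA \<ge> 0" "\<And>a b. norm (A a - A b) \<le> LA * \<bar>a - b\<bar>"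
    using W1_infinity_Lipschitz[OF kernels(1) A(1)] by blast
  obtain M where M: "\<And>x. norm (A x) \<le> M" using W1_infinity_bounded[OF A(1)] by blast
  interpret doubling T f A \<mu> "Lf + LA" M
  proof
    show "norm (f a - f b) \<le> (Lf + LA) * \<bar>a - b\<bar>" for a b
      using Lf(2)[of a b] LA(1) by (simp add: distrib_right add_increasing2)
    show "\<bar>A a - A b\<bar> \<le> (Lf + LA) * \<bar>a - b\<bar>" for a b
      using LA(2)[of a b] Lf(1) by (simp add: distrib_right add_increasing)
  qed (use T A \<mu> Lf LA M in auto)
  define K where "K = rescaled \<theta>d \<epsilon>"
  define \<sigma> where "\<sigma> = rescaled \<theta>1 \<delta>"
  have \<phi>: "\<phi> x t y s = \<sigma> (t - s) * K (x - y)" for x t y s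
    by (simp add: \<phi>_def doubling_test_def K_def \<sigma>_def)
  interpret averaging_kernel K unfolding K_def by (rule averaging_kernel_rescaled[OF kernels(2) \<epsilon>])
  have K: "K \<in> Cc_infinity" unfolding K_def by (rule mollifier_rescaled(1)[OF kernels(2) \<epsilon>])
  note R = mollifier_rescaled[OF kernels(1) \<delta>(1), folded \<sigma>_def]
  note Rr = Cc_infinity_reflect[OF R(1)]
  obtain S where S: "S \<ge> 0" "\<And>x. \<bar>\<sigma> x\<bar> \<le> S" using Cc_infinity_bounded[OF R(1)] by blast
  have [measurable]: "\<sigma> \<in> borel_measurable borel" by (rule Cc_infinity_borel[OF R(1)])
  obtain a b where ab: "a \<ge> 0" "b \<ge> 0" "a + b = 1"
    "(LINT t:{0<..<T}|lborel. \<sigma> (t - T)) = a" "(LINT t:{0<..<T}|lborel. \<sigma> (T - t)) = b"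
    "(LINT t:{0<..<T}|lborel. \<sigma> t) = b" "(LINT t:{0<..<T}|lborel. \<sigma> (- t)) = a"
    using time_weights[OF kernels(1) \<delta>] unfolding \<sigma>_def by blast
  have Lc: "Linf_C_L1 T u" using u by (simp add: entropy_solution_def)
  have T0: "T \<in> {0..T}" "0 \<in> {0..T}" using T by auto
  have ui: "integrable lborel (\<lambda>x. u (x, t))" and vi: "integrable lborel (\<lambda>x. v (x, t))" if "t \<in> {0..T}" for t
    using Linf_C_L1_integrable[OF Lc that] Linf_C_L1_integrable[OF v that] .
  note uT = ui[OF T0(1)] and vT = vi[OF T0(1)]
  \<comment> \<open>Needed because the modulus of continuity compares \<open>U\<close> near time 0
    with \<open>u (., 0)\<close>, while the inequality and the claim contain
    \<open>u0\<close>.\<close>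
  have init_u: "L1_norm (\<lambda>x. u (x, 0) - u0 x) = 0"
    by (rule initial_value[OF kernels u u0(2,3)])
  have init_v: "L1_norm (\<lambda>x. v (x, 0) - v0 x) = 0"
    by (rule integral_eq_zero_AE) (use v0(2) in eventually_elim, simp)
  define U where "U = cut T u"
  define V where "V = cut T v"
  have U: "integrable lborel U" "\<And>p. p \<in> Q T \<Longrightarrow> U p = u p"
    unfolding U_def by (intro cut_integrable Linf_C_L1_set_integrable[OF Lc]) (rule cut_eq)
  have V: "integrable lborel V" "\<And>p. p \<in> Q T \<Longrightarrow> V p = v p"
    unfolding V_def by (intro cut_integrable Linf_C_L1_set_integrable[OF v]) (rule cut_eq)
  have Us: "(\<lambda>x. U (x, t)) = (\<lambda>x. u (x, t))" and Vs: "(\<lambda>x. V (x, t)) = (\<lambda>x. v (x, t))" if "t \<in> {0<..<T}" for t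
    using that by (simp_all add: U_def V_def cut_slice)
  have Ut: "integrable lborel (\<lambda>x. U (x, t))" and Vt: "integrable lborel (\<lambda>x. V (x, t))" if "t \<in> {0<..<T}" for t
    using that ui[of t] vi[of t] by (simp_all add: Us Vs)
  have Um: "U \<in> borel_measurable borel" using borel_measurable_integrable[OF U(1)] by simp
  let ?b = "levy_drift (dual \<mu>) r"
  \<comment> \<open>\<open>doubled_entropy_inequality\<close> is written with argument
    \<open>s - t\<close>, the test function of the theorem with \<open>t - s\<close>; the time
    kernel is reflected accordingly.\<close>
  let ?\<tau> = "\<lambda>s. \<sigma> (- s)"
  have d: "deriv (\<lambda>\<tau>. \<phi> x \<tau> y s) t = deriv \<sigma> (t - s) * K (x - y)" for x t y s
  proof (rule DERIV_imp_deriv)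
    have "((\<lambda>\<tau>. \<tau> - s) has_real_derivative 1) (at t)" by (auto intro!: derivative_eq_intros)
    from DERIV_cmult_right[OF DERIV_chain2[OF Cc_infinity_has_real_derivative[OF R(1)] this]]
    show "((\<lambda>\<tau>. \<phi> x \<tau> y s) has_real_derivative deriv \<sigma> (t - s) * K (x - y)) (at t)" by (simp add: \<phi>)
  qed
  have g: "grad (\<lambda>\<xi>. \<phi> \<xi> t y s) x = \<sigma> (t - s) *\<^sub>R grad K (x - y)" for x t y s
    unfolding \<phi> by (rule grad_translate[OF K])
  have l: "levy_small (dual \<mu>) r (\<lambda>\<eta>. \<phi> x t \<eta> s) y = \<sigma> (t - s) * small_jump (dual \<mu>) r K (x - y)" for x t y s
    unfolding \<phi> by (rule levy_small_reflect[OF K])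
  have n: "levy_large \<mu> r (\<lambda>\<eta>. A (u (\<eta>, s))) y = nonlocal r U (y, s)" if "(y, s) \<in> Q T" for y s
  proof -
    have "(\<lambda>\<eta>. A (u (\<eta>, s))) = (\<lambda>\<eta>. A (U (\<eta>, s)))" using that U(2) by (auto simp: mem_Q)
    then show ?thesis using levy_large_nonlocal[OF Um r, of s y] by simp
  qed
  have sgn_swap: "sgn (u (y, s) - v (x, t)) = - sgn (v (x, t) - u (y, s))" for x t y s
    using sgn_minus[of "v (x, t) - u (y, s)"] by simp
  have flux_swap: "entropy_flux f k l + \<bar>A k - A l\<bar> *\<^sub>R ?b = flux ?b l k" for k l
    using flux_sym[of ?b k l] by (simp only: flux_def[of _ k l])
  \<comment> \<open>The minus sign converts the derivative in \<open>s\<close>, which the inequality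
    of \<open>u\<close> produces, into the derivative in \<open>t\<close> of the claim.\<close>
  have S1: "(LINT ((x, t), (y, s)):Q T \<times> Q T|lborel. \<bar>v (x, t) - u (y, s)\<bar> * deriv (\<lambda>\<tau>. \<phi> x \<tau> y s) t)
      = - doubled_integral T (time_term U V ?\<tau> 1 K)"
  proof -
    have "(LINT ((x, t), (y, s)):Q T \<times> Q T|lborel. \<bar>v (x, t) - u (y, s)\<bar> * deriv (\<lambda>\<tau>. \<phi> x \<tau> y s) t)
        = (LINT z:Q T \<times> Q T|lborel. - time_term U V ?\<tau> 1 K z)"
      by (rule set_lebesgue_integral_cong[OF Q_times_borel(1)])
        (auto simp: d time_term_def U(2) V(2) deriv_reflect[OF R(1)] abs_minus_commute)
    then show ?thesis by (simp add: set_lebesgue_integral_def)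
  qed
  \<comment> \<open>The flux is symmetric in its two states, so exchanging \<open>u\<close> and
    \<open>v\<close> leaves no trace.\<close>
  have S2: "(LINT ((x, t), (y, s)):Q T \<times> Q T|lborel.
            (entropy_flux f (v (x, t)) (u (y, s)) + \<bar>A (v (x, t)) - A (u (y, s))\<bar> *\<^sub>R ?b) \<bullet> grad (\<lambda>\<xi>. \<phi> \<xi> t y s) x)
      = doubled_integral T (flux_term ?b U V ?\<tau> 1 K)"
    by (rule set_lebesgue_integral_cong[OF Q_times_borel(1)]) (auto simp: flux_swap g flux_term_def U(2) V(2))
  have S3: "(LINT ((x, t), (y, s)):Q T \<times> Q T|lborel.
            \<bar>A (v (x, t)) - A (u (y, s))\<bar> * levy_small (dual \<mu>) r (\<lambda>\<eta>. \<phi> x t \<eta> s) y)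
      = doubled_integral T (small_term r U V ?\<tau> 1 K)"
    by (rule set_lebesgue_integral_cong[OF Q_times_borel(1)])
      (auto simp: l small_term_def U(2) V(2) abs_minus_commute)
  have S4: "(LINT ((x, t), (y, s)):Q T \<times> Q T|lborel.
            sgn (v (x, t) - u (y, s)) * levy_large \<mu> r (\<lambda>\<eta>. A (u (\<eta>, s))) y * \<phi> x t y s)
      = - doubled_integral T (large_term r U V ?\<tau> 1 K)"
  proof -
    have "(LINT ((x, t), (y, s)):Q T \<times> Q T|lborel.
            sgn (v (x, t) - u (y, s)) * levy_large \<mu> r (\<lambda>\<eta>. A (u (\<eta>, s))) y * \<phi> x t y s)
        = (LINT z:Q T \<times> Q T|lborel. - large_term r U V ?\<tau> 1 K z)"
      by (rule set_lebesgue_integral_cong[OF Q_times_borel(1)])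
        (auto simp: n \<phi> large_term_def U(2) V(2) sgn_swap)
    then show ?thesis by (simp add: set_lebesgue_integral_def)
  qed
  have Kr: "integrable lborel (\<lambda>z. K (- z))"
    using averaging_kernel.integrable_kernel[OF averaging_kernel_reflect[OF averaging_kernel_axioms]] .
  \<comment> \<open>The integration variable carrying time is now \<open>(y, s)\<close>. The pair is
    swapped to fit \<open>slice_Fubini\<close>, and \<open>mollified_dist_swap\<close> then removes
    the resulting reflection of the kernel.\<close>
  have slice: "(LINT (x, (y, s)):UNIV \<times> Q T|lborel. \<bar>w x - u (y, s)\<bar> * \<phi> x t y s)
      = (LINT s:{0<..<T}|lborel. \<sigma> (t - s) * mollified_dist K (\<lambda>x. U (x, s)) w)"
    if w: "integrable lborel w" for w t
  proof -
    note F = slice_Fubini[OF U(1) Ut w Kr T, of "\<lambda>s. \<sigma> (t - s)" S]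
    have "(LINT (x, (y, s)):UNIV \<times> Q T|lborel. \<bar>w x - u (y, s)\<bar> * \<phi> x t y s)
        = (LINT z:UNIV \<times> Q T|lborel. \<bar>w (fst z) - U (snd z)\<bar> * (\<sigma> (t - snd (snd z)) * K (- (fst (snd z) - fst z))))"
      by (rule set_lebesgue_integral_cong[OF Q_times_borel(2)]) (auto simp: \<phi> U(2))
    also have "\<dots> = (LINT z:Q T \<times> UNIV|lborel. \<bar>w (snd z) - U (fst z)\<bar> * (\<sigma> (t - snd (fst z)) * K (- (fst (fst z) - snd z))))"
      using set_integral_swap(1)[OF F(1)] S by simp
    also have "\<dots> = (LINT s:{0<..<T}|lborel. \<sigma> (t - s) * mollified_dist (\<lambda>z. K (- z)) w (\<lambda>x. U (x, s)))"
      by (rule F(3)) (use S in auto)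
    also have "\<dots> = (LINT s:{0<..<T}|lborel. \<sigma> (t - s) * mollified_dist K (\<lambda>x. U (x, s)) w)"
      by (rule set_lebesgue_integral_cong) (auto simp: mollified_dist_swap[OF Ut w integrable_kernel])
    finally show ?thesis .
  qed
  \<comment> \<open>\<open>BT\<close> and \<open>B0\<close> are the boundary terms of the inequality
    of \<open>u\<close>, with \<open>u\<close> frozen at an end point. \<open>CT\<close> and
    \<open>C0\<close> are the boundary terms in the claim, with \<open>v\<close> frozen. All four
    reduce to two mollified distances, one per end.\<close>
  define BT where "BT = (LINT t:{0<..<T}|lborel. \<sigma> (t - T) * mollified_dist K (\<lambda>x. u (x, T)) (\<lambda>x. V (x, t)))"
  define B0 where "B0 = (LINT t:{0<..<T}|lborel. \<sigma> t * mollified_dist K u0 (\<lambda>x. V (x, t)))"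
  define CT where "CT = (LINT s:{0<..<T}|lborel. \<sigma> (T - s) * mollified_dist K (\<lambda>x. U (x, s)) (\<lambda>x. v (x, T)))"
  define C0 where "C0 = (LINT s:{0<..<T}|lborel. \<sigma> (- s) * mollified_dist K (\<lambda>x. U (x, s)) v0)"
  have S5: "(LINT (x, (y, s)):UNIV \<times> Q T|lborel. \<bar>v (x, T) - u (y, s)\<bar> * \<phi> x T y s) = CT"
    unfolding CT_def by (rule slice[OF vT])
  have S6: "(LINT (x, (y, s)):UNIV \<times> Q T|lborel. \<bar>v0 x - u (y, s)\<bar> * \<phi> x 0 y s) = C0"
    using slice[OF v0(1), of 0] by (simp add: C0_def)
  have main: "0 \<le> doubled_integral T (time_term U V ?\<tau> 1 K)
      - doubled_integral T (flux_term ?b U V ?\<tau> 1 K)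
      + doubled_integral T (small_term r U V ?\<tau> 1 K)
      + doubled_integral T (large_term r U V ?\<tau> 1 K) - BT + B0"
    using doubled_entropy_inequality[OF u u0(2) U V(1) Vt K kernel_nonneg Rr R(2) r, of 1]
    by (simp add: BT_def B0_def)
  define \<omega>u where "\<omega>u = modulus T u \<delta>"
  define \<omega>v where "\<omega>v = modulus T v \<delta>"
  have near: "\<bar>x\<bar> < \<delta>" if "\<sigma> x \<noteq> 0" for x
    using R(4)[of x] that by force
  have \<sigma>i: "set_integrable lborel {0<..<T} (\<lambda>t. \<sigma> (c + t))" "set_integrable lborel {0<..<T} (\<lambda>t. \<sigma> (c - t))" for c
    unfolding set_integrable_def
    by (intro integrable_mult_indicator lborel_integrable_translate Cc_infinity_integrable[OF R(1)]; simp)+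
  have siV: "set_integrable lborel {0<..<T} (\<lambda>t. \<sigma> (c + k * t) * mollified_dist K w (\<lambda>x. V (x, t)))"
    if "integrable lborel w" for c k w
    by (rule slice_Fubini(5)[OF V(1) Vt that integrable_kernel T, of "\<lambda>t. \<sigma> (c + k * t)" S]) (use S in auto)
  have siU: "set_integrable lborel {0<..<T} (\<lambda>t. \<sigma> (c + k * t) * mollified_dist K (\<lambda>x. U (x, t)) w)"
    if w: "integrable lborel w" for c k w
  proof -
    have "set_integrable lborel {0<..<T} (\<lambda>t. \<sigma> (c + k * t) * mollified_dist (\<lambda>z. K (- z)) w (\<lambda>x. U (x, t)))"
      by (rule slice_Fubini(5)[OF U(1) Ut w Kr T, of "\<lambda>t. \<sigma> (c + k * t)" S]) (use S in auto)
    moreover have "set_integrable lborel {0<..<T} (\<lambda>t. \<sigma> (c + k * t) * mollified_dist (\<lambda>z. K (- z)) w (\<lambda>x. U (x, t)))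
        \<longleftrightarrow> set_integrable lborel {0<..<T} (\<lambda>t. \<sigma> (c + k * t) * mollified_dist K (\<lambda>x. U (x, t)) w)"
      by (rule set_integrable_cong) (auto simp: mollified_dist_swap[OF Ut w integrable_kernel])
    ultimately show ?thesis by simp
  qed
  let ?E = "mollified_dist K (\<lambda>x. u (x, T)) (\<lambda>x. v (x, T))"
  let ?P = "mollified_dist K u0 v0"
  have late_u: "L1_norm (\<lambda>x. u (x, T) - U (x, t)) \<le> \<omega>u" and late_v: "L1_norm (\<lambda>x. v (x, T) - V (x, t)) \<le> \<omega>v"
    if t: "t \<in> {0<..<T}" "\<bar>t - T\<bar> < \<delta>" for t
    using modulus_upper[OF Lc, of T t \<delta>] modulus_upper[OF v, of T t \<delta>] t
    by (auto simp: \<omega>u_def \<omega>v_def U_def V_def cut_def abs_minus_commute)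
  have early: "L1_norm (\<lambda>x. cut T w (x, t) - w0 x) \<le> modulus T w \<delta>"
    if t: "t \<in> {0<..<T}" "\<bar>t\<bar> < \<delta>" and w: "Linf_C_L1 T w" "integrable lborel w0" "L1_norm (\<lambda>x. w (x, 0) - w0 x) = 0"
    for t w and w0 :: "'a \<Rightarrow> real"
  proof -
    have "L1_norm (\<lambda>x. w (x, t) - w0 x) \<le> L1_norm (\<lambda>x. w (x, t) - w (x, 0)) + L1_norm (\<lambda>x. w (x, 0) - w0 x)"
      by (rule L1_norm_triangle) (use Linf_C_L1_integrable[OF w(1)] t w(2) in auto)
    then show ?thesis using modulus_upper[OF w(1), of t 0 \<delta>] t w(3) by (auto simp: cut_def)
  qed
  have total: "a * w + b * w = w" for w using ab(3) by (metis distrib_right mult_1)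
  \<comment> \<open>In \<open>BT\<close> only \<open>v\<close> has to be moved to time
    \<open>T\<close>, at the cost \<open>\<omega>v\<close>; in \<open>CT\<close> only
    \<open>u\<close>, at the cost \<open>\<omega>u\<close>. The same happens at time 0 with the
    weights exchanged.\<close>
  have "a * (?E - \<omega>v) \<le> BT"
    unfolding BT_def ab(4)[symmetric]
  proof (rule weighted_average_bounds(1))
    show "?E - \<omega>v \<le> mollified_dist K (\<lambda>x. u (x, T)) (\<lambda>x. V (x, t))" if t: "t \<in> {0<..<T}" "\<sigma> (t - T) \<noteq> 0" for t
      using mollified_dist_le[OF uT uT vT Vt[OF t(1)]] late_v[OF t(1) near[OF t(2)]] by simp
  qed (use \<sigma>i(1)[of "-T"] siV[OF uT, of "-T" 1] R(2) in simp_all)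
  moreover have "b * (?E - \<omega>u) \<le> CT"
    unfolding CT_def ab(5)[symmetric]
  proof (rule weighted_average_bounds(1))
    show "?E - \<omega>u \<le> mollified_dist K (\<lambda>x. U (x, t)) (\<lambda>x. v (x, T))" if t: "t \<in> {0<..<T}" "\<sigma> (T - t) \<noteq> 0" for t
      using mollified_dist_le[OF uT Ut[OF t(1)] vT vT] late_u[OF t(1)] near[OF t(2)] by (simp add: abs_minus_commute)
  qed (use \<sigma>i(2)[of "T"] siU[OF vT, of "T" "-1"] R(2) in simp_all)
  moreover have "B0 \<le> b * (?P + \<omega>v)"
    unfolding B0_def ab(6)[symmetric]
  proof (rule weighted_average_bounds(2))
    show "mollified_dist K u0 (\<lambda>x. V (x, t)) \<le> ?P + \<omega>v" if t: "t \<in> {0<..<T}" "\<sigma> t \<noteq> 0" for t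
      using mollified_dist_le[OF u0(2) u0(2) Vt[OF t(1)] v0(1)] early[OF t(1) near[OF t(2)] v v0(1) init_v]
      by (simp add: V_def \<omega>v_def)
  qed (use \<sigma>i(1)[of 0] siV[OF u0(2), of 0 1] R(2) in simp_all)
  moreover have "C0 \<le> a * (?P + \<omega>u)"
    unfolding C0_def ab(7)[symmetric]
  proof (rule weighted_average_bounds(2))
    show "mollified_dist K (\<lambda>x. U (x, t)) v0 \<le> ?P + \<omega>u" if t: "t \<in> {0<..<T}" "\<sigma> (- t) \<noteq> 0" for t
      using mollified_dist_le[OF Ut[OF t(1)] u0(2) v0(1) v0(1)] early[OF t(1) _ Lc u0(2) init_u] near[OF t(2)]
      by (simp add: U_def \<omega>u_def)
  qed (use \<sigma>i(2)[of 0] siU[OF v0(1), of 0 "-1"] R(2) in simp_all)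
  moreover have "a * (?E - \<omega>v) + b * (?E - \<omega>u) = ?E - (a * \<omega>v + b * \<omega>u)"
    "b * (?P + \<omega>v) + a * (?P + \<omega>u) = ?P + (b * \<omega>v + a * \<omega>u)"
    using total[of ?E] total[of ?P] unfolding right_diff_distrib distrib_left by linarith+
  moreover have "a * \<omega>v + b * \<omega>u \<le> max \<omega>u \<omega>v" "b * \<omega>v + a * \<omega>u \<le> max \<omega>u \<omega>v"
    using ab by (intro convex_bound_le; simp)+
  \<comment> \<open>The self-distance of \<open>u (., T)\<close> is chosen, since nothing controls
    that of \<open>v (., T)\<close>.\<close>
  moreover have "L1_norm (\<lambda>x. u (x, T) - v (x, T)) \<le> ?E + mollified_dist K u0 u0"
    using L1_norm_le_mollified_dist(1)[OF uT vT]
      mollified_dist_self_le[OF kernels(1) u u0(2) init_u K averaging_kernel_axioms] by simp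
  moreover have "?P \<le> L1_norm (\<lambda>x. u0 x - v0 x) + mollified_dist K u0 u0"
    using mollified_dist_le[OF u0(2) u0(2) v0(1) u0(2)] by (simp add: L1_norm_sym[of v0])
  moreover have "2 * mollified_dist K u0 u0 \<le> \<epsilon> * C\<theta> * BV_seminorm u0"
    using mollified_dist_rescaled_BV[OF kernels(2) \<epsilon> u0(2,3)] by (simp add: K_def C\<theta>_def)
  ultimately show ?thesis
    using main unfolding S1 S2 S3 S4 S5 S6 \<omega>u_def[symmetric] \<omega>v_def[symmetric] by linarith
qed

end
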